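(* For all $0\le t<T<\infty$, the yield $Y(t,T)=-\frac{\log P(t,T)}{T-t}$ satisfies \[ Y(t,T)=\frac{A(t,T)}{T-t}+\frac{C(t,T)}{T-t}r(t)-\frac{U(t,T)}{T-t}. \] In particular, for all $T>0$, \[ Y(0,T)=\frac{A(0,T)}{T}+\frac{C(0,T)}{T}r(0). \]
   Context: Let $\{W^*(t)\}_{t\ge 0}$ be a one-dimensional standard Brownian motion on a complete probability space $(\Omega,\mathcal{F},Q)$ and let $\{\mathcal{F}_t\}_{t\ge 0}$ be the $Q$-augmentation of the filtration it generates. Let $p,q$ be real numbers with $0<q<\infty$ and $-q<p<\infty$. Define \[ l(\tau)=1-\frac{2qp}{(p+2q)^2e^{2q\tau}-p^2}\quad(\tau\ge 0), \] \[ Z(t)=W^*(t)-\int_0^t\left\{\int_0^s pe^{-(p+q)(s-\tau)}l(\tau)\,dW^*(\tau)\right\}ds\quad(t\ge 0). \] $Z$ is an It\^o process, and integrals with respect to $dZ$ are It\^o integrals. Let $a,b,\sigma\in(0,\infty)$ and let $\{r(t)\}_{t\ge 0}$ (the short rate) be the unique strong solution of $dr(t)=\{a-br(t)\}dt+\sigma\,dZ(t)$, $t\ge 0$, with deterministic initial value $r(0)\in[0,\infty)$. $E^Q$ denotes expectation under $Q$. For $0\le t\le T$, the time $t$ price of the zero-coupon bond with maturity $T$ is $P(t,T)=E^Q\left[e^{-\int_t^T r(s)ds}\,\middle|\,\mathcal{F}_t\right]$. Further notation: $m(t):=\int_0^t pe^{-(p+q)s}\{1-e^{-b(t-s)}\}ds$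 for $t\ge 0$; \[ C(t,T):=\frac{1-e^{-b(T-t)}}{b}, \] \[ A(t,T):=\frac{a}{b}\left\{T-t-C(t,T)\right\}-\frac{\sigma^2}{2b^2}\int_0^{T-t}\left\{m(s)+e^{-bs}-1\right\}^2ds-\frac{\sigma^2 q\, m^2(T-t)}{b^2\{(p+2q)^2e^{2qt}-p^2\}}, \] \[ U(t,T):=\frac{\sigma(p+2q)^2e^{qt}m(T-t)}{b\{(p+2q)^2e^{2qt}-p^2\}}\int_0^t\left(e^{qs}-\frac{p}{p+2q}e^{-qs}\right)dZ(s). \] *)

theory Defs
  imports "HOL-Probability.Probability"
begin

section \<open>Brownian motion and its augmented filtration\<close>

text \<open>Processes are maps \<open>X :: real \<Rightarrow> 'a \<Rightarrow> real\<close> of which only the times \<open>t \<ge> 0\<close> matter.\<close>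

definition standard_brownian_motion :: "'a measure \<Rightarrow> (real \<Rightarrow> 'a \<Rightarrow> real) \<Rightarrow> bool" where
  "standard_brownian_motion M W \<longleftrightarrow>
     (\<forall>t\<ge>0. W t \<in> borel_measurable M) \<and>
     (AE \<omega> in M. W 0 \<omega> = 0) \<and>
     (AE \<omega> in M. continuous_on {0..} (\<lambda>t. W t \<omega>)) \<and>
     (\<forall>s t. 0 \<le> s \<and> s < t \<longrightarrow>
        distributed M lborel (\<lambda>\<omega>. W t \<omega> - W s \<omega>) (normal_density 0 (sqrt (t - s)))) \<and>
     (\<forall>(n::nat) \<tau>. 0 \<le> \<tau> 0 \<and> (\<forall>i<n. \<tau> i \<le> \<tau> (Suc i)) \<longrightarrow>
        prob_space.indep_vars M (\<lambda>_. borel) (\<lambda>i \<omega>. W (\<tau> (Suc i)) \<omega> - W (\<tau> i) \<omega>) {..<n})"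

definition augmented_filtration :: "'a measure \<Rightarrow> (real \<Rightarrow> 'a \<Rightarrow> real) \<Rightarrow> real \<Rightarrow> 'a measure" where
  "augmented_filtration M W t =
     sigma (space M)
       ({W s -` B \<inter> space M | s B. 0 \<le> s \<and> s \<le> t \<and> B \<in> sets borel} \<union> null_sets M)"

definition adapted :: "(real \<Rightarrow> 'a measure) \<Rightarrow> (real \<Rightarrow> 'a \<Rightarrow> real) \<Rightarrow> bool" where
  "adapted F X \<longleftrightarrow> (\<forall>t\<ge>0. X t \<in> borel_measurable (F t))"

definition progressively_measurable :: "(real \<Rightarrow> 'a measure) \<Rightarrow> (real \<Rightarrow> 'a \<Rightarrow> real) \<Rightarrow> bool" where
  "progressively_measurable F X \<longleftrightarrow>
     (\<forall>T\<ge>0. (\<lambda>(s, \<omega>). X s \<omega>) \<in> borel_measurable (restrict_space borel {0..T} \<Otimes>\<^sub>M F T))"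

section \<open>The Ito integral\<close>

text \<open>The triple \<open>n\<close>, \<open>\<tau>\<close>, \<open>\<xi>\<close> represents the simple process that takes the value \<open>\<xi> i\<close> on
  the interval \<open>(\<tau> i, \<tau> (i + 1)]\<close> for \<open>i < n\<close>, and the value 0 elsewhere.\<close>

definition simple_integrand ::
    "'a measure \<Rightarrow> (real \<Rightarrow> 'a measure) \<Rightarrow> nat \<Rightarrow> (nat \<Rightarrow> real) \<Rightarrow> (nat \<Rightarrow> 'a \<Rightarrow> real) \<Rightarrow> bool" where
  "simple_integrand M F n \<tau> \<xi> \<longleftrightarrow>
     0 \<le> \<tau> 0 \<and> (\<forall>i<n. \<tau> i \<le> \<tau> (Suc i)) \<and>
     (\<forall>i<n. \<xi> i \<in> borel_measurable (F (\<tau> i)) \<and> (\<exists>c. \<forall>\<omega>\<in>space M. \<bar>\<xi> i \<omega>\<bar> \<le> c))"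

definition simple_value ::
    "nat \<Rightarrow> (nat \<Rightarrow> real) \<Rightarrow> (nat \<Rightarrow> 'a \<Rightarrow> real) \<Rightarrow> real \<Rightarrow> 'a \<Rightarrow> real" where
  "simple_value n \<tau> \<xi> s \<omega> = (\<Sum>i<n. \<xi> i \<omega> * indicator {\<tau> i<..\<tau> (Suc i)} s)"

definition simple_ito_integral ::
    "(real \<Rightarrow> 'a \<Rightarrow> real) \<Rightarrow> nat \<Rightarrow> (nat \<Rightarrow> real) \<Rightarrow> (nat \<Rightarrow> 'a \<Rightarrow> real) \<Rightarrow> real \<Rightarrow> 'a \<Rightarrow> real" where
  "simple_ito_integral W n \<tau> \<xi> T \<omega> =
     (\<Sum>i<n. \<xi> i \<omega> * (W (min (\<tau> (Suc i)) T) \<omega> - W (min (\<tau> i) T) \<omega>))"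

text \<open>\<open>has_ito_integral M F W H T X\<close>: the random variable \<open>X\<close> is (a version of) the integral of
  \<open>H\<close> against \<open>dW\<close> over \<open>[0, T]\<close>, i.e. the limit in mean square of the integrals of simple
  processes that converge to \<open>H\<close> in mean square. As usual this determines \<open>X\<close> only up to
  null sets. Extended nonnegative integrals are used so that no integrability is presupposed;
  the convergence forces \<open>H\<close> to be square integrable on \<open>[0, T]\<close>.\<close>

definition has_ito_integral ::
    "'a measure \<Rightarrow> (real \<Rightarrow> 'a measure) \<Rightarrow> (real \<Rightarrow> 'a \<Rightarrow> real) \<Rightarrow> (real \<Rightarrow> 'a \<Rightarrow> real) \<Rightarrow>
     real \<Rightarrow> ('a \<Rightarrow> real) \<Rightarrow> bool" where
  "has_ito_integral M F W H T X \<longleftrightarrow>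
     progressively_measurable F H \<and> X \<in> borel_measurable M \<and>
     (\<exists>(n :: nat \<Rightarrow> nat) (\<tau> :: nat \<Rightarrow> nat \<Rightarrow> real) (\<xi> :: nat \<Rightarrow> nat \<Rightarrow> 'a \<Rightarrow> real).
        (\<forall>k. simple_integrand M F (n k) (\<tau> k) (\<xi> k)) \<and>
        (\<lambda>k. \<integral>\<^sup>+\<omega>. (\<integral>\<^sup>+s\<in>{0..T}. ennreal ((simple_value (n k) (\<tau> k) (\<xi> k) s \<omega> - H s \<omega>)\<^sup>2) \<partial>lborel) \<partial>M)
          \<longlonglongrightarrow> 0 \<and>
        (\<lambda>k. \<integral>\<^sup>+\<omega>. ennreal ((simple_ito_integral W (n k) (\<tau> k) (\<xi> k) T \<omega> - X \<omega>)\<^sup>2) \<partial>M)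
          \<longlonglongrightarrow> 0)"

section \<open>Ito processes and integrals against them\<close>

text \<open>\<open>Z\<close> is an Ito process with stochastic differential \<open>dZ = \<mu> dt + \<nu> dW\<close>.\<close>

definition ito_process ::
    "'a measure \<Rightarrow> (real \<Rightarrow> 'a measure) \<Rightarrow> (real \<Rightarrow> 'a \<Rightarrow> real) \<Rightarrow>
     (real \<Rightarrow> 'a \<Rightarrow> real) \<Rightarrow> (real \<Rightarrow> 'a \<Rightarrow> real) \<Rightarrow> (real \<Rightarrow> 'a \<Rightarrow> real) \<Rightarrow> bool" where
  "ito_process M F W \<mu> \<nu> Z \<longleftrightarrow>
     progressively_measurable F \<mu> \<and>
     (AE \<omega> in M. \<forall>t\<ge>0. set_integrable lborel {0..t} (\<lambda>s. \<mu> s \<omega>)) \<and>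
     adapted F Z \<and> (AE \<omega> in M. continuous_on {0..} (\<lambda>t. Z t \<omega>)) \<and>
     (\<forall>t\<ge>0. has_ito_integral M F W \<nu> t (\<lambda>\<omega>. Z t \<omega> - Z 0 \<omega> - (LBINT s:{0..t}. \<mu> s \<omega>)))"

text \<open>\<open>X\<close> is (a version of) the integral of \<open>H\<close> against \<open>dZ\<close> over \<open>[0, T]\<close>, where
  \<open>dZ = \<mu> dt + \<nu> dW\<close>; that is, \<open>X\<close> is the sum of the pathwise integral of \<open>H \<mu>\<close> and of the
  Ito integral of \<open>H \<nu>\<close>.\<close>

definition has_ito_process_integral ::
    "'a measure \<Rightarrow> (real \<Rightarrow> 'a measure) \<Rightarrow> (real \<Rightarrow> 'a \<Rightarrow> real) \<Rightarrow>
     (real \<Rightarrow> 'a \<Rightarrow> real) \<Rightarrow> (real \<Rightarrow> 'a \<Rightarrow> real) \<Rightarrow> (real \<Rightarrow> 'a \<Rightarrow> real) \<Rightarrow>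
     (real \<Rightarrow> 'a \<Rightarrow> real) \<Rightarrow> real \<Rightarrow> ('a \<Rightarrow> real) \<Rightarrow> bool" where
  "has_ito_process_integral M F W \<mu> \<nu> Z H T X \<longleftrightarrow>
     ito_process M F W \<mu> \<nu> Z \<and> progressively_measurable F H \<and>
     (AE \<omega> in M. set_integrable lborel {0..T} (\<lambda>s. H s \<omega> * \<mu> s \<omega>)) \<and>
     has_ito_integral M F W (\<lambda>s \<omega>. H s \<omega> * \<nu> s \<omega>) T
       (\<lambda>\<omega>. X \<omega> - (LBINT s:{0..T}. H s \<omega> * \<mu> s \<omega>))"

definition ito_process_integral ::
    "'a measure \<Rightarrow> (real \<Rightarrow> 'a measure) \<Rightarrow> (real \<Rightarrow> 'a \<Rightarrow> real) \<Rightarrow>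
     (real \<Rightarrow> 'a \<Rightarrow> real) \<Rightarrow> (real \<Rightarrow> 'a \<Rightarrow> real) \<Rightarrow> (real \<Rightarrow> 'a \<Rightarrow> real) \<Rightarrow>
     (real \<Rightarrow> 'a \<Rightarrow> real) \<Rightarrow> real \<Rightarrow> 'a \<Rightarrow> real" where
  "ito_process_integral M F W \<mu> \<nu> Z H T = (SOME X. has_ito_process_integral M F W \<mu> \<nu> Z H T X)"

text \<open>\<open>X\<close> is a strong solution of \<open>dX(t) = \<alpha>(t, X(t)) dt + \<beta>(t, X(t)) dZ(t)\<close>, \<open>X(0) = x0\<close>,
  where \<open>dZ = \<mu> dt + \<nu> dW\<close>. Adaptedness to the given \<open>F\<close> (in the application: the augmented
  filtration of the driving Brownian motion) is what makes the solution strong.\<close>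

definition strong_solution ::
    "'a measure \<Rightarrow> (real \<Rightarrow> 'a measure) \<Rightarrow> (real \<Rightarrow> 'a \<Rightarrow> real) \<Rightarrow>
     (real \<Rightarrow> 'a \<Rightarrow> real) \<Rightarrow> (real \<Rightarrow> 'a \<Rightarrow> real) \<Rightarrow> (real \<Rightarrow> 'a \<Rightarrow> real) \<Rightarrow>
     (real \<Rightarrow> real \<Rightarrow> real) \<Rightarrow> (real \<Rightarrow> real \<Rightarrow> real) \<Rightarrow> real \<Rightarrow> (real \<Rightarrow> 'a \<Rightarrow> real) \<Rightarrow> bool" where
  "strong_solution M F W \<mu> \<nu> Z \<alpha> \<beta> x0 X \<longleftrightarrow>
     adapted F X \<and> (AE \<omega> in M. continuous_on {0..} (\<lambda>t. X t \<omega>)) \<and>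
     (AE \<omega> in M. X 0 \<omega> = x0) \<and>
     (AE \<omega> in M. \<forall>t\<ge>0. set_integrable lborel {0..t} (\<lambda>s. \<alpha> s (X s \<omega>))) \<and>
     (\<forall>t\<ge>0. has_ito_process_integral M F W \<mu> \<nu> Z (\<lambda>s \<omega>. \<beta> s (X s \<omega>)) t
        (\<lambda>\<omega>. X t \<omega> - x0 - (LBINT s:{0..t}. \<alpha> s (X s \<omega>))))"

section \<open>The bond market\<close>

definition kernel_l :: "real \<Rightarrow> real \<Rightarrow> real \<Rightarrow> real" where
  "kernel_l p q \<tau> = 1 - 2 * q * p / ((p + 2 * q)\<^sup>2 * exp (2 * q * \<tau>) - p\<^sup>2)"

definition bond_price ::
    "'a measure \<Rightarrow> (real \<Rightarrow> 'a measure) \<Rightarrow> (real \<Rightarrow> 'a \<Rightarrow> real) \<Rightarrow> real \<Rightarrow> real \<Rightarrow> 'a \<Rightarrow> real" where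
  "bond_price M F r t T = real_cond_exp M (F t) (\<lambda>\<omega>. exp (- (LBINT s:{t..T}. r s \<omega>)))"

definition bond_yield ::
    "'a measure \<Rightarrow> (real \<Rightarrow> 'a measure) \<Rightarrow> (real \<Rightarrow> 'a \<Rightarrow> real) \<Rightarrow> real \<Rightarrow> real \<Rightarrow> 'a \<Rightarrow> real" where
  "bond_yield M F r t T \<omega> = - (ln (bond_price M F r t T \<omega>) / (T - t))"

definition coef_m :: "real \<Rightarrow> real \<Rightarrow> real \<Rightarrow> real \<Rightarrow> real" where
  "coef_m p q b t = (LBINT s:{0..t}. p * exp (- (p + q) * s) * (1 - exp (- b * (t - s))))"

definition coef_C :: "real \<Rightarrow> real \<Rightarrow> real \<Rightarrow> real" where
  "coef_C b t T = (1 - exp (- b * (T - t))) / b"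

definition coef_A ::
    "real \<Rightarrow> real \<Rightarrow> real \<Rightarrow> real \<Rightarrow> real \<Rightarrow> real \<Rightarrow> real \<Rightarrow> real" where
  "coef_A p q a b \<sigma> t T =
     a / b * (T - t - coef_C b t T)
     - \<sigma>\<^sup>2 / (2 * b\<^sup>2) * (LBINT s:{0..T - t}. (coef_m p q b s + exp (- b * s) - 1)\<^sup>2)
     - \<sigma>\<^sup>2 * q * (coef_m p q b (T - t))\<^sup>2 / (b\<^sup>2 * ((p + 2 * q)\<^sup>2 * exp (2 * q * t) - p\<^sup>2))"

definition term_U ::
    "'a measure \<Rightarrow> (real \<Rightarrow> 'a measure) \<Rightarrow> (real \<Rightarrow> 'a \<Rightarrow> real) \<Rightarrow>
     (real \<Rightarrow> 'a \<Rightarrow> real) \<Rightarrow> (real \<Rightarrow> 'a \<Rightarrow> real) \<Rightarrow> (real \<Rightarrow> 'a \<Rightarrow> real) \<Rightarrow>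
     real \<Rightarrow> real \<Rightarrow> real \<Rightarrow> real \<Rightarrow> real \<Rightarrow> real \<Rightarrow> 'a \<Rightarrow> real" where
  "term_U M F W \<mu> \<nu> Z p q b \<sigma> t T \<omega> =
     \<sigma> * (p + 2 * q)\<^sup>2 * exp (q * t) * coef_m p q b (T - t)
       / (b * ((p + 2 * q)\<^sup>2 * exp (2 * q * t) - p\<^sup>2))
     * ito_process_integral M F W \<mu> \<nu> Z
         (\<lambda>s _. exp (q * s) - p / (p + 2 * q) * exp (- q * s)) t \<omega>"

end

theory Submission
  imports Defs
begin

text \<open>The driver is Gaussian with a memory that can be carried by one number. The kernel of \<open>V\<close>
factors as \<open>p e^(-(p+q)s)\<close> times \<open>e^((p+q)\<tau>) l(\<tau>)\<close>, so that
\<open>V(s) = p e^(-(p+q)s) N(s)\<close> with the Gaussian martingale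
\<open>N(s) = \<integral>\<^sub>0\<^sup>s e^((p+q)\<tau>) l(\<tau>) dW(\<tau>)\<close>. Everything that
is needed about the past up to time \<open>t\<close> is therefore contained in \<open>r(t)\<close> and \<open>N(t)\<close>.

All integrands that occur are deterministic and smooth. For such an integrand \<open>f\<close> the Ito
integral has a pathwise version, namely the one given by integration by parts,
\<open>f(\<beta>)W(\<beta>) - f(\<alpha>)W(\<alpha>) - \<integral> f' W\<close>. It is the limit of the forward sums
both along almost every path and in mean square
(\<open>left_sum_tendsto_path_integral\<close>, \<open>has_ito_integral_smooth\<close>), and by the Ito isometry it is almost
surely the only one (\<open>ito_integral_unique\<close>). Consequently \<open>V\<close>, \<open>Z\<close> and \<open>r\<close> are explicit
functionals of the path of \<open>W\<close>, and the stochastic differential equation becomes an integral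
equation for a continuous function.

Solving that equation with an integrating factor and interchanging the order of integration gives
(\<open>integrated_short_rate\<close>)
\<open>\<integral>\<^sub>t\<^sup>T r(s) ds = C(t,T) r(t) + a/b (T - t - C(t,T)) + \<sigma> (\<integral>\<^sub>t\<^sup>T v(s) dW(s) - k(t) N(t))\<close>
with deterministic \<open>v\<close> and \<open>k(t) = m(T-t) e^(-(p+q)t) / b\<close>. The stochastic integral is
independent of the past and Gaussian with variance \<open>\<integral> v\<^sup>2\<close>, because increments of \<open>W\<close> are
independent of the augmented filtration (\<open>increment_indep_past\<close>). Hence the conditional expectation of
\<open>exp(-\<integral> r)\<close> is the mean of a log-normal variable (\<open>cond_exp_exp_wint\<close>).

Two computations turn this into the stated formula. First, \<open>m' = p(1-e^(-b s)) - (p+q)m\<close> yields an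
antiderivative of \<open>v\<^sup>2\<close>, and the variance becomes the last two terms of \<open>A\<close>
(\<open>integral_vol_square\<close>). Secondly, \<open>N(t)\<close> is recovered from \<open>Z\<close>, since the weight
\<open>e^(qs) - p/(p+2q) e^(-qs)\<close> is chosen so that its integral against \<open>Z\<close> is a deterministic
multiple of \<open>N(t)\<close> (\<open>integral_against_drifted_path\<close>); this gives \<open>\<sigma> k(t) N(t) = U(t,T)\<close>.\<close>

section \<open>The augmented filtration\<close>

locale brownian = prob_space M + complete_measure M
  for M :: "'a measure" and W :: "real \<Rightarrow> 'a \<Rightarrow> real" +
  assumes bm: "standard_brownian_motion M W"
begin

abbreviation F :: "real \<Rightarrow> 'a measure" where "F \<equiv> augmented_filtration M W"

lemma W_measurable [measurable]: "0 \<le> t \<Longrightarrow> W t \<in> borel_measurable M"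
  using bm by (simp add: standard_brownian_motion_def)

lemma W_null: "AE \<omega> in M. W 0 \<omega> = 0"
  using bm by (simp add: standard_brownian_motion_def)

lemma W_cont: "AE \<omega> in M. continuous_on {0..} (\<lambda>t. W t \<omega>)"
  using bm by (simp add: standard_brownian_motion_def)

lemma W_increment_normal:
  "0 \<le> s \<Longrightarrow> s < t \<Longrightarrow>
     distributed M lborel (\<lambda>\<omega>. W t \<omega> - W s \<omega>) (normal_density 0 (sqrt (t - s)))"
  using bm by (simp add: standard_brownian_motion_def)

lemma W_increments_indep:
  "0 \<le> \<tau> 0 \<Longrightarrow> (\<And>i. i < n \<Longrightarrow> \<tau> i \<le> \<tau> (Suc i)) \<Longrightarrow>
     indep_vars (\<lambda>_. borel) (\<lambda>i \<omega>. W (\<tau> (Suc i)) \<omega> - W (\<tau> i) \<omega>) {..<n}"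
  using bm by (simp add: standard_brownian_motion_def)

lemma F_generators: "{W s -` B \<inter> space M | s B. 0 \<le> s \<and> s \<le> t \<and> B \<in> sets borel} \<union> null_sets M \<subseteq> sets M"
  by (auto intro!: measurable_sets[OF W_measurable])

lemma space_F [simp]: "space (F t) = space M"
  unfolding augmented_filtration_def
  using F_generators[of t] sets.space_closed[of M] by (intro space_measure_of) blast

lemma sets_F: "sets (F t) =
    sigma_sets (space M) ({W s -` B \<inter> space M | s B. 0 \<le> s \<and> s \<le> t \<and> B \<in> sets borel} \<union> null_sets M)"
  unfolding augmented_filtration_def
  using F_generators[of t] sets.space_closed[of M] by (intro sets_measure_of) blast

lemma sets_F_subset: "sets (F t) \<subseteq> sets M"
  unfolding sets_F using F_generators[of t] sets.sigma_sets_subset by blast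

lemma F_subalgebra: "subalgebra M (F t)"
  using sets_F_subset by (simp add: subalgebra_def)

lemma F_mono: "s \<le> t \<Longrightarrow> sets (F s) \<subseteq> sets (F t)"
  unfolding sets_F by (intro sigma_sets_mono' Un_mono order_refl Collect_mono)
    (auto, metis order_trans)

lemma W_F_measurable: "0 \<le> s \<Longrightarrow> s \<le> t \<Longrightarrow> W s \<in> borel_measurable (F t)"
  by (rule measurableI) (auto simp: sets_F intro!: sigma_sets.Basic)

lemma F_measurable_mono:
  "f \<in> borel_measurable (F s) \<Longrightarrow> s \<le> t \<Longrightarrow> f \<in> borel_measurable (F t)"
  using F_mono[of s t] unfolding measurable_def by auto

lemma F_measurable_M: "f \<in> borel_measurable (F s) \<Longrightarrow> f \<in> borel_measurable M"
  using measurable_from_subalg[OF F_subalgebra] .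

lemma M_measurable_AE_cong:
  assumes f: "(f :: 'a \<Rightarrow> 'b::topological_space) \<in> borel_measurable M" and eq: "AE \<omega> in M. f \<omega> = g \<omega>"
  shows "g \<in> borel_measurable M"
proof (rule measurableI)
  fix B :: "'b set" assume B: "B \<in> sets borel"
  have "f -` B \<inter> space M \<in> sets M" using measurable_sets[OF f B] .
  moreover have "AE \<omega> in M. \<omega> \<in> f -` B \<inter> space M \<longleftrightarrow> \<omega> \<in> g -` B \<inter> space M"
    using eq by eventually_elim auto
  ultimately show "g -` B \<inter> space M \<in> sets M"
    using in_sets_AE[of "f -` B \<inter> space M" "g -` B \<inter> space M"] by auto
qed simp

section \<open>Increments are independent of the augmented past\<close>

text \<open>The times in \<open>S\<close>, together with \<open>0\<close>, \<open>s\<close> and \<open>u\<close>, are sorted into one partition. Since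
\<open>W(0) = 0\<close> almost surely, the event on the past is a function of the increments before \<open>s\<close>, and
these are independent of the last one.\<close>

lemma past_event_indep_increment:
  assumes s: "0 \<le> s" "s \<le> u" and S: "finite S" "S \<subseteq> {0..s}"
    and B: "\<And>x. x \<in> S \<Longrightarrow> B x \<in> sets borel" and G: "G \<in> sets borel"
  shows "prob ({\<omega> \<in> space M. (\<forall>x\<in>S. W x \<omega> \<in> B x) \<and> W u \<omega> - W s \<omega> \<in> G})
    = prob {\<omega> \<in> space M. \<forall>x\<in>S. W x \<omega> \<in> B x} * prob {\<omega> \<in> space M. W u \<omega> - W s \<omega> \<in> G}"
proof -
  define L where "L = sorted_list_of_set (insert 0 (insert s S))"
  define N where "N = length L"
  have finL: "finite (insert 0 (insert s S))" using S by simp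
  have setL: "set L = insert 0 (insert s S)" unfolding L_def using finL by (rule set_sorted_list_of_set)
  have sortedL: "sorted L" unfolding L_def by simp
  have N0: "0 < N" using setL by (cases L) (auto simp: N_def)
  have range: "x \<in> set L \<Longrightarrow> 0 \<le> x \<and> x \<le> s" for x using setL S s by auto
  \<comment> \<open>Beyond the sorted list the partition has the single further point \<open>u\<close>.\<close>
  define \<tau> where "\<tau> i = (if i < N then L ! i else u)" for i
  have tau0: "\<tau> 0 = 0"
  proof -
    obtain i where i: "i < N" "L ! i = 0" using setL unfolding N_def by (metis in_set_conv_nth insertI1)
    have "L ! 0 \<le> L ! i" using sortedL i by (intro sorted_nth_mono) (auto simp: N_def)
    moreover have "L ! 0 \<in> set L" using N0 by (simp add: N_def)
    ultimately show ?thesis using range i N0 by (force simp: \<tau>_def)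
  qed
  have tau_last: "\<tau> (N - 1) = s"
  proof -
    obtain i where i: "i < N" "L ! i = s" using setL unfolding N_def by (metis in_set_conv_nth insert_iff)
    have "L ! i \<le> L ! (N - 1)" using sortedL i by (intro sorted_nth_mono) (auto simp: N_def)
    moreover have "L ! (N - 1) \<in> set L" using N0 by (simp add: N_def)
    ultimately show ?thesis using range i N0 by (force simp: \<tau>_def)
  qed
  have mono: "\<tau> i \<le> \<tau> (Suc i)" if "i < N" for i
  proof (cases "Suc i < N")
    case True then show ?thesis using sortedL that by (simp add: \<tau>_def sorted_nth_mono N_def)
  next
    case False
    then have "i = N - 1" "\<tau> (Suc i) = u" using that by (auto simp: \<tau>_def)
    then show ?thesis using tau_last s by simp
  qed
  define D where "D i \<omega> = W (\<tau> (Suc i)) \<omega> - W (\<tau> i) \<omega>" for i \<omega>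
  have ind: "indep_vars (\<lambda>_. borel) D {..<N}"
    unfolding D_def using tau0 mono by (intro W_increments_indep) auto
  have D_last: "D (N - 1) \<omega> = W u \<omega> - W s \<omega>" for \<omega>
    using tau_last N0 by (simp add: D_def \<tau>_def)
  have D_sum: "(\<Sum>i<k. D i \<omega>) = W (\<tau> k) \<omega> - W 0 \<omega>" for k \<omega>
    unfolding D_def using sum_lessThan_telescope[of "\<lambda>i. W (\<tau> i) \<omega>" k] tau0 by simp
  have "\<exists>k. k < N \<and> \<tau> k = x" if "x \<in> S" for x
  proof -
    have "x \<in> set L" using that setL by simp
    then show ?thesis unfolding N_def \<tau>_def in_set_conv_nth by auto
  qed
  then obtain k where k: "\<And>x. x \<in> S \<Longrightarrow> k x < N \<and> \<tau> (k x) = x" by metis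
  let ?I = "{..<N - 1}"
  let ?P = "PiM ?I (\<lambda>_. borel :: real measure)"
  have iv: "indep_var ?P (\<lambda>\<omega>. restrict (\<lambda>i. D i \<omega>) ?I)
      (PiM {N - 1} (\<lambda>_. borel)) (\<lambda>\<omega>. restrict (\<lambda>i. D i \<omega>) {N - 1})"
    using N0 by (intro indep_var_restrict[OF ind]) auto
  define A where "A = {x \<in> space ?P. \<forall>y\<in>S. (\<Sum>i<k y. x i) \<in> B y}"
  have A: "A \<in> sets ?P"
  proof -
    have "{x \<in> space ?P. (\<Sum>i<k y. x i) \<in> B y} \<in> sets ?P" if "y \<in> S" for y
    proof -
      have "(\<lambda>x. \<Sum>i<k y. x i) \<in> borel_measurable ?P"
        using k[OF that] by (intro borel_measurable_sum measurable_component_singleton) auto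
      from measurable_sets[OF this B[OF that]] show ?thesis
        by (simp add: vimage_def Int_def conj_commute)
    qed
    then show ?thesis unfolding A_def using S by (intro sets.sets_Collect_finite_All) auto
  qed
  define G' where "G' = {x \<in> space (PiM {N - 1} (\<lambda>_. borel :: real measure)). x (N - 1) \<in> G}"
  have G': "G' \<in> sets (PiM {N - 1} (\<lambda>_. borel))"
  proof -
    have "(\<lambda>x. x (N - 1)) \<in> measurable (PiM {N - 1} (\<lambda>_. borel :: real measure)) borel"
      by (intro measurable_component_singleton) auto
    from measurable_sets[OF this G] show ?thesis
      unfolding G'_def by (simp add: vimage_def Int_def conj_commute)
  qed
  let ?Q = "\<lambda>\<omega>. \<forall>x\<in>S. W x \<omega> - W 0 \<omega> \<in> B x"
  have sum_restrict: "(\<Sum>i<k y. restrict (\<lambda>i. D i \<omega>) ?I i) = W y \<omega> - W 0 \<omega>" if "y \<in> S" for y \<omega>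
  proof -
    have "(\<Sum>i<k y. restrict (\<lambda>i. D i \<omega>) ?I i) = (\<Sum>i<k y. D i \<omega>)"
      using k[OF that] by (intro sum.cong) auto
    then show ?thesis using D_sum k[OF that] by simp
  qed
  have "prob {\<omega> \<in> space M. ?Q \<omega> \<and> W u \<omega> - W s \<omega> \<in> G}
     = prob {\<omega> \<in> space M. ?Q \<omega>} * prob {\<omega> \<in> space M. W u \<omega> - W s \<omega> \<in> G}"
  proof -
    have 1: "(\<lambda>\<omega>. restrict (\<lambda>i. D i \<omega>) ?I) -` A \<inter> space M = {\<omega> \<in> space M. ?Q \<omega>}"
      unfolding A_def using sum_restrict by (auto simp: space_PiM)
    have 2: "(\<lambda>\<omega>. restrict (\<lambda>i. D i \<omega>) {N - 1}) -` G' \<inter> space M = {\<omega> \<in> space M. W u \<omega> - W s \<omega> \<in> G}"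
      unfolding G'_def using D_last by (auto simp: space_PiM)
    have 3: "(\<lambda>\<omega>. (restrict (\<lambda>i. D i \<omega>) ?I, restrict (\<lambda>i. D i \<omega>) {N - 1})) -` (A \<times> G') \<inter> space M =
        {\<omega> \<in> space M. ?Q \<omega> \<and> W u \<omega> - W s \<omega> \<in> G}"
      using 1 2 by auto
    show ?thesis using indep_varD[OF iv A G'] unfolding 1 2 3 .
  qed
  moreover have [measurable]: "W x \<in> borel_measurable M" if "x \<in> S" for x
    using S that by auto
  have [measurable]: "{\<omega> \<in> space M. \<forall>x\<in>S. W x \<omega> \<in> B x} \<in> sets M"
    using S B by (intro sets.sets_Collect_finite_All) (auto intro!: measurable_sets_Collect)
  have [measurable]: "{\<omega> \<in> space M. ?Q \<omega>} \<in> sets M"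
    using S B by (intro sets.sets_Collect_finite_All) (auto intro!: measurable_sets_Collect)
  have [measurable]: "{\<omega> \<in> space M. W u \<omega> - W s \<omega> \<in> G} \<in> sets M"
    using s G by (auto intro!: measurable_sets_Collect)
  have "prob {\<omega> \<in> space M. ?Q \<omega>} = prob {\<omega> \<in> space M. \<forall>x\<in>S. W x \<omega> \<in> B x}"
    using W_null by (intro measure_eq_AE) auto
  moreover have "prob {\<omega> \<in> space M. ?Q \<omega> \<and> W u \<omega> - W s \<omega> \<in> G} =
      prob {\<omega> \<in> space M. (\<forall>x\<in>S. W x \<omega> \<in> B x) \<and> W u \<omega> - W s \<omega> \<in> G}"
    using W_null by (intro measure_eq_AE) auto
  ultimately show ?thesis by simp
qed

text \<open>Finite-dimensional events on the past together with all null sets form an intersection-stable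
generator of the augmented \<open>\<sigma>\<close>-algebra, so independence extends from this generator.\<close>

lemma increment_indep_past:
  assumes s: "0 \<le> s" "s \<le> u"
  shows "indep_set (sets (F s)) (sigma_sets (space M) {(\<lambda>\<omega>. W u \<omega> - W s \<omega>) -` G \<inter> space M | G. G \<in> sets borel})"
proof -
  let ?D = "\<lambda>\<omega>. W u \<omega> - W s \<omega>"
  let ?E = "\<lambda>S B. {\<omega> \<in> space M. \<forall>x\<in>S. W x \<omega> \<in> B x}"
  define C where "C = {?E S B | S B. finite S \<and> S \<subseteq> {0..s} \<and> (\<forall>x\<in>S. B x \<in> sets (borel :: real measure))}"
  define P where "P = C \<union> null_sets M"
  define Q where "Q = {?D -` G \<inter> space M | G. G \<in> sets borel}"
  have C_sub: "C \<subseteq> events"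
  proof
    fix A assume "A \<in> C"
    then obtain S B where *: "A = ?E S B" "finite S" "S \<subseteq> {0..s}" "\<forall>x\<in>S. B x \<in> sets (borel :: real measure)"
      unfolding C_def by auto
    then have [measurable]: "W x \<in> borel_measurable M" if "x \<in> S" for x using that by auto
    show "A \<in> events" using *
      by (auto intro!: sets.sets_Collect_finite_All measurable_sets_Collect)
  qed
  have Q_sub: "Q \<subseteq> events"
  proof -
    have "?D \<in> borel_measurable M" using s by auto
    then show ?thesis unfolding Q_def by (auto intro: measurable_sets)
  qed
  have "indep_set P Q"
  proof (rule indep_setI)
    show "P \<subseteq> events" using C_sub by (auto simp: P_def)
    show "Q \<subseteq> events" by (rule Q_sub)
    fix x y assume x: "x \<in> P" and y: "y \<in> Q"
    obtain G where G: "y = ?D -` G \<inter> space M" "G \<in> sets borel" using y by (auto simp: Q_def)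
    show "prob (x \<inter> y) = prob x * prob y"
    proof (cases "x \<in> null_sets M")
      case True
      then have "x \<inter> y \<in> null_sets M" by (intro complete2[OF _ True]) auto
      then show ?thesis using True by (simp add: null_sets_def measure_def)
    next
      case False
      then obtain S B where *: "x = ?E S B" "finite S" "S \<subseteq> {0..s}" "\<forall>x\<in>S. B x \<in> sets (borel :: real measure)"
        using x unfolding P_def C_def by auto
      have "x \<inter> y = {\<omega> \<in> space M. (\<forall>x\<in>S. W x \<omega> \<in> B x) \<and> ?D \<omega> \<in> G}" "y = {\<omega> \<in> space M. ?D \<omega> \<in> G}"
        using * G by auto
      then show ?thesis using past_event_indep_increment[OF s *(2,3), of B G] * G by simp
    qed
  qed
  moreover have "Int_stable P"
  proof (rule Int_stableI)
    fix x y assume xy: "x \<in> P" "y \<in> P"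
    show "x \<inter> y \<in> P"
    proof (cases "x \<in> null_sets M \<or> y \<in> null_sets M")
      case True
      then have "x \<inter> y \<in> null_sets M" by (elim disjE) (auto intro: complete2)
      then show ?thesis by (simp add: P_def)
    next
      case False
      then obtain S B S' B' where *: "x = ?E S B" "finite S" "S \<subseteq> {0..s}" "\<forall>x\<in>S. B x \<in> sets (borel :: real measure)"
         "y = ?E S' B'" "finite S'" "S' \<subseteq> {0..s}" "\<forall>x\<in>S'. B' x \<in> sets (borel :: real measure)"
        using xy unfolding P_def C_def by auto
      let ?B = "\<lambda>x. (if x \<in> S then B x else UNIV) \<inter> (if x \<in> S' then B' x else UNIV)"
      have "x \<inter> y = ?E (S \<union> S') ?B" unfolding * by auto
      moreover have "?B z \<in> sets borel" if "z \<in> S \<union> S'" for z using * that by auto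
      ultimately have "x \<inter> y \<in> C" unfolding C_def using *
        by (intro CollectI exI[of _ "S \<union> S'"] exI[of _ ?B]) blast
      then show ?thesis by (simp add: P_def)
    qed
  qed
  moreover have "Int_stable Q"
  proof (rule Int_stableI)
    fix x y assume "x \<in> Q" "y \<in> Q"
    then obtain G G' where *: "x = ?D -` G \<inter> space M" "y = ?D -` G' \<inter> space M" "G \<in> sets borel" "G' \<in> sets borel"
      unfolding Q_def by blast
    then have "x \<inter> y = ?D -` (G \<inter> G') \<inter> space M" by auto
    then show "x \<inter> y \<in> Q" unfolding Q_def using * by blast
  qed
  ultimately have ind: "indep_set (sigma_sets (space M) P) (sigma_sets (space M) Q)"
    by (rule indep_set_sigma_sets)
  have "sets (F s) \<subseteq> sigma_sets (space M) P"
    unfolding sets_F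
  proof (intro sigma_sets_mono' subsetI)
    fix A assume A: "A \<in> {W x -` B \<inter> space M | x B. 0 \<le> x \<and> x \<le> s \<and> B \<in> sets borel} \<union> null_sets M"
    show "A \<in> P"
    proof (cases "A \<in> null_sets M")
      case False
      then obtain x B where *: "A = W x -` B \<inter> space M" "0 \<le> x" "x \<le> s" "B \<in> sets borel" using A by auto
      then have "A = ?E {x} (\<lambda>_. B)" by auto
      then have "A \<in> C" unfolding C_def using * by (intro CollectI exI[of _ "{x}"] exI[of _ "\<lambda>_. B"]) auto
      then show ?thesis by (simp add: P_def)
    qed (simp add: P_def)
  qed
  then show ?thesis using ind unfolding indep_sets2_eq Q_def by blast
qed

lemma indep_var_past_increment:
  assumes s: "0 \<le> s" "s \<le> u" and X: "X \<in> borel_measurable (F s)"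
  shows "indep_var borel X borel (\<lambda>\<omega>. W u \<omega> - W s \<omega>)"
  unfolding indep_var_eq
proof (intro conjI)
  show "random_variable borel X" using X by (rule F_measurable_M)
  show "random_variable borel (\<lambda>\<omega>. W u \<omega> - W s \<omega>)" using s by auto
  have "sigma_sets (space M) {X -` A \<inter> space M | A. A \<in> sets borel} \<subseteq> sets (F s)"
    using sets.sigma_sets_subset[of "{X -` A \<inter> space M | A. A \<in> sets borel}" "F s"] measurable_sets[OF X]
    by auto
  then show "indep_set (sigma_sets (space M) {X -` A \<inter> space M | A. A \<in> sets borel})
     (sigma_sets (space M) {(\<lambda>\<omega>. W u \<omega> - W s \<omega>) -` A \<inter> space M | A. A \<in> sets borel})"
    using increment_indep_past[OF s] unfolding indep_sets2_eq by blast
qed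


section \<open>Moments of increments\<close>

lemma increment_moments:
  assumes s: "0 \<le> s" "s \<le> u"
  shows "integrable M (\<lambda>\<omega>. W u \<omega> - W s \<omega>)" "expectation (\<lambda>\<omega>. W u \<omega> - W s \<omega>) = 0"
    and "integrable M (\<lambda>\<omega>. (W u \<omega> - W s \<omega>)\<^sup>2)" "expectation (\<lambda>\<omega>. (W u \<omega> - W s \<omega>)\<^sup>2) = u - s"
    and "integrable M (\<lambda>\<omega>. exp (\<theta> * (W u \<omega> - W s \<omega>)))"
      "expectation (\<lambda>\<omega>. exp (\<theta> * (W u \<omega> - W s \<omega>))) = exp (\<theta>\<^sup>2 * (u - s) / 2)"
proof -
  have "integrable M (\<lambda>\<omega>. W u \<omega> - W s \<omega>) \<and> expectation (\<lambda>\<omega>. W u \<omega> - W s \<omega>) = 0 \<and>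
    integrable M (\<lambda>\<omega>. (W u \<omega> - W s \<omega>)\<^sup>2) \<and> expectation (\<lambda>\<omega>. (W u \<omega> - W s \<omega>)\<^sup>2) = u - s \<and>
    integrable M (\<lambda>\<omega>. exp (\<theta> * (W u \<omega> - W s \<omega>))) \<and>
      expectation (\<lambda>\<omega>. exp (\<theta> * (W u \<omega> - W s \<omega>))) = exp (\<theta>\<^sup>2 * (u - s) / 2)"
  proof (cases "s = u")
    case True
    then show ?thesis by (simp add: prob_space)
  next
    case False
    define sd where "sd = sqrt (u - s)"
    have sd: "0 < sd" "sd\<^sup>2 = u - s" using False s by (auto simp: sd_def)
    let ?D = "\<lambda>\<omega>. W u \<omega> - W s \<omega>"
    have D: "distributed M lborel ?D (normal_density 0 sd)"
      using W_increment_normal[of s u] s False by (simp add: sd_def)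
    have D': "\<And>x. x \<in> space lborel \<Longrightarrow> 0 \<le> normal_density 0 sd x" by simp
    note transfer = distributed_integrable[OF D _ D'] distributed_integral[OF D _ D']
    have 1: "has_bochner_integral lborel (\<lambda>x. normal_density 0 sd x * x) 0"
      using normal_moment_nz_1[OF sd(1), of 0] .
    have 2: "has_bochner_integral lborel (\<lambda>x. normal_density 0 sd x * x\<^sup>2) (sd\<^sup>2)"
      using normal_moment_even[OF sd(1), of 0 1] by (simp add: power2_eq_square fact_numeral)
    have 3: "has_bochner_integral lborel (\<lambda>x. normal_density 0 sd x * exp (\<theta> * x)) (exp (\<theta>\<^sup>2 * sd\<^sup>2 / 2))"
    proof -
      have "normal_density 0 sd x * exp (\<theta> * x) = exp (\<theta>\<^sup>2 * sd\<^sup>2 / 2) * normal_density (\<theta> * sd\<^sup>2) sd x" for x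
      proof -
        have "- (x - 0)\<^sup>2 / (2 * sd\<^sup>2) + \<theta> * x = \<theta>\<^sup>2 * sd\<^sup>2 / 2 + - (x - \<theta> * sd\<^sup>2)\<^sup>2 / (2 * sd\<^sup>2)"
          using sd(1) by (simp add: field_simps power2_eq_square)
        then have "exp (- (x - 0)\<^sup>2 / (2 * sd\<^sup>2)) * exp (\<theta> * x) = exp (\<theta>\<^sup>2 * sd\<^sup>2 / 2) * exp (- (x - \<theta> * sd\<^sup>2)\<^sup>2 / (2 * sd\<^sup>2))"
          by (simp only: exp_add[symmetric])
        then show ?thesis unfolding normal_density_def by (simp add: mult_ac)
      qed
      moreover have "has_bochner_integral lborel (normal_density (\<theta> * sd\<^sup>2) sd) 1"
        using sd(1) by (simp add: has_bochner_integral_iff)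
      then have "has_bochner_integral lborel (\<lambda>x. exp (\<theta>\<^sup>2 * sd\<^sup>2 / 2) * normal_density (\<theta> * sd\<^sup>2) sd x) (exp (\<theta>\<^sup>2 * sd\<^sup>2 / 2) * 1)"
        by (intro has_bochner_integral_mult_right) auto
      ultimately show ?thesis by simp
    qed
    show ?thesis
      using 1 2 3 unfolding has_bochner_integral_iff sd(2)
      by (simp add: transfer[of "\<lambda>x. x"] transfer[of "\<lambda>x. x\<^sup>2"] transfer[of "\<lambda>x. exp (\<theta> * x)"])
  qed
  then show "integrable M (\<lambda>\<omega>. W u \<omega> - W s \<omega>)" "expectation (\<lambda>\<omega>. W u \<omega> - W s \<omega>) = 0"
    and "integrable M (\<lambda>\<omega>. (W u \<omega> - W s \<omega>)\<^sup>2)" "expectation (\<lambda>\<omega>. (W u \<omega> - W s \<omega>)\<^sup>2) = u - s"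
    and "integrable M (\<lambda>\<omega>. exp (\<theta> * (W u \<omega> - W s \<omega>)))"
      "expectation (\<lambda>\<omega>. exp (\<theta> * (W u \<omega> - W s \<omega>))) = exp (\<theta>\<^sup>2 * (u - s) / 2)"
    by auto
qed

lemma past_times_increment:
  assumes s: "0 \<le> s" "s \<le> u" and X: "X \<in> borel_measurable (F s)" "integrable M X"
    and g: "g \<in> borel_measurable borel" "integrable M (\<lambda>\<omega>. g (W u \<omega> - W s \<omega>))"
  shows "integrable M (\<lambda>\<omega>. X \<omega> * g (W u \<omega> - W s \<omega>))"
    and "expectation (\<lambda>\<omega>. X \<omega> * g (W u \<omega> - W s \<omega>)) = expectation X * expectation (\<lambda>\<omega>. g (W u \<omega> - W s \<omega>) :: real)"
proof -
  have "indep_var borel (id \<circ> X) borel (g \<circ> (\<lambda>\<omega>. W u \<omega> - W s \<omega>))"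
    by (rule indep_var_compose[OF indep_var_past_increment[OF s X(1)]]) (use g in auto)
  then have "indep_var borel X borel (\<lambda>\<omega>. g (W u \<omega> - W s \<omega>))" by (simp add: comp_def)
  from indep_var_integrable[OF this X(2) g(2)] indep_var_lebesgue_integral[OF this X(2) g(2)]
  show "integrable M (\<lambda>\<omega>. X \<omega> * g (W u \<omega> - W s \<omega>))"
    and "expectation (\<lambda>\<omega>. X \<omega> * g (W u \<omega> - W s \<omega>)) = expectation X * expectation (\<lambda>\<omega>. g (W u \<omega> - W s \<omega>) :: real)"
    by auto
qed

lemma past_times_increment_zero:
  assumes s: "0 \<le> s" "s \<le> u" and X: "X \<in> borel_measurable (F s)" "integrable M X"
  shows "integrable M (\<lambda>\<omega>. X \<omega> * (W u \<omega> - W s \<omega>))" "expectation (\<lambda>\<omega>. X \<omega> * (W u \<omega> - W s \<omega>)) = 0"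
  using past_times_increment[OF s X, of "\<lambda>x. x"] increment_moments(1,2)[OF s] by auto

section \<open>The Ito isometry for elementary integrands\<close>

definition bounded_rv :: "('a \<Rightarrow> real) \<Rightarrow> bool" where
  "bounded_rv X \<longleftrightarrow> (\<exists>c. \<forall>\<omega>\<in>space M. \<bar>X \<omega>\<bar> \<le> c)"

lemma bounded_rv_mult: "bounded_rv X \<Longrightarrow> bounded_rv Y \<Longrightarrow> bounded_rv (\<lambda>\<omega>. X \<omega> * Y \<omega>)"
proof -
  assume "bounded_rv X" "bounded_rv Y"
  then obtain c d where *: "\<And>\<omega>. \<omega> \<in> space M \<Longrightarrow> \<bar>X \<omega>\<bar> \<le> c" "\<And>\<omega>. \<omega> \<in> space M \<Longrightarrow> \<bar>Y \<omega>\<bar> \<le> d"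
    unfolding bounded_rv_def by blast
  have "\<bar>X \<omega> * Y \<omega>\<bar> \<le> c * d" if "\<omega> \<in> space M" for \<omega>
    unfolding abs_mult using *[OF that] by (intro mult_mono) auto
  then show ?thesis unfolding bounded_rv_def by blast
qed

lemma integrable_bounded_mult:
  assumes "bounded_rv X" "X \<in> borel_measurable M" "integrable M Y"
  shows "integrable M (\<lambda>\<omega>. X \<omega> * Y \<omega>)"
proof -
  obtain c where c: "\<And>\<omega>. \<omega> \<in> space M \<Longrightarrow> \<bar>X \<omega>\<bar> \<le> c" using assms(1) unfolding bounded_rv_def by blast
  have "integrable M (\<lambda>\<omega>. c * Y \<omega>)" using assms by simp
  then show ?thesis
  proof (rule Bochner_Integration.integrable_bound)
    show "AE \<omega> in M. norm (X \<omega> * Y \<omega>) \<le> norm (c * Y \<omega>)"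
    proof (rule AE_I2)
      fix \<omega> assume "\<omega> \<in> space M"
      from c[OF this] have "\<bar>X \<omega>\<bar> * \<bar>Y \<omega>\<bar> \<le> \<bar>c\<bar> * \<bar>Y \<omega>\<bar>" by (intro mult_right_mono) auto
      then show "norm (X \<omega> * Y \<omega>) \<le> norm (c * Y \<omega>)" by (simp add: abs_mult)
    qed
  qed (use assms in auto)
qed

lemma integrable_bounded:
  "bounded_rv X \<Longrightarrow> X \<in> borel_measurable M \<Longrightarrow> integrable M X"
  using integrable_bounded_mult[of X "\<lambda>_. 1"] by simp

lemma integrable_increment_product:
  assumes "0 \<le> a" "a \<le> b" "0 \<le> c" "c \<le> d"
  shows "integrable M (\<lambda>\<omega>. (W b \<omega> - W a \<omega>) * (W d \<omega> - W c \<omega>))"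
proof -
  have "integrable M (\<lambda>\<omega>. (W b \<omega> - W a \<omega>)\<^sup>2 + (W d \<omega> - W c \<omega>)\<^sup>2)"
    using increment_moments(3) assms by auto
  then show ?thesis
  proof (rule Bochner_Integration.integrable_bound)
    have "\<bar>x * y\<bar> \<le> \<bar>x\<^sup>2 + y\<^sup>2\<bar>" for x y :: real
    proof -
      have "2 * \<bar>x * y\<bar> \<le> x\<^sup>2 + y\<^sup>2"
        using sum_squares_bound[of "\<bar>x\<bar>" "\<bar>y\<bar>"] by (simp add: abs_mult)
      then show ?thesis by linarith
    qed
    then show "AE \<omega> in M. norm ((W b \<omega> - W a \<omega>) * (W d \<omega> - W c \<omega>)) \<le> norm ((W b \<omega> - W a \<omega>)\<^sup>2 + (W d \<omega> - W c \<omega>)\<^sup>2)"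
      by auto
  qed (use assms in auto)
qed

text \<open>Overlapping increments are split at the later left endpoint \<open>c\<close> and at the earlier right endpoint.
Every product in which one factor is an increment after everything else has mean zero; only the
square of the common increment, over \<open>(c, min b d]\<close>, survives.\<close>

lemma covariance_elementary_ordered:
  assumes a: "0 \<le> a" "a \<le> b" and c: "c \<le> d" and ac: "a \<le> c"
    and X: "X \<in> borel_measurable (F a)" "bounded_rv X" and Y: "Y \<in> borel_measurable (F c)" "bounded_rv Y"
  shows "expectation (\<lambda>\<omega>. (X \<omega> * Y \<omega>) * ((W b \<omega> - W a \<omega>) * (W d \<omega> - W c \<omega>)))
     = expectation (\<lambda>\<omega>. X \<omega> * Y \<omega>) * measure lborel ({a<..b} \<inter> {c<..d})"
proof -
  have Int: "{a<..b} \<inter> {c<..d} = {c<..min b d}" using ac by auto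
  define Z where "Z \<omega> = X \<omega> * Y \<omega>" for \<omega>
  have Z: "Z \<in> borel_measurable (F c)" "bounded_rv Z"
    unfolding Z_def using X Y F_measurable_mono[OF X(1) ac] bounded_rv_mult by auto
  have ZM: "Z \<in> borel_measurable M" using Z(1) by (rule F_measurable_M)
  have meas: "W y \<in> borel_measurable (F x)" if "0 \<le> y" "y \<le> x" for x y using that by (rule W_F_measurable)
  have zero: "expectation (\<lambda>\<omega>. Z \<omega> * ((W v \<omega> - W u \<omega>) * (W y \<omega> - W x \<omega>))) = 0"
    if "0 \<le> u" "u \<le> v" "v \<le> x" "c \<le> x" "x \<le> y" for u v x y
  proof -
    have "integrable M (\<lambda>\<omega>. Z \<omega> * (W v \<omega> - W u \<omega>))"
      using that by (intro integrable_bounded_mult Z ZM increment_moments) auto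
    moreover have "(\<lambda>\<omega>. Z \<omega> * (W v \<omega> - W u \<omega>)) \<in> borel_measurable (F x)"
      using that F_measurable_mono[OF Z(1), of x] meas[of v x] meas[of u x] by auto
    ultimately show ?thesis
      using past_times_increment_zero(2)[of x y "\<lambda>\<omega>. Z \<omega> * (W v \<omega> - W u \<omega>)"] that by (simp add: mult.assoc)
  qed
  show ?thesis
  proof (cases "b \<le> c")
    case True
    then show ?thesis using zero[of a b c d] a c unfolding Int Z_def by simp
  next
    case False
    define x y where "x = min b d" and "y = max b d"
    have xy: "c \<le> x" "x \<le> y" "0 \<le> c" using False c a ac by (auto simp: x_def y_def)
    have int: "integrable M (\<lambda>\<omega>. Z \<omega> * ((W v \<omega> - W u \<omega>) * (W y \<omega> - W x \<omega>)))"
      if "0 \<le> u" "u \<le> v" "0 \<le> x" "x \<le> y" for u v x y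
      by (intro integrable_bounded_mult Z ZM integrable_increment_product that)
    have "expectation (\<lambda>\<omega>. Z \<omega> * ((W b \<omega> - W a \<omega>) * (W d \<omega> - W c \<omega>)))
       = expectation (\<lambda>\<omega>. Z \<omega> * ((W c \<omega> - W a \<omega>) * (W d \<omega> - W c \<omega>)) + (Z \<omega> * ((W x \<omega> - W c \<omega>) * (W x \<omega> - W c \<omega>)) + Z \<omega> * ((W x \<omega> - W c \<omega>) * (W y \<omega> - W x \<omega>))))"
      by (rule arg_cong[where f=expectation]) (auto simp: x_def y_def min_def max_def algebra_simps fun_eq_iff)
    also have "\<dots> = expectation (\<lambda>\<omega>. Z \<omega> * ((W c \<omega> - W a \<omega>) * (W d \<omega> - W c \<omega>))) + (expectation (\<lambda>\<omega>. Z \<omega> * ((W x \<omega> - W c \<omega>) * (W x \<omega> - W c \<omega>))) + expectation (\<lambda>\<omega>. Z \<omega> * ((W x \<omega> - W c \<omega>) * (W y \<omega> - W x \<omega>))))"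
      using int a ac c xy by (subst Bochner_Integration.integral_add) auto
    also have "\<dots> = expectation (\<lambda>\<omega>. Z \<omega> * (W x \<omega> - W c \<omega>)\<^sup>2)"
      using zero[of a c c d] zero[of c x x y] a c ac xy by (simp add: power2_eq_square)
    also have "\<dots> = expectation Z * (x - c)"
      using past_times_increment(2)[of c x Z "\<lambda>x. x\<^sup>2"] increment_moments(3,4)[of c x] xy Z ZM
      by (simp add: integrable_bounded)
    finally show ?thesis using xy unfolding Int Z_def x_def by simp
  qed
qed

lemma covariance_elementary:
  assumes a: "0 \<le> a" "a \<le> b" and c: "0 \<le> c" "c \<le> d"
    and X: "X \<in> borel_measurable (F a)" "bounded_rv X" and Y: "Y \<in> borel_measurable (F c)" "bounded_rv Y"
  shows "expectation (\<lambda>\<omega>. (X \<omega> * Y \<omega>) * ((W b \<omega> - W a \<omega>) * (W d \<omega> - W c \<omega>)))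
     = expectation (\<lambda>\<omega>. X \<omega> * Y \<omega>) * measure lborel ({a<..b} \<inter> {c<..d})"
proof (cases "a \<le> c")
  case True
  then show ?thesis using covariance_elementary_ordered assms by blast
next
  case False
  then have "c \<le> a" by simp
  from covariance_elementary_ordered[OF c a(2) this Y X] show ?thesis
    by (simp add: mult_ac Int_commute)
qed

text \<open>Expanding the squares on both sides reduces the isometry to the covariance of two elementary terms. The
intervals need not be disjoint or ordered. Differences of two simple integrals, whose partitions are
unrelated, are thus covered without a common refinement.\<close>

lemma elementary_isometry:
  fixes l u :: "'i \<Rightarrow> real" and \<xi> :: "'i \<Rightarrow> 'a \<Rightarrow> real"
  assumes I: "finite I" and lu: "\<And>i. i \<in> I \<Longrightarrow> 0 \<le> l i \<and> l i \<le> u i"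
    and \<xi>: "\<And>i. i \<in> I \<Longrightarrow> \<xi> i \<in> borel_measurable (F (l i))" "\<And>i. i \<in> I \<Longrightarrow> bounded_rv (\<xi> i)"
  shows "(\<integral>\<^sup>+\<omega>. ennreal ((\<Sum>i\<in>I. \<xi> i \<omega> * (W (u i) \<omega> - W (l i) \<omega>))\<^sup>2) \<partial>M)
     = (\<integral>\<^sup>+\<omega>. (\<integral>\<^sup>+s. ennreal ((\<Sum>i\<in>I. \<xi> i \<omega> * indicator {l i<..u i} s)\<^sup>2) \<partial>lborel) \<partial>M)"
proof -
  let ?L = "\<lambda>i j. measure lborel ({l i<..u i} \<inter> {l j<..u j})"
  let ?D = "\<lambda>i \<omega>. W (u i) \<omega> - W (l i) \<omega>"
  have xM: "\<xi> i \<in> borel_measurable M" if "i \<in> I" for i using \<xi>(1)[OF that] by (rule F_measurable_M)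
  have sq: "(\<Sum>i\<in>I. f i)\<^sup>2 = (\<Sum>i\<in>I. \<Sum>j\<in>I. f i * f j)" for f :: "'i \<Rightarrow> real"
    by (simp add: power2_eq_square sum_product)
  have intD: "integrable M (\<lambda>\<omega>. (\<xi> i \<omega> * \<xi> j \<omega>) * (?D i \<omega> * ?D j \<omega>))" if "i \<in> I" "j \<in> I" for i j
    using that lu \<xi> xM by (intro integrable_bounded_mult integrable_increment_product bounded_rv_mult) auto
  have intx: "integrable M (\<lambda>\<omega>. \<xi> i \<omega> * \<xi> j \<omega>)" if "i \<in> I" "j \<in> I" for i j
    using that \<xi> xM by (intro integrable_bounded bounded_rv_mult) auto
  have lhs: "(\<Sum>i\<in>I. \<xi> i \<omega> * ?D i \<omega>)\<^sup>2 = (\<Sum>i\<in>I. \<Sum>j\<in>I. (\<xi> i \<omega> * \<xi> j \<omega>) * (?D i \<omega> * ?D j \<omega>))" for \<omega>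
    unfolding sq by (intro sum.cong) (auto simp: mult_ac)
  have rhs: "(\<integral>\<^sup>+s. ennreal ((\<Sum>i\<in>I. \<xi> i \<omega> * indicator {l i<..u i} s)\<^sup>2) \<partial>lborel)
     = ennreal (\<Sum>i\<in>I. \<Sum>j\<in>I. (\<xi> i \<omega> * \<xi> j \<omega>) * ?L i j) \<and> 0 \<le> (\<Sum>i\<in>I. \<Sum>j\<in>I. (\<xi> i \<omega> * \<xi> j \<omega>) * ?L i j)" for \<omega>
  proof -
    have e: "(\<Sum>i\<in>I. \<xi> i \<omega> * indicator {l i<..u i} s)\<^sup>2
       = (\<Sum>i\<in>I. \<Sum>j\<in>I. (\<xi> i \<omega> * \<xi> j \<omega>) * indicator ({l i<..u i} \<inter> {l j<..u j}) s)" for s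
      unfolding sq by (intro sum.cong) (auto simp: indicator_def)
    have fin: "emeasure lborel ({l i<..u i} \<inter> {l j<..u j}) < \<infinity>" for i j
      by (rule le_less_trans[OF emeasure_mono[of _ "{l i..u i}"]]) (auto simp: emeasure_lborel_Icc_eq)
    have "has_bochner_integral lborel (\<lambda>s. (\<Sum>i\<in>I. \<xi> i \<omega> * indicator {l i<..u i} s)\<^sup>2)
       (\<Sum>i\<in>I. \<Sum>j\<in>I. (\<xi> i \<omega> * \<xi> j \<omega>) * ?L i j)"
      unfolding e
      by (intro has_bochner_integral_sum has_bochner_integral_mult_right has_bochner_integral_real_indicator fin) auto
    then have 1: "integrable lborel (\<lambda>s. (\<Sum>i\<in>I. \<xi> i \<omega> * indicator {l i<..u i} s)\<^sup>2)"
      and 2: "(\<integral>s. (\<Sum>i\<in>I. \<xi> i \<omega> * indicator {l i<..u i} s)\<^sup>2 \<partial>lborel) = (\<Sum>i\<in>I. \<Sum>j\<in>I. (\<xi> i \<omega> * \<xi> j \<omega>) * ?L i j)"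
      by (auto simp: has_bochner_integral_iff)
    have "0 \<le> (\<integral>s. (\<Sum>i\<in>I. \<xi> i \<omega> * indicator {l i<..u i} s)\<^sup>2 \<partial>lborel)" by simp
    then show ?thesis using nn_integral_eq_integral[OF 1] 2 by simp
  qed
  have "(\<integral>\<^sup>+\<omega>. ennreal ((\<Sum>i\<in>I. \<xi> i \<omega> * ?D i \<omega>)\<^sup>2) \<partial>M) = ennreal (expectation (\<lambda>\<omega>. (\<Sum>i\<in>I. \<xi> i \<omega> * ?D i \<omega>)\<^sup>2))"
  proof (rule nn_integral_eq_integral)
    show "integrable M (\<lambda>\<omega>. (\<Sum>i\<in>I. \<xi> i \<omega> * ?D i \<omega>)\<^sup>2)"
      unfolding lhs using intD by (intro Bochner_Integration.integrable_sum) auto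
  qed simp
  also have "expectation (\<lambda>\<omega>. (\<Sum>i\<in>I. \<xi> i \<omega> * ?D i \<omega>)\<^sup>2) = (\<Sum>i\<in>I. \<Sum>j\<in>I. expectation (\<lambda>\<omega>. \<xi> i \<omega> * \<xi> j \<omega>) * ?L i j)"
  proof -
    have "expectation (\<lambda>\<omega>. \<Sum>i\<in>I. \<Sum>j\<in>I. (\<xi> i \<omega> * \<xi> j \<omega>) * (?D i \<omega> * ?D j \<omega>))
       = (\<Sum>i\<in>I. expectation (\<lambda>\<omega>. \<Sum>j\<in>I. (\<xi> i \<omega> * \<xi> j \<omega>) * (?D i \<omega> * ?D j \<omega>)))"
      using intD by (intro Bochner_Integration.integral_sum Bochner_Integration.integrable_sum)
    also have "\<dots> = (\<Sum>i\<in>I. \<Sum>j\<in>I. expectation (\<lambda>\<omega>. (\<xi> i \<omega> * \<xi> j \<omega>) * (?D i \<omega> * ?D j \<omega>)))"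
      using intD by (intro sum.cong refl Bochner_Integration.integral_sum)
    also have "\<dots> = (\<Sum>i\<in>I. \<Sum>j\<in>I. expectation (\<lambda>\<omega>. \<xi> i \<omega> * \<xi> j \<omega>) * ?L i j)"
      using lu \<xi> by (intro sum.cong refl covariance_elementary) auto
    finally show ?thesis unfolding lhs .
  qed
  also have "\<dots> = expectation (\<lambda>\<omega>. \<Sum>i\<in>I. \<Sum>j\<in>I. (\<xi> i \<omega> * \<xi> j \<omega>) * ?L i j)"
    using intx by simp
  also have "ennreal \<dots> = (\<integral>\<^sup>+\<omega>. ennreal (\<Sum>i\<in>I. \<Sum>j\<in>I. (\<xi> i \<omega> * \<xi> j \<omega>) * ?L i j) \<partial>M)"
    using intx rhs by (intro nn_integral_eq_integral[symmetric]) auto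
  also have "\<dots> = (\<integral>\<^sup>+\<omega>. (\<integral>\<^sup>+s. ennreal ((\<Sum>i\<in>I. \<xi> i \<omega> * indicator {l i<..u i} s)\<^sup>2) \<partial>lborel) \<partial>M)"
    using rhs by simp
  finally show ?thesis .
qed

end

section \<open>Mean square distances\<close>

definition sqd :: "'b measure \<Rightarrow> ('b \<Rightarrow> real) \<Rightarrow> ('b \<Rightarrow> real) \<Rightarrow> ennreal" where
  "sqd N f g = (\<integral>\<^sup>+x. ennreal ((f x - g x)\<^sup>2) \<partial>N)"

lemma sqd_commute: "sqd N f g = sqd N g f"
  by (simp add: sqd_def power2_commute)

lemma sqd_triangle:
  assumes [measurable]: "f \<in> borel_measurable N" "g \<in> borel_measurable N" "h \<in> borel_measurable N"
  shows "sqd N f h \<le> 2 * (sqd N f g + sqd N g h)"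
proof -
  have "ennreal ((f x - h x)\<^sup>2) \<le> 2 * (ennreal ((f x - g x)\<^sup>2) + ennreal ((g x - h x)\<^sup>2))" for x
  proof -
    have "(f x - h x)\<^sup>2 \<le> 2 * ((f x - g x)\<^sup>2 + (g x - h x)\<^sup>2)"
      using zero_le_power2[of "(f x - g x) - (g x - h x)"] by (simp add: power2_eq_square algebra_simps)
    then have "ennreal ((f x - h x)\<^sup>2) \<le> ennreal (2 * ((f x - g x)\<^sup>2 + (g x - h x)\<^sup>2))" by (rule ennreal_leI)
    then show ?thesis by (simp add: ennreal_mult)
  qed
  then have "sqd N f h \<le> (\<integral>\<^sup>+x. 2 * (ennreal ((f x - g x)\<^sup>2) + ennreal ((g x - h x)\<^sup>2)) \<partial>N)"
    unfolding sqd_def by (intro nn_integral_mono) auto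
  also have "\<dots> = 2 * (sqd N f g + sqd N g h)"
    unfolding sqd_def by (simp add: nn_integral_cmult nn_integral_add)
  finally show ?thesis .
qed

lemma sqd_zero_AE:
  assumes [measurable]: "f \<in> borel_measurable N" "g \<in> borel_measurable N" and z: "sqd N f g = 0"
  shows "AE x in N. f x = g x"
proof -
  have "AE x in N. ennreal ((f x - g x)\<^sup>2) = 0"
    using z unfolding sqd_def by (subst (asm) nn_integral_0_iff_AE) auto
  then show ?thesis by eventually_elim (simp add: ennreal_eq_0_iff)
qed

context brownian
begin

section \<open>Uniqueness of the Ito integral\<close>

lemma simple_integrand_nonneg:
  assumes "simple_integrand M F n \<tau> \<xi>" "i \<le> n"
  shows "0 \<le> \<tau> i"
  using assms(2)
proof (induction i)
  case (Suc i)
  then have "\<tau> i \<le> \<tau> (Suc i)" using assms(1) by (simp add: simple_integrand_def)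
  then show ?case using Suc by simp
qed (use assms in \<open>simp add: simple_integrand_def\<close>)

text \<open>Terms whose interval begins after \<open>T\<close> are dropped: their truncated increment vanishes, but their
coefficient need not be measurable at the truncated time \<open>T\<close>.\<close>

lemma simple_integrand_elementary:
  assumes S: "simple_integrand M F n \<tau> \<xi>" and T: "0 \<le> T"
  defines "I \<equiv> {i. i < n \<and> \<tau> i \<le> T}"
  shows "i \<in> I \<Longrightarrow> 0 \<le> min (\<tau> i) T \<and> min (\<tau> i) T \<le> min (\<tau> (Suc i)) T"
    and "i \<in> I \<Longrightarrow> \<xi> i \<in> borel_measurable (F (min (\<tau> i) T))"
    and "i \<in> I \<Longrightarrow> bounded_rv (\<xi> i)"
    and "simple_ito_integral W n \<tau> \<xi> T \<omega> = (\<Sum>i\<in>I. \<xi> i \<omega> * (W (min (\<tau> (Suc i)) T) \<omega> - W (min (\<tau> i) T) \<omega>))"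
    and "indicator {0..T} s * simple_value n \<tau> \<xi> s \<omega> = (\<Sum>i\<in>I. \<xi> i \<omega> * indicator {min (\<tau> i) T<..min (\<tau> (Suc i)) T} s)"
proof -
  have mono: "\<tau> i \<le> \<tau> (Suc i)" if "i < n" for i using S that by (simp add: simple_integrand_def)
  note nonneg = simple_integrand_nonneg[OF S]
  show "0 \<le> min (\<tau> i) T \<and> min (\<tau> i) T \<le> min (\<tau> (Suc i)) T" if "i \<in> I"
    using that nonneg[of i] mono[of i] T by (auto simp: I_def)
  show "\<xi> i \<in> borel_measurable (F (min (\<tau> i) T))" "bounded_rv (\<xi> i)" if "i \<in> I"
    using that S by (auto simp: I_def simple_integrand_def bounded_rv_def min_def)
  show "simple_ito_integral W n \<tau> \<xi> T \<omega> = (\<Sum>i\<in>I. \<xi> i \<omega> * (W (min (\<tau> (Suc i)) T) \<omega> - W (min (\<tau> i) T) \<omega>))"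
    unfolding simple_ito_integral_def
  proof (rule sum.mono_neutral_right)
    show "\<forall>i\<in>{..<n} - I. \<xi> i \<omega> * (W (min (\<tau> (Suc i)) T) \<omega> - W (min (\<tau> i) T) \<omega>) = 0"
      using mono by (force simp: I_def min_def)
  qed (auto simp: I_def)
  show "indicator {0..T} s * simple_value n \<tau> \<xi> s \<omega> = (\<Sum>i\<in>I. \<xi> i \<omega> * indicator {min (\<tau> i) T<..min (\<tau> (Suc i)) T} s)"
    unfolding simple_value_def sum_distrib_left
  proof (rule sum.mono_neutral_cong_right)
    show "\<forall>i\<in>{..<n} - I. indicator {0..T} s * (\<xi> i \<omega> * indicator {\<tau> i<..\<tau> (Suc i)} s) = 0"
      by (auto simp: I_def indicator_def)
    show "indicator {0..T} s * (\<xi> i \<omega> * indicator {\<tau> i<..\<tau> (Suc i)} s) = \<xi> i \<omega> * indicator {min (\<tau> i) T<..min (\<tau> (Suc i)) T} s"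
      if "i \<in> I" for i
      using that nonneg[of i] by (auto simp: I_def indicator_def)
  qed (auto simp: I_def)
qed

lemma simple_difference_isometry:
  assumes S: "simple_integrand M F n \<tau> \<xi>" and S': "simple_integrand M F n' \<tau>' \<xi>'" and T: "0 \<le> T"
  shows "sqd M (simple_ito_integral W n \<tau> \<xi> T) (simple_ito_integral W n' \<tau>' \<xi>' T) =
    (\<integral>\<^sup>+\<omega>. (\<integral>\<^sup>+s. ennreal ((indicator {0..T} s * simple_value n \<tau> \<xi> s \<omega>
        - indicator {0..T} s * simple_value n' \<tau>' \<xi>' s \<omega>)\<^sup>2) \<partial>lborel) \<partial>M)"
proof -
  define I where "I = {i. i < n \<and> \<tau> i \<le> T}"
  define J where "J = {i. i < n' \<and> \<tau>' i \<le> T}"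
  note E = simple_integrand_elementary[OF S T, folded I_def]
  note E' = simple_integrand_elementary[OF S' T, folded J_def]
  define l where "l = case_sum (\<lambda>i. min (\<tau> i) T) (\<lambda>i. min (\<tau>' i) T)"
  define u where "u = case_sum (\<lambda>i. min (\<tau> (Suc i)) T) (\<lambda>i. min (\<tau>' (Suc i)) T)"
  define \<zeta> where "\<zeta> = case_sum \<xi> (\<lambda>i \<omega>. - \<xi>' i \<omega>)"
  have fin: "finite I" "finite J" by (auto simp: I_def J_def)
  have b: "bounded_rv (\<lambda>\<omega>. - \<xi>' i \<omega>)" if "bounded_rv (\<xi>' i)" for i
    using that by (simp add: bounded_rv_def)
  have "(\<integral>\<^sup>+\<omega>. ennreal ((\<Sum>i\<in>I <+> J. \<zeta> i \<omega> * (W (u i) \<omega> - W (l i) \<omega>))\<^sup>2) \<partial>M)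
     = (\<integral>\<^sup>+\<omega>. (\<integral>\<^sup>+s. ennreal ((\<Sum>i\<in>I <+> J. \<zeta> i \<omega> * indicator {l i<..u i} s)\<^sup>2) \<partial>lborel) \<partial>M)"
    using fin E(1-3) E'(1-3) b
    by (intro elementary_isometry) (auto simp: l_def u_def \<zeta>_def)
  then show ?thesis
    unfolding sqd_def E(4,5) E'(4,5)
    by (simp add: sum.Plus[OF fin] l_def u_def \<zeta>_def sum_negf)
qed

text \<open>Progressive measurability speaks about the \<open>\<sigma>\<close>-algebra on \<open>[0,T]\<close> only; clamping the time
to \<open>[0,T]\<close> turns it into a measurable function of all times.\<close>

lemma progressive_joint_measurable:
  assumes H: "progressively_measurable F H" and T: "0 \<le> T"
  shows "(\<lambda>(\<omega>, s). indicator {0..T} s * H s \<omega>) \<in> borel_measurable (M \<Otimes>\<^sub>M lborel)"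
proof -
  have 1: "(\<lambda>(s, \<omega>). H s \<omega>) \<in> borel_measurable (restrict_space borel {0..T} \<Otimes>\<^sub>M F T)"
    using H T by (simp add: progressively_measurable_def)
  have c: "(\<lambda>s. max 0 (min T s)) \<in> measurable lborel (restrict_space borel {0..T})"
    using T by (intro measurable_restrict_space2) auto
  have i: "(\<lambda>\<omega>. \<omega>) \<in> measurable M (F T)"
    using sets_F_subset by (auto simp: measurable_def dest: sets.sets_into_space)
  have "(\<lambda>z. (max 0 (min T (snd z)), fst z)) \<in> measurable (M \<Otimes>\<^sub>M lborel) (restrict_space borel {0..T} \<Otimes>\<^sub>M F T)"
    using measurable_compose[OF measurable_snd c] measurable_compose[OF measurable_fst i]
    by (intro measurable_Pair) auto
  from measurable_compose[OF this 1]
  have [measurable]: "(\<lambda>z. H (max 0 (min T (snd z))) (fst z)) \<in> borel_measurable (M \<Otimes>\<^sub>M lborel)" by simp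
  have "(\<lambda>z. indicator {0..T} (snd z) * H (max 0 (min T (snd z))) (fst z)) \<in> borel_measurable (M \<Otimes>\<^sub>M lborel)"
    by measurable
  moreover have "(\<lambda>z. indicator {0..T} (snd z) * H (max 0 (min T (snd z))) (fst z)) = (\<lambda>(\<omega>, s). indicator {0..T} s * H s \<omega>)"
    by (auto simp: fun_eq_iff indicator_def)
  ultimately show ?thesis by simp
qed

lemma simple_value_joint_measurable:
  assumes "simple_integrand M F n \<tau> \<xi>"
  shows "(\<lambda>(\<omega>, s). indicator {0..T} s * simple_value n \<tau> \<xi> s \<omega>) \<in> borel_measurable (M \<Otimes>\<^sub>M lborel)"
proof -
  have [measurable]: "\<xi> i \<in> borel_measurable M" if "i < n" for i
    using assms that F_measurable_M by (auto simp: simple_integrand_def)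
  have "(\<lambda>z. \<Sum>i<n. \<xi> i (fst z) * indicator {\<tau> i<..\<tau> (Suc i)} (snd z)) \<in> borel_measurable (M \<Otimes>\<^sub>M lborel)"
    by (intro borel_measurable_sum borel_measurable_times) measurable
  then show ?thesis unfolding simple_value_def split_def by measurable
qed

lemma simple_ito_measurable:
  assumes "simple_integrand M F n \<tau> \<xi>" "0 \<le> T"
  shows "simple_ito_integral W n \<tau> \<xi> T \<in> borel_measurable M"
proof -
  have [measurable]: "\<xi> i \<in> borel_measurable M" if "i < n" for i
    using assms that F_measurable_M by (auto simp: simple_integrand_def)
  have n: "0 \<le> \<tau> i" if "i \<le> n" for i using simple_integrand_nonneg[OF assms(1) that] .
  have "(\<lambda>\<omega>. \<xi> i \<omega> * (W (min (\<tau> (Suc i)) T) \<omega> - W (min (\<tau> i) T) \<omega>)) \<in> borel_measurable M" if "i < n" for i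
    using n[of i] n[of "Suc i"] that assms(2)
    by (intro borel_measurable_times borel_measurable_diff W_measurable) auto
  then show ?thesis unfolding simple_ito_integral_def by (intro borel_measurable_sum) auto
qed

lemma nn_integral_process_eq_sqd:
  assumes "(\<lambda>(\<omega>, s). indicator {0..T} s * G s \<omega>) \<in> borel_measurable (M \<Otimes>\<^sub>M lborel)"
    and "(\<lambda>(\<omega>, s). indicator {0..T} s * H s \<omega>) \<in> borel_measurable (M \<Otimes>\<^sub>M lborel)"
  shows "(\<integral>\<^sup>+\<omega>. (\<integral>\<^sup>+s\<in>{0..T}. ennreal ((G s \<omega> - H s \<omega>)\<^sup>2) \<partial>lborel) \<partial>M)
     = sqd (M \<Otimes>\<^sub>M lborel) (\<lambda>(\<omega>, s). indicator {0..T} s * G s \<omega>) (\<lambda>(\<omega>, s). indicator {0..T} s * H s \<omega>)"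
    and "(\<integral>\<^sup>+\<omega>. (\<integral>\<^sup>+s. ennreal ((indicator {0..T} s * G s \<omega> - indicator {0..T} s * H s \<omega>)\<^sup>2) \<partial>lborel) \<partial>M)
     = sqd (M \<Otimes>\<^sub>M lborel) (\<lambda>(\<omega>, s). indicator {0..T} s * G s \<omega>) (\<lambda>(\<omega>, s). indicator {0..T} s * H s \<omega>)"
proof -
  let ?g = "\<lambda>z. ennreal (((\<lambda>(\<omega>, s). indicator {0..T} s * G s \<omega>) z - (\<lambda>(\<omega>, s). indicator {0..T} s * H s \<omega>) z)\<^sup>2)"
  have "?g \<in> borel_measurable (M \<Otimes>\<^sub>M lborel)" using assms by measurable
  from lborel.nn_integral_fst[OF this]
  show 2: "(\<integral>\<^sup>+\<omega>. (\<integral>\<^sup>+s. ennreal ((indicator {0..T} s * G s \<omega> - indicator {0..T} s * H s \<omega>)\<^sup>2) \<partial>lborel) \<partial>M)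
     = sqd (M \<Otimes>\<^sub>M lborel) (\<lambda>(\<omega>, s). indicator {0..T} s * G s \<omega>) (\<lambda>(\<omega>, s). indicator {0..T} s * H s \<omega>)"
    unfolding sqd_def by simp
  show "(\<integral>\<^sup>+\<omega>. (\<integral>\<^sup>+s\<in>{0..T}. ennreal ((G s \<omega> - H s \<omega>)\<^sup>2) \<partial>lborel) \<partial>M)
     = sqd (M \<Otimes>\<^sub>M lborel) (\<lambda>(\<omega>, s). indicator {0..T} s * G s \<omega>) (\<lambda>(\<omega>, s). indicator {0..T} s * H s \<omega>)"
    unfolding 2[symmetric] by (intro nn_integral_cong) (auto simp: indicator_def)
qed

text \<open>Two approximating sequences of the same integrand are close to each other in mean square, so by the
isometry their integrals are, too.\<close>

theorem ito_integral_unique: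
  assumes X: "has_ito_integral M F W H T X" and Y: "has_ito_integral M F W H T Y" and T: "0 \<le> T"
  shows "AE \<omega> in M. X \<omega> = Y \<omega>"
proof -
  let ?P = "M \<Otimes>\<^sub>M (lborel :: real measure)"
  let ?v = "\<lambda>G (\<omega>, s). indicator {0..T} s * G s \<omega> :: real"
  have [measurable]: "X \<in> borel_measurable M" "Y \<in> borel_measurable M"
    using X Y by (auto simp: has_ito_integral_def)
  have H: "?v H \<in> borel_measurable ?P"
    using X T by (intro progressive_joint_measurable) (auto simp: has_ito_integral_def)
  have approx: "\<exists>I G. (\<forall>k. I k \<in> borel_measurable M \<and> ?v (G k) \<in> borel_measurable ?P) \<and>
      (\<forall>k. \<exists>n \<tau> \<xi>. simple_integrand M F n \<tau> \<xi> \<and> I k = simple_ito_integral W n \<tau> \<xi> T \<and> G k = simple_value n \<tau> \<xi>) \<and>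
      (\<lambda>k. sqd ?P (?v (G k)) (?v H)) \<longlonglongrightarrow> 0 \<and> (\<lambda>k. sqd M (I k) X) \<longlonglongrightarrow> 0"
    if *: "has_ito_integral M F W H T X" for X
  proof -
    obtain n \<tau> \<xi> where 1: "\<And>k::nat. simple_integrand M F (n k) (\<tau> k) (\<xi> k)"
      and 2: "(\<lambda>k. \<integral>\<^sup>+\<omega>. (\<integral>\<^sup>+s\<in>{0..T}. ennreal ((simple_value (n k) (\<tau> k) (\<xi> k) s \<omega> - H s \<omega>)\<^sup>2) \<partial>lborel) \<partial>M) \<longlonglongrightarrow> 0"
      and 3: "(\<lambda>k. \<integral>\<^sup>+\<omega>. ennreal ((simple_ito_integral W (n k) (\<tau> k) (\<xi> k) T \<omega> - X \<omega>)\<^sup>2) \<partial>M) \<longlonglongrightarrow> 0"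
      using * unfolding has_ito_integral_def by blast
    have m: "?v (simple_value (n k) (\<tau> k) (\<xi> k)) \<in> borel_measurable ?P" for k
      by (rule simple_value_joint_measurable[OF 1])
    show ?thesis
      using 1 2 3 m simple_ito_measurable[OF 1 T]
      unfolding nn_integral_process_eq_sqd(1)[OF m H] sqd_def[of M]
      by (intro exI[of _ "\<lambda>k. simple_ito_integral W (n k) (\<tau> k) (\<xi> k) T"]
          exI[of _ "\<lambda>k. simple_value (n k) (\<tau> k) (\<xi> k)"]) blast
  qed
  from approx[OF X] obtain I G where I: "\<And>k. I k \<in> borel_measurable M" "\<And>k. ?v (G k) \<in> borel_measurable ?P"
    "\<And>k. \<exists>n \<tau> \<xi>. simple_integrand M F n \<tau> \<xi> \<and> I k = simple_ito_integral W n \<tau> \<xi> T \<and> G k = simple_value n \<tau> \<xi>"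
    "(\<lambda>k. sqd ?P (?v (G k)) (?v H)) \<longlonglongrightarrow> 0" "(\<lambda>k. sqd M (I k) X) \<longlonglongrightarrow> 0" by blast
  from approx[OF Y] obtain J K where J: "\<And>k. J k \<in> borel_measurable M" "\<And>k. ?v (K k) \<in> borel_measurable ?P"
    "\<And>k. \<exists>n \<tau> \<xi>. simple_integrand M F n \<tau> \<xi> \<and> J k = simple_ito_integral W n \<tau> \<xi> T \<and> K k = simple_value n \<tau> \<xi>"
    "(\<lambda>k. sqd ?P (?v (K k)) (?v H)) \<longlonglongrightarrow> 0" "(\<lambda>k. sqd M (J k) Y) \<longlonglongrightarrow> 0" by blast
  have bound: "sqd M X Y \<le> 2 * (sqd M (I k) X + 2 * (2 * (sqd ?P (?v (G k)) (?v H) + sqd ?P (?v (K k)) (?v H)) + sqd M (J k) Y))" for k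
  proof -
    have iso: "sqd M (I k) (J k) = sqd ?P (?v (G k)) (?v (K k))"
      using I(3)[of k] J(3)[of k] simple_difference_isometry[OF _ _ T]
        nn_integral_process_eq_sqd(2)[OF I(2)[of k] J(2)[of k]] by (elim exE conjE) simp
    have "sqd M X Y \<le> 2 * (sqd M X (I k) + sqd M (I k) Y)"
      using I by (intro sqd_triangle) auto
    also have "sqd M (I k) Y \<le> 2 * (sqd M (I k) (J k) + sqd M (J k) Y)"
      using I J by (intro sqd_triangle) auto
    also have "sqd M (I k) (J k) \<le> 2 * (sqd ?P (?v (G k)) (?v H) + sqd ?P (?v H) (?v (K k)))"
      unfolding iso by (intro sqd_triangle I J H)
    finally show ?thesis
      by (simp add: sqd_commute[of M X] sqd_commute[of ?P "?v H"] add_left_mono mult_left_mono)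
  qed
  have "(\<lambda>k. 2 * (sqd M (I k) X + 2 * (2 * (sqd ?P (?v (G k)) (?v H) + sqd ?P (?v (K k)) (?v H)) + sqd M (J k) Y)))
     \<longlonglongrightarrow> 2 * (0 + 2 * (2 * (0 + 0) + 0))"
    by (intro ennreal_tendsto_cmult tendsto_add I J) auto
  then have "(\<lambda>k. 2 * (sqd M (I k) X + 2 * (2 * (sqd ?P (?v (G k)) (?v H) + sqd ?P (?v (K k)) (?v H)) + sqd M (J k) Y)))
     \<longlonglongrightarrow> 0" by simp
  from LIMSEQ_le_const[OF this, of "sqd M X Y"] bound have "sqd M X Y = 0" by auto
  then show ?thesis by (intro sqd_zero_AE) auto
qed

end

section \<open>Integrals of smooth functions against a continuous path\<close>

text \<open>This is \<open>\<integral> f dw\<close> integrated by parts, where \<open>f'\<close> stands for the derivative of \<open>f\<close>. It makes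
sense for every continuous \<open>w\<close>, of bounded variation or not.\<close>

definition path_integral :: "(real \<Rightarrow> real) \<Rightarrow> (real \<Rightarrow> real) \<Rightarrow> (real \<Rightarrow> real) \<Rightarrow> real \<Rightarrow> real \<Rightarrow> real" where
  "path_integral w f f' \<alpha> \<beta> = f \<beta> * w \<beta> - f \<alpha> * w \<alpha> - integral {\<alpha>..\<beta>} (\<lambda>x. f' x * w x)"

definition node :: "real \<Rightarrow> real \<Rightarrow> nat \<Rightarrow> nat \<Rightarrow> real" where
  "node \<alpha> \<beta> n i = \<alpha> + (\<beta> - \<alpha>) * real i / real (Suc n)"

lemma node_0 [simp]: "node \<alpha> \<beta> n 0 = \<alpha>"
  by (simp add: node_def)

lemma node_last [simp]: "node \<alpha> \<beta> n (Suc n) = \<beta>"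
  unfolding node_def by (subst nonzero_mult_div_cancel_right) auto

lemma node_diff: "node \<alpha> \<beta> n (Suc i) - node \<alpha> \<beta> n i = (\<beta> - \<alpha>) / real (Suc n)"
  by (simp add: node_def add_divide_distrib distrib_left)

lemma node_mono: "\<alpha> \<le> \<beta> \<Longrightarrow> i \<le> j \<Longrightarrow> node \<alpha> \<beta> n i \<le> node \<alpha> \<beta> n j"
  by (simp add: node_def divide_right_mono mult_left_mono)

lemma node_bounds:
  assumes "\<alpha> \<le> \<beta>" "i \<le> Suc n"
  shows "\<alpha> \<le> node \<alpha> \<beta> n i" "node \<alpha> \<beta> n i \<le> \<beta>"
  using node_mono[OF assms(1), of 0 i n] node_mono[OF assms, of n] by auto

definition left_sum :: "(real \<Rightarrow> real) \<Rightarrow> (real \<Rightarrow> real) \<Rightarrow> real \<Rightarrow> real \<Rightarrow> nat \<Rightarrow> real" where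
  "left_sum w f \<alpha> \<beta> n = (\<Sum>i<Suc n. f (node \<alpha> \<beta> n i) * (w (node \<alpha> \<beta> n (Suc i)) - w (node \<alpha> \<beta> n i)))"

text \<open>On each interval of the partition the error is \<open>\<integral> f'(x)(w(x) - w(right endpoint)) dx\<close>, which is
controlled by the modulus of continuity of \<open>w\<close>.\<close>

lemma left_sum_tendsto_path_integral:
  assumes ab: "\<alpha> \<le> \<beta>" and w: "continuous_on {\<alpha>..\<beta>} w"
    and f: "\<And>x. x \<in> {\<alpha>..\<beta>} \<Longrightarrow> (f has_real_derivative f' x) (at x)" and f': "continuous_on {\<alpha>..\<beta>} f'"
  shows "left_sum w f \<alpha> \<beta> \<longlonglongrightarrow> path_integral w f f' \<alpha> \<beta>"
proof -
  obtain B where B: "0 < B" "\<And>x. x \<in> {\<alpha>..\<beta>} \<Longrightarrow> \<bar>f' x\<bar> \<le> B"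
  proof -
    have "bounded (f' ` {\<alpha>..\<beta>})" using f' by (intro compact_imp_bounded compact_continuous_image) auto
    then show ?thesis using that unfolding bounded_pos by auto
  qed
  have ucont: "uniformly_continuous_on {\<alpha>..\<beta>} w" using w by (intro compact_uniformly_continuous) auto
  have cont: "continuous_on {\<alpha>..\<beta>} (\<lambda>x. f' x * w x)" using w f' by (intro continuous_intros)
  have step: "left_sum w f \<alpha> \<beta> n - path_integral w f f' \<alpha> \<beta> =
     (\<Sum>i<Suc n. integral {node \<alpha> \<beta> n i..node \<alpha> \<beta> n (Suc i)} (\<lambda>x. f' x * (w x - w (node \<alpha> \<beta> n (Suc i)))))" for n
  proof -
    let ?t = "node \<alpha> \<beta> n"
    have sub: "{?t i..?t (Suc i)} \<subseteq> {\<alpha>..\<beta>}" if "i < Suc n" for i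
      using that node_bounds[OF ab, of i n] node_bounds[OF ab, of "Suc i" n] by auto
    have piece: "integral {?t i..?t (Suc i)} (\<lambda>x. f' x * (w x - w (?t (Suc i)))) =
       integral {?t i..?t (Suc i)} (\<lambda>x. f' x * w x) - (f (?t (Suc i)) - f (?t i)) * w (?t (Suc i))" if "i < Suc n" for i
    proof -
      have "(f' has_integral (f (?t (Suc i)) - f (?t i))) {?t i..?t (Suc i)}"
        using f sub[OF that] ab
        by (intro fundamental_theorem_of_calculus node_mono)
          (auto simp flip: has_real_derivative_iff_has_vector_derivative intro: has_field_derivative_at_within)
      from has_integral_mult_left[OF this, of "w (?t (Suc i))"]
      have 1: "((\<lambda>x. f' x * w (?t (Suc i))) has_integral (f (?t (Suc i)) - f (?t i)) * w (?t (Suc i))) {?t i..?t (Suc i)}" .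
      have "((\<lambda>x. f' x * w x) has_integral integral {?t i..?t (Suc i)} (\<lambda>x. f' x * w x)) {?t i..?t (Suc i)}"
        using continuous_on_subset[OF cont sub[OF that]] by (intro integrable_integral integrable_continuous_real)
      from has_integral_diff[OF this 1] show ?thesis
        by (simp add: right_diff_distrib integral_unique)
    qed
    have combine: "integral {\<alpha>..?t k} (\<lambda>x. f' x * w x) = (\<Sum>i<k. integral {?t i..?t (Suc i)} (\<lambda>x. f' x * w x))"
      if "k \<le> Suc n" for k using that
    proof (induction k)
      case (Suc k)
      have "integral {\<alpha>..?t k} (\<lambda>x. f' x * w x) + integral {?t k..?t (Suc k)} (\<lambda>x. f' x * w x) = integral {\<alpha>..?t (Suc k)} (\<lambda>x. f' x * w x)"
        using Suc.prems node_bounds[OF ab, of k n] node_bounds[OF ab, of "Suc k" n] ab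
        by (intro Henstock_Kurzweil_Integration.integral_combine node_mono integrable_continuous_real continuous_on_subset[OF cont]) auto
      then show ?case using Suc by simp
    qed simp
    have tele: "(\<Sum>i<Suc n. f (?t (Suc i)) * w (?t (Suc i)) - f (?t i) * w (?t i)) = f \<beta> * w \<beta> - f \<alpha> * w \<alpha>"
      using sum_lessThan_telescope[of "\<lambda>i. f (?t i) * w (?t i)" "Suc n"] by simp
    have "(\<Sum>i<Suc n. integral {?t i..?t (Suc i)} (\<lambda>x. f' x * (w x - w (?t (Suc i)))))
      = (\<Sum>i<Suc n. integral {?t i..?t (Suc i)} (\<lambda>x. f' x * w x) - (f (?t (Suc i)) - f (?t i)) * w (?t (Suc i)))"
      using piece by (intro sum.cong) auto
    also have "\<dots> = (\<Sum>i<Suc n. integral {?t i..?t (Suc i)} (\<lambda>x. f' x * w x)) + left_sum w f \<alpha> \<beta> n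
       - (\<Sum>i<Suc n. f (?t (Suc i)) * w (?t (Suc i)) - f (?t i) * w (?t i))"
      unfolding left_sum_def sum.distrib[symmetric] sum_subtractf[symmetric]
      by (intro sum.cong) (auto simp: algebra_simps)
    also have "\<dots> = left_sum w f \<alpha> \<beta> n - path_integral w f f' \<alpha> \<beta>"
      unfolding combine[OF order_refl, symmetric] tele path_integral_def by simp
    finally show ?thesis by simp
  qed
  show ?thesis
  proof (rule LIMSEQ_I)
    fix e :: real assume e: "0 < e"
    define d where "d = e / (2 * B * (\<beta> - \<alpha> + 1))"
    have d: "0 < d" using e B ab by (simp add: d_def)
    from ucont d obtain h where h: "0 < h" "\<And>x y. x \<in> {\<alpha>..\<beta>} \<Longrightarrow> y \<in> {\<alpha>..\<beta>} \<Longrightarrow> dist y x < h \<Longrightarrow> dist (w y) (w x) < d"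
      unfolding uniformly_continuous_on_def by metis
    obtain n0 where n0: "(\<beta> - \<alpha>) / h < real n0" using reals_Archimedean2 by blast
    have "norm (left_sum w f \<alpha> \<beta> n - path_integral w f f' \<alpha> \<beta>) < e" if n: "n0 \<le> n" for n
    proof -
      let ?t = "node \<alpha> \<beta> n"
      have "(\<beta> - \<alpha>) / h < real (Suc n)" using n n0 by simp
      then have mesh: "(\<beta> - \<alpha>) / real (Suc n) < h" using h(1) by (simp add: field_simps)
      have "norm (integral {?t i..?t (Suc i)} (\<lambda>x. f' x * (w x - w (?t (Suc i))))) \<le> (B * d) * (?t (Suc i) - ?t i)"
        if "i < Suc n" for i
      proof (rule integral_bound)
        have sub: "{?t i..?t (Suc i)} \<subseteq> {\<alpha>..\<beta>}"
          using that node_bounds[OF ab, of i n] node_bounds[OF ab, of "Suc i" n] by auto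
        show "?t i \<le> ?t (Suc i)" using ab by (intro node_mono) auto
        show "continuous_on {?t i..?t (Suc i)} (\<lambda>x. f' x * (w x - w (?t (Suc i))))"
          by (intro continuous_intros continuous_on_subset[OF f' sub] continuous_on_subset[OF w sub])
        fix x assume x: "x \<in> {?t i..?t (Suc i)}"
        have xb: "x \<in> {\<alpha>..\<beta>}" "?t (Suc i) \<in> {\<alpha>..\<beta>}" using x sub by auto
        have "dist x (?t (Suc i)) < h" using x mesh node_diff[of \<alpha> \<beta> n i] by (auto simp: dist_real_def)
        then have "\<bar>w x - w (?t (Suc i))\<bar> \<le> d" using h(2)[OF xb(2,1)] by (simp add: dist_real_def)
        then show "norm (f' x * (w x - w (?t (Suc i)))) \<le> B * d"
          using B(2)[OF xb(1)] B(1) by (simp add: abs_mult mult_mono)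
      qed
      then have "norm (left_sum w f \<alpha> \<beta> n - path_integral w f f' \<alpha> \<beta>) \<le> (\<Sum>i<Suc n. (B * d) * (?t (Suc i) - ?t i))"
        unfolding step by (intro order_trans[OF norm_sum] sum_mono) auto
      also have "\<dots> = B * d * (\<beta> - \<alpha>)"
        unfolding sum_distrib_left[symmetric] using sum_lessThan_telescope[of ?t "Suc n"] by simp
      also have "\<dots> \<le> B * d * (\<beta> - \<alpha> + 1)" using B d by simp
      also have "\<dots> = e / 2"
      proof -
        have "\<beta> - \<alpha> + 1 \<noteq> 0" using ab by simp
        then show ?thesis unfolding d_def using B(1) by (simp add: divide_simps del: of_nat_Suc)
      qed
      also have "\<dots> < e" using e by simp
      finally show ?thesis .
    qed
    then show "\<exists>n0. \<forall>n\<ge>n0. norm (left_sum w f \<alpha> \<beta> n - path_integral w f f' \<alpha> \<beta>) < e" by blast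
  qed
qed

text \<open>Ordinary Riemann sums are forward sums against the path \<open>w(x) = x\<close>.\<close>

lemma left_sum_tendsto_integral:
  assumes ab: "\<alpha> \<le> \<beta>"
    and f: "\<And>x. x \<in> {\<alpha>..\<beta>} \<Longrightarrow> (f has_real_derivative f' x) (at x)" and f': "continuous_on {\<alpha>..\<beta>} f'"
  shows "left_sum (\<lambda>x. x) f \<alpha> \<beta> \<longlonglongrightarrow> integral {\<alpha>..\<beta>} f"
proof -
  have cf: "continuous_on {\<alpha>..\<beta>} f"
    using f by (meson DERIV_continuous continuous_at_imp_continuous_on)
  have c: "continuous_on {\<alpha>..\<beta>} (\<lambda>x. f' x * x)" using f' by (intro continuous_intros)
  have "((\<lambda>x. f' x * x + f x) has_integral (f \<beta> * \<beta> - f \<alpha> * \<alpha>)) {\<alpha>..\<beta>}"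
  proof (rule fundamental_theorem_of_calculus[OF ab])
    fix x assume "x \<in> {\<alpha>..\<beta>}"
    then have "((\<lambda>x. f x * x) has_real_derivative f' x * x + f x) (at x within {\<alpha>..\<beta>})"
      using DERIV_mult[OF has_field_derivative_at_within[OF f] DERIV_ident, of x "{\<alpha>..\<beta>}"] by simp
    then show "((\<lambda>x. f x * x) has_vector_derivative f' x * x + f x) (at x within {\<alpha>..\<beta>})"
      by (simp add: has_real_derivative_iff_has_vector_derivative)
  qed
  moreover have "((\<lambda>x. f' x * x + f x) has_integral (integral {\<alpha>..\<beta>} (\<lambda>x. f' x * x) + integral {\<alpha>..\<beta>} f)) {\<alpha>..\<beta>}"
    using c cf by (intro has_integral_add integrable_integral integrable_continuous_real)
  ultimately have "f \<beta> * \<beta> - f \<alpha> * \<alpha> = integral {\<alpha>..\<beta>} (\<lambda>x. f' x * x) + integral {\<alpha>..\<beta>} f"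
    by (rule has_integral_unique)
  then have "path_integral (\<lambda>x. x) f f' \<alpha> \<beta> = integral {\<alpha>..\<beta>} f"
    unfolding path_integral_def by simp
  then show ?thesis using left_sum_tendsto_path_integral[OF ab continuous_on_id f f'] by simp
qed

context brownian
begin

section \<open>Deterministic integrands: existence\<close>

abbreviation wint :: "(real \<Rightarrow> real) \<Rightarrow> (real \<Rightarrow> real) \<Rightarrow> real \<Rightarrow> real \<Rightarrow> 'a \<Rightarrow> real" where
  "wint f f' \<alpha> \<beta> \<omega> \<equiv> path_integral (\<lambda>t. W t \<omega>) f f' \<alpha> \<beta>"

abbreviation wsum :: "(real \<Rightarrow> real) \<Rightarrow> real \<Rightarrow> real \<Rightarrow> nat \<Rightarrow> 'a \<Rightarrow> real" where
  "wsum f \<alpha> \<beta> n \<omega> \<equiv> left_sum (\<lambda>t. W t \<omega>) f \<alpha> \<beta> n"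

lemma M_measurable_AE_limit:
  fixes u :: "nat \<Rightarrow> 'a \<Rightarrow> real"
  assumes u: "\<And>n. u n \<in> borel_measurable M" and lim: "AE \<omega> in M. (\<lambda>n. u n \<omega>) \<longlonglongrightarrow> g \<omega>"
  shows "g \<in> borel_measurable M"
proof -
  let ?N = "{\<omega> \<in> space M. \<not> (\<lambda>n. u n \<omega>) \<longlonglongrightarrow> g \<omega>}"
  have [measurable]: "?N \<in> sets M" using lim by (simp add: AE_iff_null_sets null_sets_def)
  have "(\<lambda>\<omega>. indicator (space M - ?N) \<omega> * g \<omega>) \<in> borel_measurable M"
  proof (rule borel_measurable_LIMSEQ_real)
    show "(\<lambda>\<omega>. indicator (space M - ?N) \<omega> * u i \<omega>) \<in> borel_measurable M" for i
      using u by measurable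
    show "(\<lambda>i. indicator (space M - ?N) \<omega> * u i \<omega>) \<longlonglongrightarrow> indicator (space M - ?N) \<omega> * g \<omega>" if "\<omega> \<in> space M" for \<omega>
      using that by (auto simp: indicator_def)
  qed
  moreover have "AE \<omega> in M. indicator (space M - ?N) \<omega> * g \<omega> = g \<omega>"
    using lim AE_space by eventually_elim (simp add: indicator_def)
  ultimately show ?thesis by (rule M_measurable_AE_cong)
qed

lemma wsum_measurable:
  assumes "0 \<le> \<alpha>" "\<alpha> \<le> \<beta>"
  shows "wsum f \<alpha> \<beta> n \<in> borel_measurable M"
proof -
  have "0 \<le> node \<alpha> \<beta> n i" for i using assms node_mono[OF assms(2), of 0 i n] by simp
  then have [measurable]: "W (node \<alpha> \<beta> n i) \<in> borel_measurable M" for i by (rule W_measurable)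
  show ?thesis unfolding left_sum_def by (intro borel_measurable_sum) measurable
qed

context
  fixes f f' :: "real \<Rightarrow> real" and \<alpha> \<beta> :: real
  assumes ab: "0 \<le> \<alpha>" "\<alpha> \<le> \<beta>"
    and f: "\<And>x. x \<in> {\<alpha>..\<beta>} \<Longrightarrow> (f has_real_derivative f' x) (at x)" and f': "continuous_on {\<alpha>..\<beta>} f'"
begin

lemma wsum_AE_tendsto: "AE \<omega> in M. (\<lambda>n. wsum f \<alpha> \<beta> n \<omega>) \<longlonglongrightarrow> wint f f' \<alpha> \<beta> \<omega>"
  using W_cont
proof eventually_elim
  case (elim \<omega>)
  then have "continuous_on {\<alpha>..\<beta>} (\<lambda>t. W t \<omega>)" using ab by (rule_tac continuous_on_subset) auto
  from left_sum_tendsto_path_integral[OF ab(2) this f f'] show ?case .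
qed

lemma wint_measurable: "wint f f' \<alpha> \<beta> \<in> borel_measurable M"
  using wsum_measurable[OF ab] wsum_AE_tendsto by (rule M_measurable_AE_limit)

end

text \<open>The step functions converge uniformly to \<open>f\<close>, hence by the isometry the forward sums form a Cauchy
sequence in mean square. Their limit is identified by Fatou's lemma, since they converge almost
surely to the integral obtained by parts.\<close>

theorem has_ito_integral_smooth:
  assumes T: "0 \<le> T" and f: "\<And>x. x \<in> {0..T} \<Longrightarrow> (f has_real_derivative f' x) (at x)"
    and f': "continuous_on {0..T} f'" and prog: "progressively_measurable F (\<lambda>s _. f s)"
  shows "has_ito_integral M F W (\<lambda>s _. f s) T (wint f f' 0 T)"
proof -
  let ?t = "node 0 T"
  let ?\<xi> = "\<lambda>k i (_::'a). f (?t k i)"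
  obtain L where L: "0 < L" "\<And>x. x \<in> {0..T} \<Longrightarrow> \<bar>f' x\<bar> \<le> L"
  proof -
    have "bounded (f' ` {0..T})" using f' by (intro compact_imp_bounded compact_continuous_image) auto
    then show ?thesis using that unfolding bounded_pos by auto
  qed
  have lip: "\<bar>f x - f y\<bar> \<le> L * \<bar>x - y\<bar>" if "x \<in> {0..T}" "y \<in> {0..T}" for x y
  proof -
    have "norm (f x - f y) \<le> L * norm (x - y)"
    proof (rule field_differentiable_bound[of "{0..T}" f f'])
      show "(f has_field_derivative f' z) (at z within {0..T})" if "z \<in> {0..T}" for z
        using f[OF that] by (rule has_field_derivative_at_within)
    qed (use L that in auto)
    then show ?thesis by simp
  qed
  have simple: "simple_integrand M F (Suc k) (?t k) (?\<xi> k)" for k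
    using T by (auto simp: simple_integrand_def intro!: node_mono)
  have ito: "simple_ito_integral W (Suc k) (?t k) (?\<xi> k) T = wsum f 0 T k" for k
  proof
    fix \<omega>
    have "min (?t k i) T = ?t k i" if "i \<le> Suc k" for i using node_bounds(2)[OF T that] by simp
    then show "simple_ito_integral W (Suc k) (?t k) (?\<xi> k) T \<omega> = wsum f 0 T k \<omega>"
      unfolding simple_ito_integral_def left_sum_def by (intro sum.cong) auto
  qed
  define mesh where "mesh k = T / real (Suc k)" for k
  have mesh0: "mesh \<longlonglongrightarrow> 0" unfolding mesh_def using LIMSEQ_Suc[OF lim_const_over_n[of T]] by simp
  have near: "\<bar>simple_value (Suc k) (?t k) (?\<xi> k) s \<omega> - f s\<bar> \<le> L * mesh k" if s: "0 < s" "s \<le> T" for k s \<omega>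
  proof -
    define i where "i = (LEAST j. s \<le> ?t k j)"
    have ex: "s \<le> ?t k (Suc k)" using s by simp
    have i: "s \<le> ?t k i" "i \<le> Suc k"
      unfolding i_def using LeastI[of "\<lambda>j. s \<le> ?t k j", OF ex] Least_le[of "\<lambda>j. s \<le> ?t k j", OF ex] by auto
    have "i \<noteq> 0" using i(1) s by (intro notI) simp
    then obtain j where j: "i = Suc j" by (cases i) auto
    have j2: "?t k j < s" using not_less_Least[of j "\<lambda>j. s \<le> ?t k j"] unfolding i_def[symmetric] j by simp
    have other: "indicator {?t k m<..?t k (Suc m)} s = (0::real)" if "m \<noteq> j" for m
    proof (cases "m < j")
      case True
      then have "?t k (Suc m) \<le> ?t k j" using T by (intro node_mono) auto
      then show ?thesis using j2 by (auto simp: indicator_def)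
    next
      case False
      then have "?t k (Suc j) \<le> ?t k m" using T that by (intro node_mono) auto
      then show ?thesis using i j by (auto simp: indicator_def)
    qed
    have "simple_value (Suc k) (?t k) (?\<xi> k) s \<omega> = (\<Sum>m\<in>{j}. ?\<xi> k m \<omega> * indicator {?t k m<..?t k (Suc m)} s)"
      unfolding simple_value_def using i j other by (intro sum.mono_neutral_right) auto
    also have "\<dots> = f (?t k j)" using i j j2 by (auto simp: indicator_def)
    finally have e: "simple_value (Suc k) (?t k) (?\<xi> k) s \<omega> = f (?t k j)" .
    have "\<bar>f (?t k j) - f s\<bar> \<le> L * \<bar>?t k j - s\<bar>"
      using s i j node_bounds[OF T, of j k] by (intro lip) auto
    also have "\<dots> \<le> L * mesh k"
      using i j j2 node_diff[of 0 T k j] L(1) by (intro mult_left_mono) (auto simp: mesh_def)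
    finally show ?thesis unfolding e .
  qed
  have bound: "(\<integral>\<^sup>+\<omega>. (\<integral>\<^sup>+s. ennreal ((indicator {0..T} s * g s \<omega> - indicator {0..T} s * h s \<omega>)\<^sup>2) \<partial>lborel) \<partial>M) \<le> ennreal (c\<^sup>2 * T)"
    if c: "\<And>s \<omega>. 0 < s \<Longrightarrow> s \<le> T \<Longrightarrow> \<bar>g s \<omega> - h s \<omega>\<bar> \<le> c" for g h :: "real \<Rightarrow> 'a \<Rightarrow> real" and c
  proof -
    have "(\<integral>\<^sup>+s. ennreal ((indicator {0..T} s * g s \<omega> - indicator {0..T} s * h s \<omega>)\<^sup>2) \<partial>lborel) \<le> ennreal (c\<^sup>2 * T)" for \<omega>
    proof -
      have "(\<integral>\<^sup>+s. ennreal ((indicator {0..T} s * g s \<omega> - indicator {0..T} s * h s \<omega>)\<^sup>2) \<partial>lborel)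
         \<le> (\<integral>\<^sup>+s. ennreal (c\<^sup>2) * indicator {0..T} s \<partial>lborel)"
      proof (rule nn_integral_mono_AE)
        have "AE s in lborel. s \<noteq> (0::real)" by (rule AE_lborel_singleton)
        then show "AE s in lborel. ennreal ((indicator {0..T} s * g s \<omega> - indicator {0..T} s * h s \<omega>)\<^sup>2) \<le> ennreal (c\<^sup>2) * indicator {0..T} s"
        proof eventually_elim
          case (elim s)
          show ?case
          proof (cases "s \<in> {0..T}")
            case True
            then have "\<bar>g s \<omega> - h s \<omega>\<bar> \<le> c" using c[of s \<omega>] elim by auto
            then have "\<bar>g s \<omega> - h s \<omega>\<bar>\<^sup>2 \<le> c\<^sup>2" by (intro power_mono) auto
            then show ?thesis using True by (simp add: ennreal_leI)
          qed simp
        qed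
      qed
      also have "\<dots> = ennreal (c\<^sup>2) * ennreal T" using T by (simp add: nn_integral_cmult_indicator)
      finally show ?thesis using T by (simp add: ennreal_mult'')
    qed
    then have "(\<integral>\<^sup>+\<omega>. (\<integral>\<^sup>+s. ennreal ((indicator {0..T} s * g s \<omega> - indicator {0..T} s * h s \<omega>)\<^sup>2) \<partial>lborel) \<partial>M)
       \<le> (\<integral>\<^sup>+\<omega>. ennreal (c\<^sup>2 * T) \<partial>M)" by (intro nn_integral_mono) auto
    then show ?thesis by (simp add: emeasure_space_1)
  qed
  have H: "(\<lambda>(\<omega>::'a, s). indicator {0..T} s * f s) \<in> borel_measurable (M \<Otimes>\<^sub>M lborel)"
    using progressive_joint_measurable[OF prog T] .
  have 1: "(\<lambda>k. \<integral>\<^sup>+\<omega>. (\<integral>\<^sup>+s\<in>{0..T}. ennreal ((simple_value (Suc k) (?t k) (?\<xi> k) s \<omega> - f s)\<^sup>2) \<partial>lborel) \<partial>M) \<longlonglongrightarrow> 0"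
  proof (rule tendsto_sandwich[OF _ _ tendsto_const])
    show "eventually (\<lambda>k. (\<integral>\<^sup>+\<omega>. (\<integral>\<^sup>+s\<in>{0..T}. ennreal ((simple_value (Suc k) (?t k) (?\<xi> k) s \<omega> - f s)\<^sup>2) \<partial>lborel) \<partial>M) \<le> ennreal ((L * mesh k)\<^sup>2 * T)) sequentially"
      unfolding nn_integral_process_eq_sqd(1)[OF simple_value_joint_measurable[OF simple] H]
        nn_integral_process_eq_sqd(2)[OF simple_value_joint_measurable[OF simple] H, symmetric]
      by (intro always_eventually allI bound near)
    have "(\<lambda>k. (L * mesh k)\<^sup>2 * T) \<longlonglongrightarrow> (L * 0)\<^sup>2 * T" by (intro tendsto_intros mesh0)
    then show "(\<lambda>k. ennreal ((L * mesh k)\<^sup>2 * T)) \<longlonglongrightarrow> 0"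
      using tendsto_ennrealI by fastforce
  qed auto
  have cauchy: "sqd M (wsum f 0 T k) (wsum f 0 T m) \<le> ennreal ((2 * L * mesh k)\<^sup>2 * T)" if "k \<le> m" for k m
  proof -
    have mm: "mesh m \<le> mesh k" unfolding mesh_def using that T by (intro divide_left_mono) auto
    show ?thesis
      using simple_difference_isometry[OF simple simple T, of k m] unfolding ito
    proof (simp only:, intro bound)
      fix s \<omega> assume s: "0 < s" "s \<le> T"
      have "L * mesh m \<le> L * mesh k" using mm L by simp
      then show "\<bar>simple_value (Suc k) (?t k) (?\<xi> k) s \<omega> - simple_value (Suc m) (?t m) (?\<xi> m) s \<omega>\<bar> \<le> 2 * L * mesh k"
        using near[OF s, of k \<omega>] near[OF s, of m \<omega>] by linarith
    qed
  qed
  have conv: "AE \<omega> in M. (\<lambda>n. wsum f 0 T n \<omega>) \<longlonglongrightarrow> wint f f' 0 T \<omega>"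
    using wsum_AE_tendsto[OF order_refl T f f'] .
  have meas [measurable]: "wsum f 0 T n \<in> borel_measurable M" for n using T by (intro wsum_measurable) auto
  have fatou: "sqd M (wsum f 0 T k) (wint f f' 0 T) \<le> ennreal ((2 * L * mesh k)\<^sup>2 * T)" for k
  proof -
    let ?g = "\<lambda>m \<omega>. ennreal ((wsum f 0 T k \<omega> - wsum f 0 T m \<omega>)\<^sup>2)"
    have "sqd M (wsum f 0 T k) (wint f f' 0 T) = (\<integral>\<^sup>+\<omega>. liminf (\<lambda>m. ?g m \<omega>) \<partial>M)"
      unfolding sqd_def
    proof (rule nn_integral_cong_AE)
      show "AE \<omega> in M. ennreal ((wsum f 0 T k \<omega> - wint f f' 0 T \<omega>)\<^sup>2) = liminf (\<lambda>m. ?g m \<omega>)"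
        using conv
      proof eventually_elim
        case (elim \<omega>)
        have "(\<lambda>m. ?g m \<omega>) \<longlonglongrightarrow> ennreal ((wsum f 0 T k \<omega> - wint f f' 0 T \<omega>)\<^sup>2)"
          by (intro tendsto_ennrealI tendsto_intros elim)
        then show ?case using lim_imp_Liminf[OF sequentially_bot] by fastforce
      qed
    qed
    also have "\<dots> \<le> liminf (\<lambda>m. \<integral>\<^sup>+\<omega>. ?g m \<omega> \<partial>M)" by (intro nn_integral_liminf) measurable
    also have "\<dots> \<le> limsup (\<lambda>m. \<integral>\<^sup>+\<omega>. ?g m \<omega> \<partial>M)" by (intro Liminf_le_Limsup) simp
    also have "\<dots> \<le> ennreal ((2 * L * mesh k)\<^sup>2 * T)"
      using cauchy[of k] unfolding sqd_def
      by (intro Limsup_bounded eventually_sequentiallyI[of k]) auto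
    finally show ?thesis .
  qed
  have 2: "(\<lambda>k. \<integral>\<^sup>+\<omega>. ennreal ((simple_ito_integral W (Suc k) (?t k) (?\<xi> k) T \<omega> - wint f f' 0 T \<omega>)\<^sup>2) \<partial>M) \<longlonglongrightarrow> 0"
  proof (rule tendsto_sandwich[OF _ _ tendsto_const])
    show "eventually (\<lambda>k. (\<integral>\<^sup>+\<omega>. ennreal ((simple_ito_integral W (Suc k) (?t k) (?\<xi> k) T \<omega> - wint f f' 0 T \<omega>)\<^sup>2) \<partial>M) \<le> ennreal ((2 * L * mesh k)\<^sup>2 * T)) sequentially"
      unfolding ito using fatou unfolding sqd_def by simp
    have "(\<lambda>k. (2 * L * mesh k)\<^sup>2 * T) \<longlonglongrightarrow> (2 * L * 0)\<^sup>2 * T" by (intro tendsto_intros mesh0)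
    then show "(\<lambda>k. ennreal ((2 * L * mesh k)\<^sup>2 * T)) \<longlonglongrightarrow> 0"
      using tendsto_ennrealI by fastforce
  qed auto
  show ?thesis
    unfolding has_ito_integral_def
    using prog wint_measurable[OF order_refl T f f'] simple 1 2
    by (intro conjI exI[of _ "\<lambda>k. Suc k"] exI[of _ ?t] exI[of _ ?\<xi>] allI) auto
qed


section \<open>Exponentials of Wiener integrals given the past\<close>

text \<open>The exponential of the sum up to step \<open>k\<close> is measurable at the \<open>k\<close>-th node, so the increments are
integrated out one at a time.\<close>

lemma exp_increments:
  fixes c :: "nat \<Rightarrow> real"
  assumes \<tau>: "0 \<le> \<tau> 0" "\<And>i. i < n \<Longrightarrow> \<tau> i \<le> \<tau> (Suc i)" and A: "A \<in> sets (F (\<tau> 0))" and k: "k \<le> n"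
  defines "Y \<equiv> \<lambda>k \<omega>. indicator A \<omega> * exp (\<Sum>i<k. c i * (W (\<tau> (Suc i)) \<omega> - W (\<tau> i) \<omega>)) :: real"
  shows "Y k \<in> borel_measurable (F (\<tau> k)) \<and> integrable M (Y k) \<and>
    expectation (Y k) = prob A * exp ((\<Sum>i<k. (c i)\<^sup>2 * (\<tau> (Suc i) - \<tau> i)) / 2)"
  using k
proof (induction k)
  case 0
  have "A \<in> sets M" using A sets_F_subset by blast
  moreover from this have "integrable M (indicator A :: 'a \<Rightarrow> real)"
    by (intro integrable_real_indicator) (auto simp: less_top[symmetric])
  ultimately show ?case using A by (auto simp: Y_def)
next
  case (Suc k)
  then have IH: "Y k \<in> borel_measurable (F (\<tau> k))" "integrable M (Y k)"
    "expectation (Y k) = prob A * exp ((\<Sum>i<k. (c i)\<^sup>2 * (\<tau> (Suc i) - \<tau> i)) / 2)" by auto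
  have pos: "0 \<le> \<tau> i" if "i \<le> n" for i using that
  proof (induction i)
    case (Suc i) then show ?case using \<tau>(2)[of i] by simp
  qed (rule \<tau>)
  have k: "0 \<le> \<tau> k" "\<tau> k \<le> \<tau> (Suc k)" using pos[of k] \<tau>(2)[of k] Suc.prems by auto
  have step: "Y (Suc k) = (\<lambda>\<omega>. Y k \<omega> * exp (c k * (W (\<tau> (Suc k)) \<omega> - W (\<tau> k) \<omega>)))"
    by (simp add: Y_def fun_eq_iff exp_add)
  note E = increment_moments(5,6)[OF k, of "c k"]
  note P = past_times_increment[OF k IH(1,2), of "\<lambda>x. exp (c k * x)", OF _ E(1)]
  have "Y (Suc k) \<in> borel_measurable (F (\<tau> (Suc k)))"
    unfolding step using F_measurable_mono[OF IH(1) k(2)] W_F_measurable[of "\<tau> k" "\<tau> (Suc k)"]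
      W_F_measurable[of "\<tau> (Suc k)" "\<tau> (Suc k)"] k by (auto intro!: borel_measurable_times borel_measurable_exp[THEN measurable_compose[rotated]])
  moreover have "integrable M (Y (Suc k))" unfolding step using P(1) by simp
  moreover have "expectation (Y (Suc k)) = prob A * exp ((\<Sum>i<Suc k. (c i)\<^sup>2 * (\<tau> (Suc i) - \<tau> i)) / 2)"
  proof -
    have "expectation (Y (Suc k)) = expectation (Y k) * exp ((c k)\<^sup>2 * (\<tau> (Suc k) - \<tau> k) / 2)"
      unfolding step using P(2) E(2) by simp
    then show ?thesis unfolding IH(3) by (simp add: exp_add[symmetric] add_divide_distrib)
  qed
  ultimately show ?case by blast
qed

text \<open>Bounded second moments give uniform integrability: from \<open>y \<le> min(y, K) + y\<^sup>2 / K\<close> the part above a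
level \<open>K\<close> contributes at most \<open>C / K\<close>.\<close>

lemma expectation_limit_of_second_moment_bound:
  fixes Y :: "nat \<Rightarrow> 'a \<Rightarrow> real"
  assumes Y: "\<And>n. Y n \<in> borel_measurable M" and X: "X \<in> borel_measurable M"
    and nonneg: "\<And>n \<omega>. 0 \<le> Y n \<omega>" "\<And>\<omega>. 0 \<le> X \<omega>"
    and lim: "AE \<omega> in M. (\<lambda>n. Y n \<omega>) \<longlonglongrightarrow> X \<omega>"
    and int: "\<And>n. integrable M (Y n)" and a: "(\<lambda>n. expectation (Y n)) \<longlonglongrightarrow> a"
    and sq: "\<And>n. integrable M (\<lambda>\<omega>. (Y n \<omega>)\<^sup>2)" "\<And>n. expectation (\<lambda>\<omega>. (Y n \<omega>)\<^sup>2) \<le> C"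
  shows "integrable M X" "expectation X = a"
proof -
  note [measurable] = Y X
  have a0: "0 \<le> a" using a nonneg by (intro LIMSEQ_le_const[OF a]) auto
  have "(\<integral>\<^sup>+\<omega>. ennreal (X \<omega>) \<partial>M) = (\<integral>\<^sup>+\<omega>. liminf (\<lambda>n. ennreal (Y n \<omega>)) \<partial>M)"
  proof (rule nn_integral_cong_AE)
    show "AE \<omega> in M. ennreal (X \<omega>) = liminf (\<lambda>n. ennreal (Y n \<omega>))"
      using lim
    proof eventually_elim
      case (elim \<omega>)
      have "(\<lambda>n. ennreal (Y n \<omega>)) \<longlonglongrightarrow> ennreal (X \<omega>)" by (intro tendsto_ennrealI elim)
      then show ?case using lim_imp_Liminf[OF sequentially_bot] by metis
    qed
  qed
  also have "\<dots> \<le> liminf (\<lambda>n. \<integral>\<^sup>+\<omega>. ennreal (Y n \<omega>) \<partial>M)" by (intro nn_integral_liminf) measurable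
  also have "\<dots> = liminf (\<lambda>n. ennreal (expectation (Y n)))"
    using int nonneg by (intro arg_cong[where f=liminf] ext nn_integral_eq_integral) auto
  also have "\<dots> = ennreal a"
    by (intro lim_imp_Liminf tendsto_ennrealI a) simp
  finally have le: "(\<integral>\<^sup>+\<omega>. ennreal (X \<omega>) \<partial>M) \<le> ennreal a" .
  show intX: "integrable M X"
    using le nonneg by (intro integrableI_bounded) (auto simp: order_le_less_trans)
  have upper: "expectation X \<le> a"
    using le nn_integral_eq_integral[OF intX] nonneg a0 by simp
  have C0: "0 \<le> C" using order_trans[OF _ sq(2)[of 0], of 0] by simp
  have lower: "a \<le> expectation X + C / K" if K: "0 < K" for K
  proof -
    have intm: "integrable M (\<lambda>\<omega>. min (Y n \<omega>) K)" for n
      using K nonneg by (intro integrable_const_bound[of _ K]) (auto simp: min_def)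
    have intmX: "integrable M (\<lambda>\<omega>. min (X \<omega>) K)"
      using K nonneg by (intro integrable_const_bound[of _ K]) (auto simp: min_def)
    have 1: "expectation (Y n) \<le> expectation (\<lambda>\<omega>. min (Y n \<omega>) K) + C / K" for n
    proof -
      have "expectation (Y n) \<le> expectation (\<lambda>\<omega>. min (Y n \<omega>) K + (Y n \<omega>)\<^sup>2 / K)"
      proof (intro integral_mono int Bochner_Integration.integrable_add intm)
        show "integrable M (\<lambda>\<omega>. (Y n \<omega>)\<^sup>2 / K)" using sq(1) by simp
        show "Y n \<omega> \<le> min (Y n \<omega>) K + (Y n \<omega>)\<^sup>2 / K" for \<omega>
        proof (cases "Y n \<omega> \<le> K")
          case True then show ?thesis using K by simp
        next
          case False
          then have "Y n \<omega> * K \<le> Y n \<omega> * Y n \<omega>" using nonneg(1)[of n \<omega>] by (intro mult_left_mono) auto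
          then have "Y n \<omega> \<le> (Y n \<omega>)\<^sup>2 / K" using K by (simp add: field_simps power2_eq_square)
          then show ?thesis using False K by simp
        qed
      qed
      also have "\<dots> = expectation (\<lambda>\<omega>. min (Y n \<omega>) K) + expectation (\<lambda>\<omega>. (Y n \<omega>)\<^sup>2) / K"
        using sq(1) intm by simp
      also have "\<dots> \<le> expectation (\<lambda>\<omega>. min (Y n \<omega>) K) + C / K"
        using sq(2)[of n] K by (simp add: divide_right_mono)
      finally show ?thesis .
    qed
    have "(\<lambda>n. expectation (\<lambda>\<omega>. min (Y n \<omega>) K)) \<longlonglongrightarrow> expectation (\<lambda>\<omega>. min (X \<omega>) K)"
    proof (rule integral_dominated_convergence[where w="\<lambda>_. K"])
      show "AE \<omega> in M. (\<lambda>n. min (Y n \<omega>) K) \<longlonglongrightarrow> min (X \<omega>) K"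
        using lim by eventually_elim (intro tendsto_min tendsto_const)
      show "AE \<omega> in M. norm (min (Y n \<omega>) K) \<le> K" for n
        using K nonneg by (auto simp: min_def)
    qed auto
    then have "(\<lambda>n. expectation (\<lambda>\<omega>. min (Y n \<omega>) K) + C / K) \<longlonglongrightarrow> expectation (\<lambda>\<omega>. min (X \<omega>) K) + C / K"
      by (intro tendsto_intros)
    from LIMSEQ_le[OF a this] 1 have "a \<le> expectation (\<lambda>\<omega>. min (X \<omega>) K) + C / K" by blast
    also have "expectation (\<lambda>\<omega>. min (X \<omega>) K) \<le> expectation X"
      by (intro integral_mono intmX intX) auto
    finally show ?thesis by simp
  qed
  have "a \<le> expectation X"
  proof (rule field_le_epsilon)
    fix e :: real assume e: "0 < e"
    \<comment> \<open>The level \<open>(C + 1) / e\<close> makes the remainder at most \<open>e\<close>, also when \<open>C = 0\<close>.\<close>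
    have "a \<le> expectation X + C / ((C + 1) / e)" using e C0 by (intro lower) auto
    also have "C / ((C + 1) / e) \<le> e" using e C0 by (simp add: field_simps)
    finally show "a \<le> expectation X + e" by simp
  qed
  then show "expectation X = a" using upper by simp
qed

context
  fixes f f' :: "real \<Rightarrow> real" and \<alpha> \<beta> :: real
  assumes ab: "0 \<le> \<alpha>" "\<alpha> \<le> \<beta>"
    and f: "\<And>x. x \<in> {\<alpha>..\<beta>} \<Longrightarrow> (f has_real_derivative f' x) (at x)" and f': "continuous_on {\<alpha>..\<beta>} f'"
begin

text \<open>For the forward sums the identity is exact with a Riemann sum of \<open>f\<^sup>2\<close> in the exponent. The second
moments are the same quantities for \<open>2 f\<close> and hence bounded.\<close>

lemma exp_wint_past:
  assumes A: "A \<in> sets (F \<alpha>)"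
  shows "integrable M (\<lambda>\<omega>. indicator A \<omega> * exp (wint f f' \<alpha> \<beta> \<omega>))"
    and "expectation (\<lambda>\<omega>. indicator A \<omega> * exp (wint f f' \<alpha> \<beta> \<omega>)) = prob A * exp (integral {\<alpha>..\<beta>} (\<lambda>x. (f x)\<^sup>2) / 2)"
proof -
  let ?t = "node \<alpha> \<beta>"
  define v where "v n = left_sum (\<lambda>x. x) (\<lambda>x. (f x)\<^sup>2) \<alpha> \<beta> n" for n
  have AM: "A \<in> sets M" using A sets_F_subset by blast
  have sum: "integrable M (\<lambda>\<omega>. indicator B \<omega> * exp (\<theta> * wsum f \<alpha> \<beta> n \<omega>)) \<and>
      expectation (\<lambda>\<omega>. indicator B \<omega> * exp (\<theta> * wsum f \<alpha> \<beta> n \<omega>)) = prob B * exp (\<theta>\<^sup>2 * v n / 2)"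
    if B: "B \<in> sets (F \<alpha>)" for B \<theta> n
  proof -
    have "?t n i \<le> ?t n (Suc i)" for i using ab by (intro node_mono) auto
    from exp_increments[of "?t n" "Suc n" B "Suc n" "\<lambda>i. \<theta> * f (?t n i)"] this ab B
    show ?thesis
      by (simp add: left_sum_def v_def sum_distrib_left mult.assoc power_mult_distrib del: sum.lessThan_Suc)
  qed
  have cf: "continuous_on {\<alpha>..\<beta>} f"
    using f by (meson DERIV_continuous continuous_at_imp_continuous_on)
  have v: "v \<longlonglongrightarrow> integral {\<alpha>..\<beta>} (\<lambda>x. (f x)\<^sup>2)"
    unfolding v_def
  proof (rule left_sum_tendsto_integral[OF ab(2)])
    show "((\<lambda>x. (f x)\<^sup>2) has_real_derivative 2 * f x * f' x) (at x)" if "x \<in> {\<alpha>..\<beta>}" for x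
      using DERIV_power[OF f[OF that], of 2] by (simp add: mult_ac)
    show "continuous_on {\<alpha>..\<beta>} (\<lambda>x. 2 * f x * f' x)" by (intro continuous_intros cf f')
  qed
  have "Bseq v" using v by (intro convergent_imp_Bseq convergentI)
  then obtain K where "\<And>n. \<bar>v n\<bar> \<le> K" by (auto simp: Bseq_def)
  then have K: "v n \<le> K" for n using abs_le_D1 by blast
  let ?Y = "\<lambda>n \<omega>. indicator A \<omega> * exp (wsum f \<alpha> \<beta> n \<omega>) :: real"
  have sq: "(?Y n \<omega>)\<^sup>2 = indicator A \<omega> * exp (2 * wsum f \<alpha> \<beta> n \<omega>)" for n \<omega>
    by (simp add: power_mult_distrib indicator_def exp_double)
  have [measurable]: "wint f f' \<alpha> \<beta> \<in> borel_measurable M"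
    using f by (intro wint_measurable ab f') auto
  note [measurable] = wsum_measurable[OF ab] AM
  have Y: "?Y n \<in> borel_measurable M" for n by measurable
  have X: "(\<lambda>\<omega>. indicator A \<omega> * exp (wint f f' \<alpha> \<beta> \<omega>)) \<in> borel_measurable M" by measurable
  have lim: "AE \<omega> in M. (\<lambda>n. ?Y n \<omega>) \<longlonglongrightarrow> indicator A \<omega> * exp (wint f f' \<alpha> \<beta> \<omega>)"
  proof -
    have "AE \<omega> in M. (\<lambda>n. wsum f \<alpha> \<beta> n \<omega>) \<longlonglongrightarrow> wint f f' \<alpha> \<beta> \<omega>"
      using f by (intro wsum_AE_tendsto ab f') auto
    then show ?thesis by eventually_elim (intro tendsto_intros)
  qed
  have int: "integrable M (?Y n)" for n using sum[OF A, of 1 n] by simp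
  have a: "(\<lambda>n. expectation (?Y n)) \<longlonglongrightarrow> prob A * exp (integral {\<alpha>..\<beta>} (\<lambda>x. (f x)\<^sup>2) / 2)"
    using sum[OF A, of 1] by (auto intro!: tendsto_intros v)
  have s1: "integrable M (\<lambda>\<omega>. (?Y n \<omega>)\<^sup>2)" for n unfolding sq using sum[OF A, of 2 n] by simp
  have s2: "expectation (\<lambda>\<omega>. (?Y n \<omega>)\<^sup>2) \<le> exp (2 * K)" for n
  proof -
    have "expectation (\<lambda>\<omega>. (?Y n \<omega>)\<^sup>2) = prob A * exp (2 * v n)" unfolding sq using sum[OF A, of 2 n] by simp
    also have "\<dots> \<le> 1 * exp (2 * K)" using K[of n] by (intro mult_mono) auto
    finally show ?thesis by simp
  qed
  note L = expectation_limit_of_second_moment_bound[OF Y X _ _ lim int a s1 s2]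
  show "integrable M (\<lambda>\<omega>. indicator A \<omega> * exp (wint f f' \<alpha> \<beta> \<omega>))" by (rule L(1)) auto
  show "expectation (\<lambda>\<omega>. indicator A \<omega> * exp (wint f f' \<alpha> \<beta> \<omega>)) = prob A * exp (integral {\<alpha>..\<beta>} (\<lambda>x. (f x)\<^sup>2) / 2)"
    by (rule L(2)) auto
qed

text \<open>The known factor \<open>exp G\<close> is pulled out of the nonnegative conditional expectation, where the question
of integrability does not arise; the real-valued one then follows.\<close>

theorem cond_exp_exp_wint:
  assumes G: "G \<in> borel_measurable (F \<alpha>)"
  shows "AE \<omega> in M. real_cond_exp M (F \<alpha>) (\<lambda>\<omega>. exp (G \<omega> + wint f f' \<alpha> \<beta> \<omega>)) \<omega>
    = exp (G \<omega> + integral {\<alpha>..\<beta>} (\<lambda>x. (f x)\<^sup>2) / 2)"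
proof -
  interpret F: finite_measure_subalgebra M "F \<alpha>"
    by unfold_locales (rule F_subalgebra)
  let ?X = "wint f f' \<alpha> \<beta>" and ?c = "exp (integral {\<alpha>..\<beta>} (\<lambda>x. (f x)\<^sup>2) / 2)"
  have X [measurable]: "?X \<in> borel_measurable M"
    using f by (intro wint_measurable ab f') auto
  have GM [measurable]: "G \<in> borel_measurable M" using G by (rule F_measurable_M)
  have "AE \<omega> in M. ennreal ?c = nn_cond_exp M (F \<alpha>) (\<lambda>\<omega>. ennreal (exp (?X \<omega>))) \<omega>"
  proof (rule F.nn_cond_exp_charact[of _ "\<lambda>_. ennreal ?c"])
    fix A assume A: "A \<in> sets (F \<alpha>)"
    then have AM [measurable]: "A \<in> sets M" using sets_F_subset by blast
    have "(\<integral>\<^sup>+\<omega>\<in>A. ennreal (exp (?X \<omega>)) \<partial>M) = (\<integral>\<^sup>+\<omega>. ennreal (indicator A \<omega> * exp (?X \<omega>)) \<partial>M)"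
      by (intro nn_integral_cong) (auto simp: indicator_def)
    also have "\<dots> = ennreal (prob A * ?c)"
      using nn_integral_eq_integral[OF exp_wint_past(1)[OF A]] exp_wint_past(2)[OF A] by simp
    also have "\<dots> = (\<integral>\<^sup>+\<omega>\<in>A. ennreal ?c \<partial>M)"
      by (subst nn_integral_cmult_indicator) (auto simp: emeasure_eq_measure ennreal_mult mult.commute)
    finally show "(\<integral>\<^sup>+\<omega>\<in>A. ennreal (exp (?X \<omega>)) \<partial>M) = (\<integral>\<^sup>+\<omega>\<in>A. ennreal ?c \<partial>M)" .
  qed auto
  moreover have "AE \<omega> in M. ennreal (exp (G \<omega>)) * nn_cond_exp M (F \<alpha>) (\<lambda>\<omega>. ennreal (exp (?X \<omega>))) \<omega>
     = nn_cond_exp M (F \<alpha>) (\<lambda>\<omega>. ennreal (exp (G \<omega>)) * ennreal (exp (?X \<omega>))) \<omega>"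
  proof (rule F.nn_cond_exp_prod)
    show "(\<lambda>\<omega>. ennreal (exp (G \<omega>))) \<in> borel_measurable (F \<alpha>)" using G by measurable
  qed measurable
  moreover have "AE \<omega> in M. 0 = nn_cond_exp M (F \<alpha>) (\<lambda>_. 0) \<omega>"
    by (intro F.nn_cond_exp_F_meas) auto
  ultimately show ?thesis
  proof eventually_elim
    case (elim \<omega>)
    have 1: "(\<lambda>\<omega>. ennreal (exp (G \<omega> + ?X \<omega>))) = (\<lambda>\<omega>. ennreal (exp (G \<omega>)) * ennreal (exp (?X \<omega>)))"
      by (simp add: exp_add ennreal_mult)
    have 2: "(\<lambda>\<omega>. ennreal (- exp (G \<omega> + ?X \<omega>))) = (\<lambda>_. 0)" by (simp add: ennreal_neg)
    have "real_cond_exp M (F \<alpha>) (\<lambda>\<omega>. exp (G \<omega> + ?X \<omega>)) \<omega> = enn2real (ennreal (exp (G \<omega>)) * ennreal ?c)"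
      unfolding real_cond_exp_def 1 2 using elim by simp
    then show ?case by (simp add: ennreal_mult[symmetric] exp_add)
  qed
qed

end

end

section \<open>Pathwise calculus\<close>

lemma LBINT_eq_integral:
  fixes f :: "real \<Rightarrow> real"
  assumes "continuous_on {a..b} f"
  shows "(LBINT x:{a..b}. f x) = integral {a..b} f"
  using borel_integrable_atLeastAtMost'[OF assms] by (rule set_borel_integral_eq_integral)

lemma DERIV_imp_continuous_on:
  fixes f :: "real \<Rightarrow> real"
  assumes "\<And>x. x \<in> S \<Longrightarrow> (f has_real_derivative f' x) (at x)"
  shows "continuous_on S f"
  using assms by (intro continuous_at_imp_continuous_on ballI DERIV_isCont)

lemma zero_derivative_eq:
  fixes Q :: "real \<Rightarrow> real"
  assumes "\<And>x. x \<in> {a..b} \<Longrightarrow> (Q has_real_derivative 0) (at x within {a..b})" and "s \<in> {a..b}" "t \<in> {a..b}"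
  shows "Q s = Q t"
  using has_field_derivative_zero_constant[of "{a..b}" Q] assms by fastforce

text \<open>Here \<open>w\<close> is the driving path, \<open>n = \<integral> H dw\<close>, and the path \<open>r\<close> is driven by \<open>w\<close> with
drift \<open>- g n\<close>. Formally \<open>\<integral>\<^sub>t\<^sup>T r\<close> equals \<open>c(t) r(t)\<close>, a
deterministic term, and \<open>\<sigma> \<integral> c (dw - g n ds)\<close>, and integration by parts of \<open>\<integral> c g n\<close> with
\<open>k(x) = \<integral>\<^sub>x\<^sup>T c g\<close> separates the past value \<open>n(t)\<close> from an integral over \<open>[t,T]\<close>. As
\<open>w\<close> is merely continuous, the identity is verified by exhibiting a combination of the
differentiable quantities, called \<open>Q\<close>, whose derivative vanishes.\<close>

lemma integrated_short_rate_path: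
  fixes w r c k H H' g :: "real \<Rightarrow> real" and a b \<sigma> r0 t T :: real
  assumes t: "0 \<le> t" "t \<le> T" and b: "b \<noteq> 0"
    and w: "continuous_on {0..T} w" "w 0 = 0" and r: "continuous_on {0..T} r"
    and c: "\<And>x. x \<in> {0..T} \<Longrightarrow> (c has_real_derivative b * c x - 1) (at x)" "c T = 0"
    and g: "continuous_on {0..T} g"
    and k: "\<And>x. x \<in> {0..T} \<Longrightarrow> (k has_real_derivative - g x * c x) (at x)" "k T = 0"
    and H: "\<And>x. x \<in> {0..T} \<Longrightarrow> (H has_real_derivative H' x) (at x)" and H': "continuous_on {0..T} H'"
  defines "n \<equiv> path_integral w H H' 0"
  assumes eq: "\<And>x. x \<in> {0..T} \<Longrightarrow> r x = r0 + (a * x - b * integral {0..x} r) + \<sigma> * (w x - integral {0..x} (\<lambda>s. g s * n s))"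
  shows "integral {t..T} r = c t * r t + a / b * (T - t - c t)
    + \<sigma> * (path_integral w (\<lambda>x. c x - k x * H x) (\<lambda>x. b * c x - 1 + g x * c x * H x - k x * H' x) t T - k t * n t)"
proof -
  have T: "0 \<le> T" using t by simp
  let ?I = "{0..T}"
  let ?f' = "\<lambda>x. b * c x - 1 + g x * c x * H x - k x * H' x"
  have cc: "continuous_on ?I c" "continuous_on ?I k" "continuous_on ?I H"
    by (rule DERIV_imp_continuous_on, fact)+
  define \<Psi> where "\<Psi> x = integral {0..x} (\<lambda>s. H' s * w s)" for x
  have n: "n x = H x * w x - \<Psi> x" for x using w(2) by (simp add: n_def path_integral_def \<Psi>_def)
  have d\<Psi>: "(\<Psi> has_real_derivative H' x * w x) (at x within ?I)" if "x \<in> ?I" for x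
    unfolding \<Psi>_def using that by (intro integral_has_real_derivative continuous_intros H' w)
  have c\<Psi>: "continuous_on ?I \<Psi>" by (rule DERIV_continuous_on[OF d\<Psi>])
  define \<Theta> where "\<Theta> x = integral {0..x} (\<lambda>s. ?f' s * w s)" for x
  have cf': "continuous_on ?I (\<lambda>s. ?f' s * w s)" by (intro continuous_intros cc w g H')
  have d\<Theta>: "(\<Theta> has_real_derivative ?f' x * w x) (at x within ?I)" if "x \<in> ?I" for x
    unfolding \<Theta>_def using that by (intro integral_has_real_derivative cf')
  have cn: "continuous_on ?I n" unfolding n by (intro continuous_intros cc w c\<Psi>)
  define \<Phi> where "\<Phi> x = integral {0..x} (\<lambda>s. g s * n s)" for x
  have d\<Phi>: "(\<Phi> has_real_derivative g x * n x) (at x within ?I)" if "x \<in> ?I" for x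
    unfolding \<Phi>_def using that by (intro integral_has_real_derivative continuous_intros g cn)
  define R where "R x = integral {0..x} r" for x
  have dR: "(R has_real_derivative r x) (at x within ?I)" if "x \<in> ?I" for x
    unfolding R_def using that by (intro integral_has_real_derivative r)
  define y where "y x = r0 + (a * x - b * R x) - \<sigma> * \<Phi> x" for x
  have ry: "r x = y x + \<sigma> * w x" if "x \<in> ?I" for x
    using eq[OF that] by (simp add: y_def R_def \<Phi>_def right_diff_distrib)
  \<comment> \<open>The rate without its rough part, \<open>y = r - \<sigma> w\<close>, is differentiable and so is each term of \<open>Q\<close>.\<close>
  define Q where "Q x = R x + c x * y x + a / b * (T - x - c x) + \<sigma> * (k x * \<Psi> x) + \<sigma> * \<Theta> x" for x
  have dQ: "(Q has_real_derivative 0) (at x within ?I)" if x: "x \<in> ?I" for x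
  proof -
    note D = dR[OF x] d\<Phi>[OF x] d\<Psi>[OF x] d\<Theta>[OF x] has_field_derivative_at_within[OF c(1)[OF x], of ?I]
      has_field_derivative_at_within[OF k(1)[OF x], of ?I]
    have dy: "(y has_real_derivative 0 + (a * 1 - b * r x) - \<sigma> * (g x * n x)) (at x within ?I)"
      unfolding y_def by (intro DERIV_add DERIV_diff DERIV_const DERIV_cmult DERIV_ident D)
    have "(Q has_real_derivative r x + ((b * c x - 1) * y x + (0 + (a * 1 - b * r x) - \<sigma> * (g x * n x)) * c x)
        + a / b * (0 - 1 - (b * c x - 1)) + \<sigma> * ((- g x * c x) * \<Psi> x + (H' x * w x) * k x) + \<sigma> * (?f' x * w x)) (at x within ?I)"
      unfolding Q_def by (intro DERIV_add DERIV_diff DERIV_const DERIV_cmult DERIV_mult DERIV_ident D dy)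
    moreover have "r x + ((b * c x - 1) * y x + (0 + (a * 1 - b * r x) - \<sigma> * (g x * n x)) * c x)
        + a / b * (0 - 1 - (b * c x - 1)) + \<sigma> * ((- g x * c x) * \<Psi> x + (H' x * w x) * k x) + \<sigma> * (?f' x * w x) = 0"
      unfolding n ry[OF x] using b by (simp add: field_simps)
    ultimately show ?thesis by simp
  qed
  have tI: "t \<in> ?I" "T \<in> ?I" using t by auto
  have QtT: "Q t = Q T" by (rule zero_derivative_eq[OF dQ tI])
  have comb: "integral {0..t} h + integral {t..T} h = integral {0..T} h" if "continuous_on ?I h" for h :: "real \<Rightarrow> real"
    using t that by (intro Henstock_Kurzweil_Integration.integral_combine integrable_continuous_real) auto
  have "R T - R t = c t * y t + a / b * (T - t - c t) + \<sigma> * (k t * \<Psi> t) - \<sigma> * (\<Theta> T - \<Theta> t)"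
    using QtT c(2) k(2) by (simp add: Q_def algebra_simps)
  also have "\<dots> = c t * r t + a / b * (T - t - c t) + \<sigma> * ((c T - k T * H T) * w T - (c t - k t * H t) * w t - (\<Theta> T - \<Theta> t) - k t * n t)"
    unfolding n ry[OF tI(1)] c(2) k(2) by (simp add: algebra_simps)
  also have "\<Theta> T - \<Theta> t = integral {t..T} (\<lambda>s. ?f' s * w s)"
    using comb[OF cf'] by (simp add: \<Theta>_def)
  also have "R T - R t = integral {t..T} r" using comb[OF r] by (simp add: R_def)
  finally show ?thesis by (simp add: path_integral_def)
qed

text \<open>If \<open>\<phi> = \<rho> H\<close> and \<open>\<rho>' = - \<phi> g\<close>, then \<open>d(\<rho> n) = \<rho> H dw - \<phi> g n ds\<close> is the
differential of \<open>\<phi>\<close> against the path with drift \<open>- g n\<close>.\<close>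

lemma integral_against_drifted_path:
  fixes w \<phi> \<phi>' \<rho> H H' g :: "real \<Rightarrow> real"
  assumes t: "0 \<le> t" and w: "continuous_on {0..t} w" "w 0 = 0"
    and g: "continuous_on {0..t} g"
    and \<rho>: "\<And>x. x \<in> {0..t} \<Longrightarrow> (\<rho> has_real_derivative - \<phi> x * g x) (at x)"
    and H: "\<And>x. x \<in> {0..t} \<Longrightarrow> (H has_real_derivative H' x) (at x)" and H': "continuous_on {0..t} H'"
    and \<phi>: "\<And>x. x \<in> {0..t} \<Longrightarrow> \<phi> x = \<rho> x * H x"
    and \<phi>': "\<And>x. x \<in> {0..t} \<Longrightarrow> \<phi>' x = \<rho> x * H' x - \<phi> x * g x * H x"
  defines "n \<equiv> path_integral w H H' 0"
  shows "path_integral w \<phi> \<phi>' 0 t - integral {0..t} (\<lambda>s. \<phi> s * (g s * n s)) = \<rho> t * n t"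
proof -
  let ?I = "{0..t}"
  have cc: "continuous_on ?I \<rho>" "continuous_on ?I H"
    by (rule DERIV_imp_continuous_on, fact)+
  have c\<phi>: "continuous_on ?I \<phi>" 
    using \<phi> by (intro continuous_on_eq[OF continuous_on_mult[OF cc]]) simp
  have c\<phi>': "continuous_on ?I \<phi>'"
  proof -
    have "continuous_on ?I (\<lambda>x. \<rho> x * H' x - \<phi> x * g x * H x)" by (intro continuous_intros cc H' c\<phi> g)
    then show ?thesis by (rule continuous_on_eq) (simp add: \<phi>')
  qed
  define \<Psi> where "\<Psi> x = integral {0..x} (\<lambda>s. H' s * w s)" for x
  have n: "n x = H x * w x - \<Psi> x" for x using w(2) by (simp add: n_def path_integral_def \<Psi>_def)
  have d\<Psi>: "(\<Psi> has_real_derivative H' x * w x) (at x within ?I)" if "x \<in> ?I" for x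
    unfolding \<Psi>_def using that by (intro integral_has_real_derivative continuous_intros H' w)
  have c\<Psi>: "continuous_on ?I \<Psi>" by (rule DERIV_continuous_on[OF d\<Psi>])
  have cn: "continuous_on ?I n" unfolding n by (intro continuous_intros cc w c\<Psi>)
  define \<Theta> where "\<Theta> x = integral {0..x} (\<lambda>s. \<phi>' s * w s)" for x
  have d\<Theta>: "(\<Theta> has_real_derivative \<phi>' x * w x) (at x within ?I)" if "x \<in> ?I" for x
    unfolding \<Theta>_def using that by (intro integral_has_real_derivative continuous_intros c\<phi>' w)
  define \<Phi> where "\<Phi> x = integral {0..x} (\<lambda>s. \<phi> s * (g s * n s))" for x
  have d\<Phi>: "(\<Phi> has_real_derivative \<phi> x * (g x * n x)) (at x within ?I)" if "x \<in> ?I" for x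
    unfolding \<Phi>_def using that by (intro integral_has_real_derivative continuous_intros c\<phi> g cn)
  define Q where "Q x = \<rho> x * \<Psi> x - \<Theta> x - \<Phi> x" for x
  have dQ: "(Q has_real_derivative 0) (at x within ?I)" if x: "x \<in> ?I" for x
  proof -
    have "(Q has_real_derivative ((- \<phi> x * g x) * \<Psi> x + (H' x * w x) * \<rho> x) - \<phi>' x * w x - \<phi> x * (g x * n x)) (at x within ?I)"
      unfolding Q_def
      by (intro DERIV_diff DERIV_mult d\<Psi> d\<Theta> d\<Phi> has_field_derivative_at_within[OF \<rho>] x)
    moreover have "((- \<phi> x * g x) * \<Psi> x + (H' x * w x) * \<rho> x) - \<phi>' x * w x - \<phi> x * (g x * n x) = 0"
      unfolding n \<phi>'[OF x] by (simp add: algebra_simps)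
    ultimately show ?thesis by simp
  qed
  have "Q t = Q 0" by (rule zero_derivative_eq[OF dQ]) (use t in auto)
  also have "Q 0 = 0" by (simp add: Q_def \<Psi>_def \<Theta>_def \<Phi>_def)
  finally have "\<rho> t * \<Psi> t - \<Theta> t - \<Phi> t = 0" by (simp add: Q_def)
  moreover have "\<phi> t * w t = \<rho> t * \<Psi> t + \<rho> t * n t"
    using \<phi>[of t] t n[of t] by (simp add: distrib_left[symmetric] mult.assoc)
  ultimately show ?thesis using w(2) by (simp add: path_integral_def \<Theta>_def \<Phi>_def)
qed

section \<open>The coefficient functions of the model\<close>

text \<open>The integral of \<open>exp (-\<kappa> u)\<close> over \<open>[0, s]\<close>. The case \<open>\<kappa> = 0\<close> occurs when \<open>p + q = b\<close>.\<close>

definition exp_primitive :: "real \<Rightarrow> real \<Rightarrow> real" where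
  "exp_primitive \<kappa> s = (if \<kappa> = 0 then s else (1 - exp (- \<kappa> * s)) / \<kappa>)"

lemma exp_primitive_deriv: "(exp_primitive \<kappa> has_real_derivative exp (- \<kappa> * s)) (at s)"
  unfolding exp_primitive_def[abs_def] by (cases "\<kappa> = 0") (auto intro!: derivative_eq_intros)

lemma exp_primitive_mult: "\<kappa> * exp_primitive \<kappa> s = 1 - exp (- \<kappa> * s)"
  by (simp add: exp_primitive_def)

locale model_parameters =
  fixes p q b :: real
  assumes q: "0 < q" and pq: "- q < p" and b: "0 < b"
begin

definition den :: "real \<Rightarrow> real" where
  "den t = (p + 2 * q)\<^sup>2 * exp (2 * q * t) - p\<^sup>2"

lemma den_pos: "0 \<le> t \<Longrightarrow> 0 < den t"
proof -
  assume t: "0 \<le> t"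
  have "p\<^sup>2 < (p + 2 * q)\<^sup>2"
  proof -
    have "0 < 4 * q * (p + q)" using q pq by simp
    then show ?thesis by (simp add: power2_eq_square algebra_simps)
  qed
  also have "\<dots> \<le> (p + 2 * q)\<^sup>2 * exp (2 * q * t)" using q t by (simp add: mult_le_cancel_left1)
  finally show ?thesis by (simp add: den_def)
qed

lemma den_nz: "0 \<le> t \<Longrightarrow> den t \<noteq> 0"
  using den_pos by force

lemma den_deriv: "(den has_real_derivative 2 * q * (den t + p\<^sup>2)) (at t)"
  unfolding den_def by (auto intro!: derivative_eq_intros)

lemma kernel_l_den: "kernel_l p q t = 1 - 2 * q * p / den t"
  by (simp add: kernel_l_def den_def)

definition kernel_l' :: "real \<Rightarrow> real" where
  "kernel_l' t = 4 * q\<^sup>2 * p * (den t + p\<^sup>2) / (den t)\<^sup>2"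

lemma kernel_l_deriv: "0 \<le> t \<Longrightarrow> (kernel_l p q has_real_derivative kernel_l' t) (at t)"
  unfolding kernel_l_den[abs_def] kernel_l'_def
  by (auto intro!: derivative_eq_intros den_deriv simp: den_nz power2_eq_square field_simps)

definition kern :: "real \<Rightarrow> real" where "kern t = exp ((p + q) * t) * kernel_l p q t"

definition kern' :: "real \<Rightarrow> real" where
  "kern' t = exp ((p + q) * t) * ((p + q) * kernel_l p q t + kernel_l' t)"

text \<open>In terms of these functions, \<open>V(s) = decay(s) N(s)\<close> where \<open>N\<close> integrates \<open>kern\<close> against \<open>W\<close>.\<close>

definition decay :: "real \<Rightarrow> real" where "decay t = p * exp (- (p + q) * t)"

lemma kern_deriv: "0 \<le> t \<Longrightarrow> (kern has_real_derivative kern' t) (at t)"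
  unfolding kern_def[abs_def] kern'_def
  by (auto intro!: derivative_eq_intros kernel_l_deriv simp: algebra_simps)

lemma den_cont: "continuous_on S den"
  unfolding den_def by (intro continuous_intros)

lemma kernel_l_cont: "continuous_on {0..t} (kernel_l p q)"
  unfolding kernel_l_den by (intro continuous_intros den_cont) (auto simp: den_nz)

lemma kern'_cont: "continuous_on {0..t} kern'"
  unfolding kern'_def kernel_l'_def
  by (intro continuous_intros den_cont kernel_l_cont) (auto simp: den_nz)

lemma exp_cancel: "exp (- (p + q) * t) * exp ((p + q) * t) = 1"
  unfolding exp_add[symmetric] by (simp add: algebra_simps)

lemma decay_kern: "decay t * kern t = p * kernel_l p q t"
proof -
  have "decay t * kern t = p * (exp (- (p + q) * t) * exp ((p + q) * t)) * kernel_l p q t"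
    unfolding decay_def kern_def by (simp only: mult_ac)
  then show ?thesis unfolding exp_cancel by simp
qed

text \<open>A closed form of \<open>coef_m\<close> that makes sense for all real arguments, so that it has a two-sided
derivative at \<open>0\<close> as well.\<close>

definition mcoef :: "real \<Rightarrow> real" where
  "mcoef t = p * exp_primitive (p + q) t - p * exp (- b * t) * exp_primitive (p + q - b) t"

lemma exp_split: "exp (- b * t) * exp (- (p + q - b) * s) = exp (- (p + q) * s) * exp (- b * (t - s))"
  unfolding exp_add[symmetric] by (simp add: algebra_simps)

lemma coef_m_eq_mcoef: "0 \<le> t \<Longrightarrow> coef_m p q b t = mcoef t"
proof -
  assume t: "0 \<le> t"
  define A where "A s = p * exp_primitive (p + q) s - p * exp (- b * t) * exp_primitive (p + q - b) s" for s
  have "((\<lambda>s. p * exp (- (p + q) * s) * (1 - exp (- b * (t - s)))) has_integral A t - A 0) {0..t}"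
  proof (rule fundamental_theorem_of_calculus[OF t])
    fix s
    have "(A has_real_derivative p * exp (- (p + q) * s) - p * exp (- b * t) * exp (- (p + q - b) * s)) (at s)"
      unfolding A_def by (intro DERIV_diff DERIV_cmult exp_primitive_deriv)
    moreover have "p * exp (- (p + q) * s) * (1 - exp (- b * (t - s))) = p * exp (- (p + q) * s) - p * exp (- b * t) * exp (- (p + q - b) * s)"
      unfolding right_diff_distrib mult_1_right mult.assoc exp_split by simp
    ultimately have "(A has_real_derivative p * exp (- (p + q) * s) * (1 - exp (- b * (t - s)))) (at s within {0..t})"
      by (simp add: has_field_derivative_at_within)
    then show "(A has_vector_derivative p * exp (- (p + q) * s) * (1 - exp (- b * (t - s)))) (at s within {0..t})"
      by (simp add: has_real_derivative_iff_has_vector_derivative)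
  qed
  then have "integral {0..t} (\<lambda>s. p * exp (- (p + q) * s) * (1 - exp (- b * (t - s)))) = A t - A 0"
    by (rule integral_unique)
  moreover have "A t = mcoef t" "A 0 = 0" by (simp_all add: A_def mcoef_def exp_primitive_def)
  ultimately show ?thesis
    unfolding coef_m_def by (subst LBINT_eq_integral) (auto intro!: continuous_intros)
qed

lemma mcoef_0: "mcoef 0 = 0"
  by (simp add: mcoef_def exp_primitive_def)

text \<open>This differential equation makes \<open>noise_load\<close> an antiderivative of \<open>- decay * rate_load\<close>, and it is
the reason why the variance can be integrated.\<close>

lemma mcoef_deriv: "(mcoef has_real_derivative p * (1 - exp (- b * t)) - (p + q) * mcoef t) (at t)"
proof -
  define c d K L where "c = exp (- b * t)" and "d = exp (- (p + q) * t)"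
    and "K = exp_primitive (p + q - b) t" and "L = exp_primitive (p + q) t"
  have "((\<lambda>t. exp (- b * t)) has_real_derivative c * (- b)) (at t)"
    unfolding c_def by (auto intro!: derivative_eq_intros)
  then have "(mcoef has_real_derivative p * d - ((p * (c * (- b))) * K + exp (- (p + q - b) * t) * (p * c))) (at t)"
    unfolding mcoef_def[abs_def] c_def d_def K_def
    by (intro DERIV_diff DERIV_cmult DERIV_mult exp_primitive_deriv)
  moreover have "c * exp (- (p + q - b) * t) = d" unfolding c_def d_def exp_split by simp
  moreover from this have "(p + q - b) * K * c = c - d"
    unfolding K_def exp_primitive_mult by (simp add: algebra_simps)
  moreover have "(p + q) * L = 1 - d" unfolding L_def d_def by (rule exp_primitive_mult)
  moreover have "mcoef t = p * L - p * c * K" by (simp add: mcoef_def c_def K_def L_def)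
  ultimately show ?thesis
  proof -
    assume D: "(mcoef has_real_derivative p * d - ((p * (c * (- b))) * K + exp (- (p + q - b) * t) * (p * c))) (at t)"
      and 1: "c * exp (- (p + q - b) * t) = d" and 2: "(p + q - b) * K * c = c - d"
      and 3: "(p + q) * L = 1 - d" and 4: "mcoef t = p * L - p * c * K"
    have "p * (1 - c) - (p + q) * mcoef t = p * (1 - c) - p * ((p + q) * L) + p * ((p + q - b) * K * c) + p * b * c * K"
      unfolding 4 by (simp add: algebra_simps)
    also have "\<dots> = p * b * c * K" unfolding 2 3 by (simp add: algebra_simps)
    also have "\<dots> = p * d - ((p * (c * (- b))) * K + p * (c * exp (- (p + q - b) * t)))" unfolding 1 by simp
    also have "\<dots> = p * d - ((p * (c * (- b))) * K + exp (- (p + q - b) * t) * (p * c))" by simp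
    finally show ?thesis using D unfolding c_def by simp
  qed
qed

text \<open>The response of \<open>\<integral>\<^sub>x\<^sup>T r\<close> to the rate at time \<open>x\<close>, its response to \<open>N(x)\<close> (per unit of
\<open>-\<sigma>\<close>), and, in \<open>vol\<close> below, its response to \<open>dW(x)\<close> (per unit of \<open>\<sigma>\<close>).\<close>

definition rate_load :: "real \<Rightarrow> real \<Rightarrow> real" where "rate_load T x = (1 - exp (- b * (T - x))) / b"

definition noise_load :: "real \<Rightarrow> real \<Rightarrow> real" where "noise_load T x = mcoef (T - x) / b * exp (- (p + q) * x)"

lemma rate_load_deriv: "(rate_load T has_real_derivative b * rate_load T x - 1) (at x)"
  unfolding rate_load_def using b by (auto intro!: derivative_eq_intros)

lemma mcoef_deriv_rev: "((\<lambda>x. mcoef (T - x)) has_real_derivative (p + q) * mcoef (T - x) - p * (1 - exp (- b * (T - x)))) (at x)"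
proof -
  have "((\<lambda>x. T - x) has_real_derivative - 1) (at x)" by (auto intro!: derivative_eq_intros)
  from DERIV_chain2[OF mcoef_deriv this] show ?thesis by simp
qed

lemma noise_load_deriv: "(noise_load T has_real_derivative - decay x * rate_load T x) (at x)"
  unfolding noise_load_def decay_def rate_load_def using b
  by (auto intro!: derivative_eq_intros mcoef_deriv_rev simp: field_simps)

definition vol :: "real \<Rightarrow> real \<Rightarrow> real" where "vol T x = rate_load T x - noise_load T x * kern x"

definition vol' :: "real \<Rightarrow> real \<Rightarrow> real" where
  "vol' T x = b * rate_load T x - 1 + decay x * rate_load T x * kern x - noise_load T x * kern' x"

lemma vol_deriv: "0 \<le> x \<Longrightarrow> (vol T has_real_derivative vol' T x) (at x)"
  unfolding vol_def[abs_def] vol'_def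
  by (auto intro!: derivative_eq_intros rate_load_deriv noise_load_deriv kern_deriv simp: algebra_simps)

lemma decay_cont: "continuous_on S decay"
  unfolding decay_def by (intro continuous_intros)

lemma vol'_cont: "continuous_on {0..t} (vol' T)"
proof -
  have "continuous_on {0..t} (rate_load T)" "continuous_on {0..t} (noise_load T)" "continuous_on {0..t} kern"
    by (rule DERIV_imp_continuous_on, auto intro: rate_load_deriv noise_load_deriv kern_deriv)+
  then show ?thesis unfolding vol'_def by (intro continuous_intros decay_cont kern'_cont)
qed

lemma vol_eq: "b * vol T x = 2 * q * p * mcoef (T - x) / den x - (mcoef (T - x) + exp (- b * (T - x)) - 1)"
proof -
  have "noise_load T x * kern x = mcoef (T - x) / b * kernel_l p q x"
  proof -
    have "noise_load T x * kern x = mcoef (T - x) / b * (exp (- (p + q) * x) * exp ((p + q) * x)) * kernel_l p q x"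
      unfolding noise_load_def kern_def by (simp only: mult_ac)
    then show ?thesis unfolding exp_cancel by simp
  qed
  then have "b * (noise_load T x * kern x) = mcoef (T - x) * (1 - 2 * q * p / den x)"
    using b by (simp add: kernel_l_den)
  moreover have "b * rate_load T x = 1 - exp (- b * (T - x))" using b by (simp add: rate_load_def)
  ultimately show ?thesis unfolding vol_def right_diff_distrib[of b] by (simp add: algebra_simps)
qed

text \<open>The antiderivative of \<open>(b vol)\<^sup>2\<close> is found by comparing with \<open>l = 1\<close>, which would leave the square
of \<open>m + e^(-b s) - 1\<close>; the correction \<open>2 q p m / den\<close> to \<open>b vol\<close> contributes an exact derivative,
that of \<open>- 2 q m\<^sup>2 / den\<close>, by the differential equations of \<open>m\<close> and \<open>den\<close>.\<close>

lemma integral_vol_square: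
  assumes t: "0 \<le> t" "t \<le> T"
  shows "integral {t..T} (\<lambda>x. (vol T x)\<^sup>2) =
    (integral {0..T - t} (\<lambda>s. (mcoef s + exp (- b * s) - 1)\<^sup>2) + 2 * q * (mcoef (T - t))\<^sup>2 / den t) / b\<^sup>2"
proof -
  let ?h = "\<lambda>s. (mcoef s + exp (- b * s) - 1)\<^sup>2"
  \<comment> \<open>The claimed value, with \<open>t\<close> replaced by \<open>x\<close>, times \<open>- b\<^sup>2\<close>; it vanishes at \<open>x = T\<close> because \<open>m(0) = 0\<close>.\<close>
  define P where "P x = - (integral {0..T - x} ?h + 2 * q * (mcoef (T - x))\<^sup>2 / den x)" for x
  have cmm: "continuous_on S mcoef" for S
    by (rule DERIV_imp_continuous_on[OF mcoef_deriv])
  have ch: "continuous_on {0..T - t} ?h" by (intro continuous_intros cmm)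
  have "((\<lambda>x. (b * vol T x)\<^sup>2) has_integral P T - P t) {t..T}"
  proof (rule fundamental_theorem_of_calculus[OF t(2)])
    fix x assume x: "x \<in> {t..T}"
    define m e D where "m = mcoef (T - x)" and "e = exp (- b * (T - x))" and "D = den x"
    have D: "D \<noteq> 0" using x t den_nz by (simp add: D_def)
    have 1: "((\<lambda>x. integral {0..T - x} ?h) has_real_derivative (m + e - 1)\<^sup>2 * (- 1)) (at x within {t..T})"
    proof -
      have "((\<lambda>y. integral {0..y} ?h) has_real_derivative ?h (T - x)) (at (T - x) within {0..T - t})"
        using x by (intro integral_has_real_derivative ch) auto
      moreover have "(-) T ` {t..T} = {0..T - t}" by simp
      moreover have "((-) T has_real_derivative - 1) (at x within {t..T})"
        by (auto intro!: derivative_eq_intros)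
      ultimately show ?thesis
        using DERIV_image_chain[of "\<lambda>y. integral {0..y} ?h" "?h (T - x)" "(-) T" x "{t..T}" "- 1"]
        by (simp add: comp_def m_def e_def)
    qed
    note M = has_field_derivative_at_within[OF mcoef_deriv_rev[of T x], of "{t..T}", folded m_def e_def]
    note DD = has_field_derivative_at_within[OF den_deriv[of x], of "{t..T}", folded D_def]
    have 2: "((\<lambda>x. 2 * q * (mcoef (T - x))\<^sup>2 / den x) has_real_derivative
       ((2 * q * (2 * m * ((p + q) * m - p * (1 - e)))) * D - 2 * q * m\<^sup>2 * (2 * q * (D + p\<^sup>2))) / (D * D)) (at x within {t..T})"
      using D DERIV_divide[OF DERIV_cmult[OF DERIV_power[OF M, of 2], of "2 * q"] DD] unfolding m_def e_def D_def
      by (simp add: mult_ac)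
    have "(P has_real_derivative - ((m + e - 1)\<^sup>2 * (- 1) + ((2 * q * (2 * m * ((p + q) * m - p * (1 - e)))) * D - 2 * q * m\<^sup>2 * (2 * q * (D + p\<^sup>2))) / (D * D))) (at x within {t..T})"
      unfolding P_def by (intro DERIV_minus DERIV_add 1 2)
    moreover have "- ((m + e - 1)\<^sup>2 * (- 1) + ((2 * q * (2 * m * ((p + q) * m - p * (1 - e)))) * D - 2 * q * m\<^sup>2 * (2 * q * (D + p\<^sup>2))) / (D * D)) = (b * vol T x)\<^sup>2"
    proof -
      have "b * vol T x = 2 * q * p * m / D - (m + e - 1)" using vol_eq by (simp add: m_def e_def D_def)
      moreover have "- ((m + e - 1)\<^sup>2 * (- 1) + ((2 * q * (2 * m * ((p + q) * m - p * (1 - e)))) * D - 2 * q * m\<^sup>2 * (2 * q * (D + p\<^sup>2))) / (D * D)) = (2 * q * p * m / D - (m + e - 1))\<^sup>2"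
        using D by (simp add: divide_simps power2_eq_square) (simp add: algebra_simps)
      ultimately show ?thesis by simp
    qed
    ultimately show "(P has_vector_derivative (b * vol T x)\<^sup>2) (at x within {t..T})"
      by (simp add: has_real_derivative_iff_has_vector_derivative)
  qed
  then have "integral {t..T} (\<lambda>x. (b * vol T x)\<^sup>2) = P T - P t" by (rule integral_unique)
  also have "\<dots> = integral {0..T - t} ?h + 2 * q * (mcoef (T - t))\<^sup>2 / den t" by (simp add: P_def mcoef_0)
  finally have "integral {t..T} (\<lambda>x. b\<^sup>2 * (vol T x)\<^sup>2) = integral {0..T - t} ?h + 2 * q * (mcoef (T - t))\<^sup>2 / den t"
    by (simp add: power_mult_distrib)
  then show ?thesis using b by (simp add: field_simps)
qed

text \<open>The weight \<open>\<phi>\<close> in the definition of \<open>U\<close>; its integral against \<open>Z\<close> over \<open>[0, t]\<close> is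
\<open>\<rho>(t) N(t)\<close>.\<close>

definition \<phi> :: "real \<Rightarrow> real" where "\<phi> s = exp (q * s) - p / (p + 2 * q) * exp (- q * s)"

definition \<phi>' :: "real \<Rightarrow> real" where "\<phi>' s = q * exp (q * s) + q * p / (p + 2 * q) * exp (- q * s)"

definition \<rho> :: "real \<Rightarrow> real" where "\<rho> s = exp (- (p + 2 * q) * s) * den s / (p + 2 * q)\<^sup>2"

lemma E_pos: "0 < p + 2 * q"
  using q pq by simp

lemma phi_deriv: "(\<phi> has_real_derivative \<phi>' s) (at s)"
  unfolding \<phi>_def \<phi>'_def using E_pos by (auto intro!: derivative_eq_intros)

lemma phi'_cont: "continuous_on S \<phi>'"
proof -
  have "p + 2 * q \<noteq> 0" using E_pos by simp
  then show ?thesis unfolding \<phi>'_def by (intro continuous_intros ballI)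
qed

lemma phi_cont: "continuous_on S \<phi>"
  by (rule DERIV_imp_continuous_on[OF phi_deriv])

text \<open>Everything is rational in \<open>X\<close>, and \<open>den = E\<^sup>2 X\<^sup>2 - p\<^sup>2\<close>.\<close>

lemma exp_relations:
  fixes s defines "X \<equiv> exp (q * s)" and "E \<equiv> p + 2 * q"
  shows "den s = E\<^sup>2 * X\<^sup>2 - p\<^sup>2" "\<phi> s = X - p / E / X" "\<phi>' s = q * X + q * p / E / X"
    "\<rho> s * exp ((p + q) * s) = den s / E\<^sup>2 / X" "X > 0"
    "\<phi> s = (den s - 2 * q * p) / E\<^sup>2 / X" "\<phi>' s = q * (den s + 2 * p\<^sup>2 + 2 * p * q) / E\<^sup>2 / X"
proof -
  have E: "E \<noteq> 0" using E_pos by (simp add: E_def)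
  have X: "exp (- q * s) = 1 / X" by (simp add: X_def exp_minus field_simps)
  show 1: "den s = E\<^sup>2 * X\<^sup>2 - p\<^sup>2" by (simp add: den_def E_def X_def exp_double[symmetric] mult.assoc)
  show 2: "\<phi> s = X - p / E / X" unfolding \<phi>_def X by (simp add: X_def E_def)
  show 3: "\<phi>' s = q * X + q * p / E / X" unfolding \<phi>'_def X by (simp add: X_def E_def)
  have "exp (- (p + 2 * q) * s) * exp ((p + q) * s) = 1 / X"
    unfolding X[symmetric] exp_add[symmetric] by (simp add: algebra_simps)
  then show "\<rho> s * exp ((p + q) * s) = den s / E\<^sup>2 / X" by (simp add: \<rho>_def E_def field_simps)
  show X0: "X > 0" by (simp add: X_def)
  have q: "2 * q = E - p" by (simp add: E_def)
  show "\<phi> s = (den s - 2 * q * p) / E\<^sup>2 / X" unfolding 1 2 q using E X0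
    by (simp add: field_simps power2_eq_square)
  have "den s + 2 * p\<^sup>2 + 2 * p * q = E\<^sup>2 * X\<^sup>2 + E * p"
    unfolding 1 by (simp add: E_def power2_eq_square algebra_simps)
  then show "\<phi>' s = q * (den s + 2 * p\<^sup>2 + 2 * p * q) / E\<^sup>2 / X" unfolding 3 using E X0
    by (simp add: field_simps power2_eq_square)
qed

lemma rho_deriv: "(\<rho> has_real_derivative - \<phi> s * decay s) (at s)"
proof -
  let ?E = "p + 2 * q"
  have E: "?E \<noteq> 0" using E_pos by simp
  have "(\<rho> has_real_derivative (exp (- ?E * s) * (- ?E) * den s + 2 * q * (den s + p\<^sup>2) * exp (- ?E * s)) / ?E\<^sup>2) (at s)"
    unfolding \<rho>_def[abs_def] by (intro DERIV_cdivide) (auto intro!: derivative_eq_intros den_deriv)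
  moreover have "(exp (- ?E * s) * (- ?E) * den s + 2 * q * (den s + p\<^sup>2) * exp (- ?E * s)) / ?E\<^sup>2 = - \<phi> s * decay s"
  proof -
    have 1: "exp (- ?E * s) = exp (- (p + q) * s) / exp (q * s)"
      unfolding exp_diff[symmetric] by (simp add: algebra_simps)
    have 2: "Y * (- ?E) * den s + 2 * q * (den s + p\<^sup>2) * Y = - ((den s - 2 * q * p) * (p * Y))" for Y
      by (simp add: algebra_simps power2_eq_square)
    show ?thesis unfolding 2 1 exp_relations(6) decay_def by (simp add: mult.commute)
  qed
  ultimately show ?thesis by simp
qed

lemma phi_eq: "0 \<le> s \<Longrightarrow> \<phi> s = \<rho> s * kern s"
proof -
  assume s: "0 \<le> s"
  have "\<rho> s * kern s = (\<rho> s * exp ((p + q) * s)) * kernel_l p q s" by (simp add: kern_def)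
  also have "\<dots> = \<phi> s" unfolding exp_relations(4,6) kernel_l_den using den_nz[OF s] E_pos exp_gt_zero[of "q * s"]
    by (simp add: field_simps)
  finally show ?thesis by simp
qed

lemma phi'_eq: "0 \<le> s \<Longrightarrow> \<phi>' s = \<rho> s * kern' s - \<phi> s * decay s * kern s"
proof -
  assume s: "0 \<le> s"
  define D E X where "D = den s" and "E = p + 2 * q" and "X = exp (q * s)"
  have nz: "D \<noteq> 0" "E \<noteq> 0" "X \<noteq> 0" using den_nz[OF s] E_pos by (auto simp: D_def E_def X_def)
  have "\<rho> s * kern' s - \<phi> s * decay s * kern s = (\<rho> s * exp ((p + q) * s)) * ((p + q) * kernel_l p q s + kernel_l' s) - \<phi> s * (decay s * kern s)"
    by (simp add: kern'_def mult.assoc)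
  also have "\<dots> = (D / E\<^sup>2 / X) * ((p + q) * (1 - 2 * q * p / D) + 4 * q\<^sup>2 * p * (D + p\<^sup>2) / D\<^sup>2)
     - ((D - 2 * q * p) / E\<^sup>2 / X) * (p * (1 - 2 * q * p / D))"
    unfolding decay_kern exp_relations(4,6) kernel_l_den kernel_l'_def D_def E_def X_def by simp
  also have "\<dots> = ((p + q) * (D - 2 * q * p) + 4 * q\<^sup>2 * p * (D + p\<^sup>2) / D - (D - 2 * q * p) * p * (D - 2 * q * p) / D) / E\<^sup>2 / X"
    using nz by (simp add: divide_simps power2_eq_square, (simp add: algebra_simps)?)
  also have "(p + q) * (D - 2 * q * p) + 4 * q\<^sup>2 * p * (D + p\<^sup>2) / D - (D - 2 * q * p) * p * (D - 2 * q * p) / D = q * (D + 2 * p\<^sup>2 + 2 * p * q)"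
    using nz by (simp add: divide_simps power2_eq_square, (simp add: algebra_simps)?)
  finally show ?thesis unfolding exp_relations(7) D_def E_def X_def by simp
qed

end

section \<open>The yield of the zero-coupon bond\<close>

lemma path_integral_cmult:
  "path_integral w (\<lambda>x. c * f x) (\<lambda>x. c * f' x) \<alpha> \<beta> = c * path_integral w f f' \<alpha> \<beta>"
proof -
  have "integral {\<alpha>..\<beta>} (\<lambda>x. c * f' x * w x) = c * integral {\<alpha>..\<beta>} (\<lambda>x. f' x * w x)"
    unfolding mult.assoc by (rule integral_mult_right)
  then show ?thesis by (simp add: path_integral_def algebra_simps)
qed

lemma path_integral_continuous:
  assumes "continuous_on {0..T} w" "continuous_on {0..T} f" "continuous_on {0..T} f'"
  shows "continuous_on {0..T} (path_integral w f f' 0)"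
proof -
  have "continuous_on {0..T} (\<lambda>x. f' x * w x)" by (intro continuous_intros assms)
  then have "continuous_on {0..T} (\<lambda>x. integral {0..x} (\<lambda>x. f' x * w x))"
    by (intro indefinite_integral_continuous_1 integrable_continuous_real)
  then show ?thesis unfolding path_integral_def[abs_def] by (intro continuous_intros assms)
qed

text \<open>The process is the limit of its values at the grid points just before the given time, and at a grid
point only countably many random variables are involved.\<close>

lemma continuous_joint_measurable:
  fixes X :: "real \<Rightarrow> 'a \<Rightarrow> real"
  assumes T: "0 \<le> T" and c: "\<And>\<omega>. \<omega> \<in> space M \<Longrightarrow> continuous_on {0..T} (\<lambda>s. X s \<omega>)"
    and X: "\<And>s. s \<in> {0..T} \<Longrightarrow> X s \<in> borel_measurable M"
  shows "(\<lambda>(\<omega>, s). indicator {0..T} s * X s \<omega>) \<in> borel_measurable (M \<Otimes>\<^sub>M lborel)"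
proof -
  define cl where "cl n i = max 0 (min T (real_of_int i / real (Suc n)))" for n i
  have cl: "cl n i \<in> {0..T}" for n i using T by (auto simp: cl_def)
  let ?a = "\<lambda>n z. indicator {0..T} (snd z) * X (cl n \<lfloor>real (Suc n) * snd z\<rfloor>) (fst z)"
  have "?a n \<in> borel_measurable (M \<Otimes>\<^sub>M lborel)" for n
  proof -
    have [measurable]: "X (cl n i) \<in> borel_measurable M" for i using X[OF cl] .
    have "(\<lambda>z. X (cl n \<lfloor>real (Suc n) * snd z\<rfloor>) (fst z)) \<in> borel_measurable (M \<Otimes>\<^sub>M (lborel :: real measure))"
      by (rule measurable_compose_countable[where f="\<lambda>i z. X (cl n i) (fst z)"]) measurable
    then show ?thesis by measurable
  qed
  then have "(\<lambda>z. indicator {0..T} (snd z) * X (snd z) (fst z)) \<in> borel_measurable (M \<Otimes>\<^sub>M lborel)"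
  proof (rule borel_measurable_LIMSEQ_real[rotated])
    fix z assume "z \<in> space (M \<Otimes>\<^sub>M (lborel :: real measure))"
    then have z: "fst z \<in> space M" by (auto simp: space_pair_measure)
    show "(\<lambda>n. ?a n z) \<longlonglongrightarrow> indicator {0..T} (snd z) * X (snd z) (fst z)"
    proof (cases "snd z \<in> {0..T}")
      case True
      have 1: "(\<lambda>n. real_of_int \<lfloor>real (Suc n) * snd z\<rfloor> / real (Suc n)) \<longlonglongrightarrow> snd z"
      proof (rule tendsto_sandwich)
        show "(\<lambda>n. snd z - 1 / real (Suc n)) \<longlonglongrightarrow> snd z"
          using tendsto_diff[OF tendsto_const LIMSEQ_Suc[OF lim_1_over_n], of "snd z"] by simp
        show "eventually (\<lambda>n. snd z - 1 / real (Suc n) \<le> real_of_int \<lfloor>real (Suc n) * snd z\<rfloor> / real (Suc n)) sequentially"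
        proof (intro always_eventually allI)
          fix n
          have "real (Suc n) * snd z - 1 \<le> real_of_int \<lfloor>real (Suc n) * snd z\<rfloor>" by linarith
          then have "(real (Suc n) * snd z - 1) / real (Suc n) \<le> real_of_int \<lfloor>real (Suc n) * snd z\<rfloor> / real (Suc n)"
            by (intro divide_right_mono) auto
          then show "snd z - 1 / real (Suc n) \<le> real_of_int \<lfloor>real (Suc n) * snd z\<rfloor> / real (Suc n)"
            by (simp add: diff_divide_distrib del: of_nat_Suc)
        qed
        show "eventually (\<lambda>n. real_of_int \<lfloor>real (Suc n) * snd z\<rfloor> / real (Suc n) \<le> snd z) sequentially"
        proof (intro always_eventually allI)
          fix n
          have "real_of_int \<lfloor>real (Suc n) * snd z\<rfloor> \<le> snd z * real (Suc n)"
            using of_int_floor_le[of "real (Suc n) * snd z"] by (simp add: mult.commute)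
          then show "real_of_int \<lfloor>real (Suc n) * snd z\<rfloor> / real (Suc n) \<le> snd z"
            by (simp add: pos_divide_le_eq del: of_nat_Suc)
        qed
      qed auto
      have "(\<lambda>n. cl n \<lfloor>real (Suc n) * snd z\<rfloor>) \<longlonglongrightarrow> max 0 (min T (snd z))"
        unfolding cl_def by (intro tendsto_max tendsto_min tendsto_const 1)
      then have 2: "(\<lambda>n. cl n \<lfloor>real (Suc n) * snd z\<rfloor>) \<longlonglongrightarrow> snd z" using True by simp
      have "(\<lambda>n. X (cl n \<lfloor>real (Suc n) * snd z\<rfloor>) (fst z)) \<longlonglongrightarrow> X (snd z) (fst z)"
        using continuous_on_tendsto_compose[OF c[OF z] 2 True] cl by auto
      then show ?thesis using True by simp
    qed simp
  qed
  then show ?thesis by (simp add: split_def)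
qed

text \<open>The integrator \<open>Z\<close> of the equation for \<open>r\<close> is the Ito process with drift \<open>-V\<close> and diffusion
coefficient \<open>1\<close>.\<close>

locale short_rate_model = brownian M W + model_parameters p q b
  for M :: "'a measure" and W :: "real \<Rightarrow> 'a \<Rightarrow> real" and p q b :: real +
  fixes V Z r :: "real \<Rightarrow> 'a \<Rightarrow> real" and a \<sigma> r0 :: real
  assumes V_prog: "progressively_measurable F V"
    and V_ito: "\<And>s. 0 \<le> s \<Longrightarrow>
      has_ito_integral M F W (\<lambda>\<tau> _. p * exp (- (p + q) * (s - \<tau>)) * kernel_l p q \<tau>) s (V s)"
    and sol: "strong_solution M F W (\<lambda>s \<omega>. - V s \<omega>) (\<lambda>_ _. 1) Z (\<lambda>_ x. a - b * x) (\<lambda>_ _. \<sigma>) r0 r"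
begin

definition noise :: "real \<Rightarrow> 'a \<Rightarrow> real" where "noise s \<omega> = wint kern kern' 0 s \<omega>"

lemma kern_cont: "continuous_on {0..t} kern"
  by (rule DERIV_imp_continuous_on[where f'=kern']) (auto intro: kern_deriv)

lemma noise_measurable: "0 \<le> s \<Longrightarrow> noise s \<in> borel_measurable M"
  unfolding noise_def[abs_def] by (rule wint_measurable) (auto intro: kern_deriv kern'_cont)

lemma noise_continuous: "continuous_on {0..} (\<lambda>t. W t \<omega>) \<Longrightarrow> continuous_on {0..T} (\<lambda>s. noise s \<omega>)"
  unfolding noise_def by (intro path_integral_continuous kern_cont kern'_cont) (auto elim: continuous_on_subset)

lemma V_eq_noise: 
  assumes s: "0 \<le> s"
  shows "AE \<omega> in M. V s \<omega> = decay s * noise s \<omega>"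
proof -
  let ?f = "\<lambda>\<tau>. p * exp (- (p + q) * (s - \<tau>)) * kernel_l p q \<tau>"
  have f: "?f \<tau> = decay s * kern \<tau>" for \<tau>
  proof -
    have "exp (- (p + q) * (s - \<tau>)) = exp (- (p + q) * s) * exp ((p + q) * \<tau>)"
      unfolding exp_add[symmetric] by (simp add: algebra_simps)
    then show ?thesis unfolding decay_def kern_def by (simp only: mult.assoc)
  qed
  have V: "has_ito_integral M F W (\<lambda>\<tau> _. decay s * kern \<tau>) s (V s)" using V_ito[OF s] unfolding f .
  have "has_ito_integral M F W (\<lambda>\<tau> _. decay s * kern \<tau>) s (wint (\<lambda>\<tau>. decay s * kern \<tau>) (\<lambda>\<tau>. decay s * kern' \<tau>) 0 s)"
  proof (rule has_ito_integral_smooth[OF s])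
    show "((\<lambda>\<tau>. decay s * kern \<tau>) has_real_derivative decay s * kern' x) (at x)" if "x \<in> {0..s}" for x
      using that by (intro DERIV_cmult kern_deriv) auto
    show "continuous_on {0..s} (\<lambda>\<tau>. decay s * kern' \<tau>)" by (intro continuous_intros kern'_cont)
    show "progressively_measurable F (\<lambda>\<tau> _. decay s * kern \<tau>)" using V by (simp add: has_ito_integral_def)
  qed
  from ito_integral_unique[OF V this s] show ?thesis unfolding path_integral_cmult noise_def .
qed

text \<open>For each time the two sides agree almost surely; Fubini's theorem makes them agree at almost every
time of almost every path. Joint measurability of the right-hand side is obtained after discarding
the discontinuous paths of \<open>W\<close>.\<close>

lemma V_eq_noise_path:
  assumes T: "0 \<le> T"
  shows "AE \<omega> in M. AE s in lborel. indicator {0..T} s * V s \<omega> = indicator {0..T} s * (decay s * noise s \<omega>)"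
proof -
  \<comment> \<open>The product of the indicator of this set with \<open>N\<close> has continuous paths without exception.\<close>
  define G where "G = {\<omega> \<in> space M. continuous_on {0..} (\<lambda>t. W t \<omega>)}"
  have aG: "AE \<omega> in M. \<omega> \<in> G" using W_cont AE_space by eventually_elim (simp add: G_def)
  define X where "X s \<omega> = (if \<omega> \<in> G then decay s * noise s \<omega> else 0)" for s \<omega>
  have X: "AE \<omega> in M. decay s * noise s \<omega> = X s \<omega>" for s using aG by eventually_elim (simp add: X_def)
  have Xm: "X s \<in> borel_measurable M" if "s \<in> {0..T}" for s
  proof (rule M_measurable_AE_cong[OF _ X])
    have "noise s \<in> borel_measurable M" using noise_measurable[of s] that by simp
    then show "(\<lambda>\<omega>. decay s * noise s \<omega>) \<in> borel_measurable M" by measurable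
  qed
  have Xc: "continuous_on {0..T} (\<lambda>s. X s \<omega>)" for \<omega>
  proof (cases "\<omega> \<in> G")
    case True
    then show ?thesis unfolding X_def by (simp add: G_def) (intro continuous_intros decay_cont noise_continuous; simp)
  next
    case False then show ?thesis by (simp add: X_def)
  qed
  have m1: "(\<lambda>(\<omega>, s). indicator {0..T} s * X s \<omega>) \<in> borel_measurable (M \<Otimes>\<^sub>M lborel)"
    by (rule continuous_joint_measurable[OF T Xc Xm])
  have m2: "(\<lambda>(\<omega>, s). indicator {0..T} s * V s \<omega>) \<in> borel_measurable (M \<Otimes>\<^sub>M lborel)"
    by (rule progressive_joint_measurable[OF V_prog T])
  interpret P: pair_sigma_finite M "lborel :: real measure" ..
  have "AE s in lborel. AE \<omega> in M. indicator {0..T} s * V s \<omega> = indicator {0..T} s * X s \<omega>"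
  proof (rule AE_I2)
    fix s :: real
    show "AE \<omega> in M. indicator {0..T} s * V s \<omega> = indicator {0..T} s * X s \<omega>"
    proof (cases "s \<in> {0..T}")
      case True
      then show ?thesis using V_eq_noise[of s] X[of s] by (auto elim!: AE_mp)
    qed simp
  qed
  moreover have "{z \<in> space (M \<Otimes>\<^sub>M lborel). indicator {0..T} (snd z) * V (snd z) (fst z) = indicator {0..T} (snd z) * X (snd z) (fst z)} \<in> sets (M \<Otimes>\<^sub>M lborel)"
    using m1 m2 unfolding split_def by (rule_tac borel_measurable_eq) auto
  ultimately have "AE \<omega> in M. AE s in lborel. indicator {0..T} s * V s \<omega> = indicator {0..T} s * X s \<omega>"
    using P.AE_commute[of "\<lambda>\<omega> s. indicator {0..T} s * V s \<omega> = indicator {0..T} s * X s \<omega>"] by simp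
  then show ?thesis using aG by eventually_elim (simp add: X_def)
qed

text \<open>The quantifier over \<open>h\<close> stands inside the almost sure statement, so one null set serves for all
weights and all times.\<close>

lemma drift_integral:
  assumes T: "0 \<le> T"
  shows "AE \<omega> in M. \<forall>t\<in>{0..T}. \<forall>h. continuous_on {0..T} h \<longrightarrow>
     set_integrable lborel {0..t} (\<lambda>s. h s * V s \<omega>) \<and>
     (LBINT s:{0..t}. h s * V s \<omega>) = integral {0..t} (\<lambda>s. h s * (decay s * noise s \<omega>))"
  using V_eq_noise_path[OF T] W_cont AE_space
proof eventually_elim
  case (elim \<omega>)
  show ?case
  proof (intro ballI allI impI)
    fix t and h :: "real \<Rightarrow> real" assume t: "t \<in> {0..T}" and h: "continuous_on {0..T} h"
    have sub: "{0..t} \<subseteq> {0..T}" using t by auto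
    have cont: "continuous_on {0..t} (\<lambda>s. h s * (decay s * noise s \<omega>))"
      by (intro continuous_intros continuous_on_subset[OF h sub] decay_cont noise_continuous elim)
    have [measurable]: "(\<lambda>s. indicator {0..t} s * h s) \<in> borel_measurable lborel"
      using borel_measurable_continuous_on_indicator[OF _ continuous_on_subset[OF h sub]] by simp
    have [measurable]: "(\<lambda>s. indicator {0..T} s * V s \<omega>) \<in> borel_measurable lborel"
      using measurable_Pair2[OF progressive_joint_measurable[OF V_prog T] elim(3)] by simp
    have m1: "(\<lambda>s. indicator {0..t} s *\<^sub>R (h s * V s \<omega>)) \<in> borel_measurable lborel"
    proof -
      have "(\<lambda>s. (indicator {0..t} s * h s) * (indicator {0..T} s * V s \<omega>)) \<in> borel_measurable lborel" by measurable
      moreover have "(\<lambda>s. (indicator {0..t} s * h s) * (indicator {0..T} s * V s \<omega>)) = (\<lambda>s. indicator {0..t} s *\<^sub>R (h s * V s \<omega>))"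
        using sub by (auto simp: fun_eq_iff indicator_def)
      ultimately show ?thesis by simp
    qed
    have i: "set_integrable lborel {0..t} (\<lambda>s. h s * (decay s * noise s \<omega>))"
      by (rule borel_integrable_atLeastAtMost'[OF cont])
    then have m2: "(\<lambda>s. indicator {0..t} s *\<^sub>R (h s * (decay s * noise s \<omega>))) \<in> borel_measurable lborel"
      unfolding set_integrable_def by auto
    have eq: "AE s in lborel. indicator {0..t} s *\<^sub>R (h s * V s \<omega>) = indicator {0..t} s *\<^sub>R (h s * (decay s * noise s \<omega>))"
      using elim(1) by eventually_elim (use sub in \<open>auto simp: indicator_def split: if_splits\<close>)
    show "set_integrable lborel {0..t} (\<lambda>s. h s * V s \<omega>) \<and>
     (LBINT s:{0..t}. h s * V s \<omega>) = integral {0..t} (\<lambda>s. h s * (decay s * noise s \<omega>))"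
      using i integrable_cong_AE[OF m1 m2 eq] integral_cong_AE[OF m1 m2 eq]
        LBINT_eq_integral[OF cont]
      by (simp add: set_integrable_def set_lebesgue_integral_def)
  qed
qed

lemma progressive_deterministic:
  assumes [measurable]: "f \<in> borel_measurable borel"
  shows "progressively_measurable F (\<lambda>s _. f s)"
  unfolding progressively_measurable_def
proof (intro allI impI)
  fix T :: real
  have 1: "f \<in> borel_measurable (restrict_space borel {0..T})"
    by (intro measurable_restrict_space1) measurable
  show "(\<lambda>(s, \<omega>). f s) \<in> borel_measurable (restrict_space borel {0..T} \<Otimes>\<^sub>M F T)"
    using measurable_compose[OF measurable_fst 1] by (simp add: split_def)
qed

lemma r_cont: "AE \<omega> in M. continuous_on {0..} (\<lambda>t. r t \<omega>)"
  using sol by (simp add: strong_solution_def)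

lemma r_equation_at:
  assumes s: "0 \<le> s"
  shows "AE \<omega> in M. r s \<omega> = r0 + (a * s - b * integral {0..s} (\<lambda>u. r u \<omega>))
    + \<sigma> * (W s \<omega> - integral {0..s} (\<lambda>u. decay u * noise u \<omega>))"
proof -
  let ?X = "\<lambda>\<omega>. r s \<omega> - r0 - (LBINT u:{0..s}. a - b * r u \<omega>) - (LBINT u:{0..s}. \<sigma> * (- V u \<omega>))"
  have X: "has_ito_integral M F W (\<lambda>_ _. \<sigma> * 1) s ?X"
    using sol s by (simp add: strong_solution_def has_ito_process_integral_def)
  have "has_ito_integral M F W (\<lambda>_ _. \<sigma> * 1) s (wint (\<lambda>_. \<sigma> * 1) (\<lambda>_. 0) 0 s)"
    using s by (intro has_ito_integral_smooth progressive_deterministic) auto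
  from ito_integral_unique[OF X this s] drift_integral[OF s] r_cont W_null
  show ?thesis
  proof eventually_elim
    case (elim \<omega>)
    have "(LBINT u:{0..s}. (- \<sigma>) * V u \<omega>) = integral {0..s} (\<lambda>u. (- \<sigma>) * (decay u * noise u \<omega>))"
      using elim(2)[rule_format, of s "\<lambda>_. - \<sigma>"] s by simp
    then have 1: "(LBINT u:{0..s}. \<sigma> * (- V u \<omega>)) = - \<sigma> * integral {0..s} (\<lambda>u. decay u * noise u \<omega>)"
      by simp
    have c: "continuous_on {0..s} (\<lambda>t. r t \<omega>)" using elim(3) by (rule continuous_on_subset) auto
    have "(LBINT u:{0..s}. a - b * r u \<omega>) = integral {0..s} (\<lambda>u. a - b * r u \<omega>)"
      by (intro LBINT_eq_integral continuous_intros c)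
    also have "\<dots> = integral {0..s} (\<lambda>u. a) - integral {0..s} (\<lambda>u. b * r u \<omega>)"
      by (intro Henstock_Kurzweil_Integration.integral_diff integrable_continuous_real continuous_intros c)
    also have "\<dots> = a * s - b * integral {0..s} (\<lambda>u. r u \<omega>)" using s by (simp add: mult.commute)
    finally show ?case using elim(1,4) 1 by (simp add: path_integral_def algebra_simps)
  qed
qed

text \<open>The equation holds almost surely at each time, hence simultaneously at all rational times, and both
sides are continuous.\<close>

lemma r_equation:
  assumes T: "0 < T"
  shows "AE \<omega> in M. \<forall>x\<in>{0..T}. r x \<omega> = r0 + (a * x - b * integral {0..x} (\<lambda>u. r u \<omega>))
    + \<sigma> * (W x \<omega> - integral {0..x} (\<lambda>u. decay u * noise u \<omega>))"
proof -
  let ?Q = "{0<..<T} \<inter> \<rat>"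
  let ?d = "\<lambda>x \<omega>. r x \<omega> - (r0 + (a * x - b * integral {0..x} (\<lambda>u. r u \<omega>))
    + \<sigma> * (W x \<omega> - integral {0..x} (\<lambda>u. decay u * noise u \<omega>)))"
  have "countable ?Q" by (intro countable_Int2 countable_rat)
  moreover have "AE \<omega> in M. ?d x \<omega> = 0" if "x \<in> ?Q" for x
    using r_equation_at[of x] that by simp
  ultimately have "AE \<omega> in M. \<forall>x\<in>?Q. ?d x \<omega> = 0" by (simp add: AE_ball_countable)
  then show ?thesis using r_cont W_cont
  proof eventually_elim
    case (elim \<omega>)
    have cr: "continuous_on {0..T} (\<lambda>t. r t \<omega>)" and cW: "continuous_on {0..T} (\<lambda>t. W t \<omega>)"
      using elim(2,3) by (auto elim: continuous_on_subset)
    have cg: "continuous_on {0..T} (\<lambda>u. decay u * noise u \<omega>)" by (intro continuous_intros decay_cont noise_continuous elim)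
    have "continuous_on {0..T} (\<lambda>x. ?d x \<omega>)"
      by (intro continuous_intros cr cW indefinite_integral_continuous_1 integrable_continuous_real cg)
    moreover have "closure ?Q = {0..T}"
      using T closure_open_Int_superset[of "{0<..<T}" "\<rat>"] by (simp add: Rats_closure_real)
    ultimately have "?d x \<omega> = 0" if "x \<in> {0..T}" for x
      using continuous_constant_on_closure[of ?Q "\<lambda>x. ?d x \<omega>" 0 x] elim(1) that by auto
    then show ?case by simp
  qed
qed

lemma integrated_short_rate:
  assumes t: "0 \<le> t" "t < T"
  shows "AE \<omega> in M. (LBINT s:{t..T}. r s \<omega>) = rate_load T t * r t \<omega> + a / b * (T - t - rate_load T t)
     + \<sigma> * (wint (vol T) (vol' T) t T \<omega> - noise_load T t * noise t \<omega>)"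
proof -
  have T: "0 < T" using t by simp
  have at_T: "rate_load T T = 0" "noise_load T T = 0" by (simp_all add: rate_load_def noise_load_def mcoef_0)
  from r_equation[OF T] r_cont W_cont W_null show ?thesis
  proof eventually_elim
    case (elim \<omega>)
    have cr: "continuous_on {0..T} (\<lambda>t. r t \<omega>)" and cW: "continuous_on {0..T} (\<lambda>t. W t \<omega>)"
      using elim(2,3) by (auto elim: continuous_on_subset)
    have "integral {t..T} (\<lambda>s. r s \<omega>) = rate_load T t * r t \<omega> + a / b * (T - t - rate_load T t)
     + \<sigma> * (path_integral (\<lambda>s. W s \<omega>) (\<lambda>x. rate_load T x - noise_load T x * kern x) (\<lambda>x. b * rate_load T x - 1 + decay x * rate_load T x * kern x - noise_load T x * kern' x) t T
        - noise_load T t * path_integral (\<lambda>s. W s \<omega>) kern kern' 0 t)"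
    proof (rule integrated_short_rate_path[where ?r0.0=r0])
      show "r x \<omega> = r0 + (a * x - b * integral {0..x} (\<lambda>s. r s \<omega>)) + \<sigma> * (W x \<omega> - integral {0..x} (\<lambda>s. decay s * path_integral (\<lambda>s. W s \<omega>) kern kern' 0 s))"
        if "x \<in> {0..T}" for x using elim(1) that unfolding noise_def by blast
    qed (use t b cr cW elim(4) in \<open>auto intro: rate_load_deriv noise_load_deriv[simplified] kern_deriv kern'_cont decay_cont simp: at_T\<close>)
    moreover have "(LBINT s:{t..T}. r s \<omega>) = integral {t..T} (\<lambda>s. r s \<omega>)"
      by (rule LBINT_eq_integral, rule continuous_on_subset[OF cr]) (use t in auto)
    ultimately show ?case by (simp add: vol_def[abs_def] vol'_def[abs_def] noise_def)
  qed
qed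

lemma V_F_measurable: "0 \<le> t \<Longrightarrow> V t \<in> borel_measurable (F t)"
proof -
  assume t: "0 \<le> t"
  have 1: "(\<lambda>(s, \<omega>). V s \<omega>) \<in> borel_measurable (restrict_space borel {0..t} \<Otimes>\<^sub>M F t)"
    using V_prog t by (simp add: progressively_measurable_def)
  have "t \<in> space (restrict_space borel {0..t})" using t by (simp add: space_restrict_space)
  from measurable_compose[OF measurable_Pair1'[OF this] 1] show ?thesis by simp
qed

text \<open>The past enters through \<open>r(t)\<close> and \<open>N(t)\<close>. To have a version of \<open>N(t)\<close> that is measurable with
respect to the past, \<open>noise_load * N\<close> is written as a multiple of \<open>V(t)\<close>.\<close>

lemma bond_price_eq:
  assumes t: "0 \<le> t" "t < T"
  shows "AE \<omega> in M. bond_price M F r t T \<omega> =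
    exp (- (rate_load T t * r t \<omega> + a / b * (T - t - rate_load T t)) + \<sigma> * noise_load T t * noise t \<omega>
      + \<sigma>\<^sup>2 * integral {t..T} (\<lambda>x. (vol T x)\<^sup>2) / 2)"
proof -
  \<comment> \<open>As \<open>V = p e^(-(p+q)t) N\<close>, the factor \<open>p\<close> of \<open>m\<close> must be split off; for \<open>p = 0\<close> both sides vanish.\<close>
  define u where "u = exp_primitive (p + q) (T - t) - exp (- b * (T - t)) * exp_primitive (p + q - b) (T - t)"
  have u: "mcoef (T - t) = p * u" by (simp add: mcoef_def u_def algebra_simps)
  define G where "G \<omega> = - (rate_load T t * r t \<omega> + a / b * (T - t - rate_load T t)) + \<sigma> * (u / b * V t \<omega>)" for \<omega>
  have kV: "AE \<omega> in M. u / b * V t \<omega> = noise_load T t * noise t \<omega>"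
    using V_eq_noise[OF t(1)] by eventually_elim (simp add: noise_load_def u decay_def)
  have rF: "r t \<in> borel_measurable (F t)" using sol t by (simp add: strong_solution_def adapted_def)
  have G: "G \<in> borel_measurable (F t)"
    unfolding G_def using rF V_F_measurable[OF t(1)] by measurable
  define f f' where "f = (\<lambda>x. - \<sigma> * vol T x)" and "f' = (\<lambda>x. - \<sigma> * vol' T x)"
  have f: "(f has_real_derivative f' x) (at x)" if "x \<in> {t..T}" for x
    unfolding f_def f'_def using that t by (intro DERIV_cmult vol_deriv) auto
  have f': "continuous_on {t..T} f'"
    unfolding f'_def by (intro continuous_intros continuous_on_subset[OF vol'_cont[of T]]) (use t in auto)
  let ?Y = "\<lambda>\<omega>. exp (G \<omega> + wint f f' t T \<omega>)"
  have eq: "AE \<omega> in M. ?Y \<omega> = exp (- (LBINT s:{t..T}. r s \<omega>))"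
    using integrated_short_rate[OF t] kV
  proof eventually_elim
    case (elim \<omega>)
    have "wint f f' t T \<omega> = - \<sigma> * wint (vol T) (vol' T) t T \<omega>"
      unfolding f_def f'_def by (rule path_integral_cmult)
    then show ?case using elim by (simp add: G_def algebra_simps)
  qed
  have wm: "wint f f' t T \<in> borel_measurable M"
    using f by (intro wint_measurable f') (use t in auto)
  have Ym: "?Y \<in> borel_measurable M" using wm F_measurable_M[OF G] by measurable
  interpret S: finite_measure_subalgebra M "F t" by unfold_locales (rule F_subalgebra)
  have "AE \<omega> in M. real_cond_exp M (F t) ?Y \<omega> = bond_price M F r t T \<omega>"
    unfolding bond_price_def
    by (rule S.real_cond_exp_cong[OF eq Ym M_measurable_AE_cong[OF Ym eq]])
  moreover have "AE \<omega> in M. real_cond_exp M (F t) ?Y \<omega> = exp (G \<omega> + integral {t..T} (\<lambda>x. (f x)\<^sup>2) / 2)"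
    using f t by (intro cond_exp_exp_wint f' G) auto
  moreover have "AE \<omega> in M. integral {t..T} (\<lambda>x. (f x)\<^sup>2) = \<sigma>\<^sup>2 * integral {t..T} (\<lambda>x. (vol T x)\<^sup>2)"
    unfolding f_def by (simp add: power_mult_distrib)
  ultimately show ?thesis using kV
  proof eventually_elim
    case (elim \<omega>)
    have "G \<omega> = - (rate_load T t * r t \<omega> + a / b * (T - t - rate_load T t)) + \<sigma> * noise_load T t * noise t \<omega>"
      using elim(4) by (simp add: G_def mult.assoc)
    then show ?case using elim(1,2,3) by simp
  qed
qed

text \<open>The integral in \<open>U\<close> is a chosen version. The candidate built from the pathwise integral shows that a
version exists, and uniqueness identifies the chosen one with it.\<close>

lemma term_U_eq:
  assumes t: "0 \<le> t" "t < T"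
  shows "AE \<omega> in M. term_U M F W (\<lambda>s \<omega>. - V s \<omega>) (\<lambda>_ _. 1) Z p q b \<sigma> t T \<omega> = \<sigma> * noise_load T t * noise t \<omega>"
proof -
  let ?H = "has_ito_process_integral M F W (\<lambda>s \<omega>. - V s \<omega>) (\<lambda>_ _. 1) Z (\<lambda>s _. \<phi> s) t"
  let ?J = "ito_process_integral M F W (\<lambda>s \<omega>. - V s \<omega>) (\<lambda>_ _. 1) Z (\<lambda>s _. \<phi> s) t"
  have prog: "progressively_measurable F (\<lambda>s _. \<phi> s)"
    by (intro progressive_deterministic borel_measurable_continuous_onI phi_cont)
  have smooth: "has_ito_integral M F W (\<lambda>s _. \<phi> s * 1) t (wint \<phi> \<phi>' 0 t)"
    using has_ito_integral_smooth[OF t(1) phi_deriv phi'_cont prog] by simp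
  have drift: "AE \<omega> in M. set_integrable lborel {0..t} (\<lambda>s. \<phi> s * - V s \<omega>) \<and>
      (LBINT s:{0..t}. \<phi> s * - V s \<omega>) = - integral {0..t} (\<lambda>s. \<phi> s * (decay s * noise s \<omega>))"
    using drift_integral[OF t(1)]
  proof eventually_elim
    case (elim \<omega>)
    have c: "continuous_on {0..t} (\<lambda>s. - \<phi> s)" by (intro continuous_intros phi_cont)
    from elim[rule_format, OF _ c, of t] t show ?case by simp
  qed
  have "?H (\<lambda>\<omega>. wint \<phi> \<phi>' 0 t \<omega> + (LBINT s:{0..t}. \<phi> s * - V s \<omega>))"
    unfolding has_ito_process_integral_def
  proof (intro conjI prog)
    show "ito_process M F W (\<lambda>s \<omega>. - V s \<omega>) (\<lambda>_ _. 1) Z"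
      using sol unfolding strong_solution_def has_ito_process_integral_def by blast
    show "AE \<omega> in M. set_integrable lborel {0..t} (\<lambda>s. \<phi> s * - V s \<omega>)"
      using drift by eventually_elim simp
    show "has_ito_integral M F W (\<lambda>s \<omega>. \<phi> s * 1) t
       (\<lambda>\<omega>. wint \<phi> \<phi>' 0 t \<omega> + (LBINT s:{0..t}. \<phi> s * - V s \<omega>) - (LBINT s:{0..t}. \<phi> s * - V s \<omega>))"
      using smooth by simp
  qed
  then have "?H ?J" unfolding ito_process_integral_def by (rule someI[where P="?H"])
  then have "has_ito_integral M F W (\<lambda>s \<omega>. \<phi> s * 1) t (\<lambda>\<omega>. ?J \<omega> - (LBINT s:{0..t}. \<phi> s * - V s \<omega>))"
    by (simp add: has_ito_process_integral_def)
  from ito_integral_unique[OF this smooth t(1)] drift W_cont W_null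
  show ?thesis
  proof eventually_elim
    case (elim \<omega>)
    have cW: "continuous_on {0..t} (\<lambda>t. W t \<omega>)"
      using elim(3) by (auto elim: continuous_on_subset)
    have "path_integral (\<lambda>s. W s \<omega>) \<phi> \<phi>' 0 t - integral {0..t} (\<lambda>s. \<phi> s * (decay s * path_integral (\<lambda>s. W s \<omega>) kern kern' 0 s))
       = \<rho> t * path_integral (\<lambda>s. W s \<omega>) kern kern' 0 t"
      by (rule integral_against_drifted_path)
        (use t cW elim(4) in \<open>auto intro: decay_cont rho_deriv[simplified] kern_deriv kern'_cont phi_eq phi'_eq\<close>)
    then have J: "?J \<omega> = \<rho> t * noise t \<omega>" using elim(1,2) by (simp add: noise_def)
    have "T - t \<ge> 0" using t by simp
    from coef_m_eq_mcoef[OF this]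
    have "term_U M F W (\<lambda>s \<omega>. - V s \<omega>) (\<lambda>_ _. 1) Z p q b \<sigma> t T \<omega>
       = \<sigma> * (p + 2 * q)\<^sup>2 * exp (q * t) * mcoef (T - t) / (b * den t) * (\<rho> t * noise t \<omega>)"
      unfolding term_U_def den_def J[symmetric] \<phi>_def by simp
    also have "\<dots> = \<sigma> * (mcoef (T - t) / b * (exp (q * t) * exp (- (p + 2 * q) * t))) * noise t \<omega>"
      unfolding \<rho>_def using E_pos den_nz[OF t(1)] b by (simp add: field_simps)
    also have "exp (q * t) * exp (- (p + 2 * q) * t) = exp (- (p + q) * t)"
      unfolding exp_add[symmetric] by (simp add: algebra_simps)
    finally show ?case unfolding noise_load_def .
  qed
qed

theorem bond_yield_eq:
  assumes t: "0 \<le> t" "t < T"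
  shows "AE \<omega> in M. bond_yield M F r t T \<omega> =
    coef_A p q a b \<sigma> t T / (T - t) + coef_C b t T / (T - t) * r t \<omega>
    - term_U M F W (\<lambda>s \<omega>. - V s \<omega>) (\<lambda>_ _. 1) Z p q b \<sigma> t T \<omega> / (T - t)"
  using bond_price_eq[OF t] term_U_eq[OF t]
proof eventually_elim
  case (elim \<omega>)
  let ?h = "\<lambda>s. (mcoef s + exp (- b * s) - 1)\<^sup>2"
  have "continuous_on {0..T - t} ?h"
    by (intro continuous_intros DERIV_imp_continuous_on[OF mcoef_deriv])
  from LBINT_eq_integral[OF this]
  have I: "(LBINT s:{0..T - t}. (coef_m p q b s + exp (- b * s) - 1)\<^sup>2) = integral {0..T - t} ?h"
    by (subst set_lebesgue_integral_cong[where g="?h"]) (auto simp: coef_m_eq_mcoef)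
  have C: "coef_C b t T = rate_load T t" by (simp add: coef_C_def rate_load_def)
  have A: "coef_A p q a b \<sigma> t T = a / b * (T - t - rate_load T t) - \<sigma>\<^sup>2 * integral {t..T} (\<lambda>x. (vol T x)\<^sup>2) / 2"
    unfolding coef_A_def I C integral_vol_square[OF t(1) less_imp_le[OF t(2)]]
    using t b den_nz[OF t(1)] coef_m_eq_mcoef[of "T - t"] unfolding den_def[symmetric]
    by (simp add: field_simps)
  show ?case unfolding bond_yield_def elim A C ln_exp minus_divide_left
    by (simp add: add_divide_distrib diff_divide_distrib)
qed

end

theorem theorem3p2:
  fixes M :: "'a measure" and F :: "real \<Rightarrow> 'a measure"
    and W V Z r :: "real \<Rightarrow> 'a \<Rightarrow> real"
    and p q a b \<sigma> r0 :: real
  assumes "prob_space M" and "complete_measure M"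
    and "standard_brownian_motion M W"
    and "F = augmented_filtration M W"
    and "0 < q" and "- q < p"
    and "progressively_measurable F V"
    and "\<And>s. 0 \<le> s \<Longrightarrow>
           has_ito_integral M F W (\<lambda>\<tau> _. p * exp (- (p + q) * (s - \<tau>)) * kernel_l p q \<tau>) s (V s)"
    and "AE \<omega> in M. \<forall>t\<ge>0. Z t \<omega> = W t \<omega> - (LBINT s:{0..t}. V s \<omega>)"
    and "0 < a" and "0 < b" and "0 < \<sigma>" and "0 \<le> r0"
    and "strong_solution M F W (\<lambda>s \<omega>. - V s \<omega>) (\<lambda>_ _. 1) Z
           (\<lambda>_ x. a - b * x) (\<lambda>_ _. \<sigma>) r0 r"
  shows "(\<forall>t T. 0 \<le> t \<and> t < T \<longrightarrow>
            (AE \<omega> in M. bond_yield M F r t T \<omega> =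
               coef_A p q a b \<sigma> t T / (T - t) + coef_C b t T / (T - t) * r t \<omega>
               - term_U M F W (\<lambda>s \<omega>. - V s \<omega>) (\<lambda>_ _. 1) Z p q b \<sigma> t T \<omega> / (T - t))) \<and>
         (\<forall>T>0. AE \<omega> in M. bond_yield M F r 0 T \<omega> =
               coef_A p q a b \<sigma> 0 T / T + coef_C b 0 T / T * r0)"
proof -
  interpret prob_space M by fact
  interpret complete_measure M by fact
  interpret short_rate_model M W p q b V Z r a \<sigma> r0
    using assms by unfold_locales simp_all
  have F: "F = augmented_filtration M W" by fact
  have "AE \<omega> in M. bond_yield M F r 0 T \<omega> = coef_A p q a b \<sigma> 0 T / T + coef_C b 0 T / T * r0" if "0 < T" for T
  proof -
    have "AE \<omega> in M. r 0 \<omega> = r0" using sol by (simp add: strong_solution_def)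
    then show ?thesis using bond_yield_eq[of 0 T] term_U_eq[of 0 T] W_null that unfolding F
      by (auto simp: noise_def path_integral_def elim!: AE_mp)
  qed
  then show ?thesis using bond_yield_eq unfolding F by auto
qed

end
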